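(* Let $\mu>3/2$, $-1<\sigma\le 0$ and $\beta>0$ be fixed. Then the Bargmann-type transform $\mathcal{B}_{\mu,\sigma}:L^2(\mathbb{R}_+,d\xi)\longrightarrow\mathcal{A}_{\mu,\sigma}(\mathbb{C})$ defined by $$\mathcal{B}_{\mu,\sigma}[\varphi](z)=\sqrt{\frac{2\beta^{\mu}}{\Gamma(\mu)}}\int_0^{\infty}\xi^{\mu-\frac12}e^{-\frac12\beta\xi^2}\,F^{1:0;0}_{1:0;1}\left(\begin{array}{c}1:-;-;\\ \sigma+1:-;\mu;\end{array}\Big\vert\,z,-\beta z\xi^2\right)\varphi(\xi)\,d\xi,\qquad z\in\mathbb{C},$$ is a unitary map. For $\sigma=0$ it reduces to $$\mathcal{B}_{\mu,0}[\varphi](z)=\sqrt{2\beta\,\Gamma(\mu)}\;z^{\frac{1-\mu}{2}}e^{z}\int_0^{\infty}\xi^{\frac12}e^{-\frac12\beta\xi^2}J_{\mu-1}\left(2\sqrt{\beta z}\,\xi\right)\varphi(\xi)\,d\xi.$$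
   Context: $(a)_0=1$, $(a)_n=a(a+1)\cdots(a+n-1)$. The Kampé de Fériet function used here is $$F^{1:0;0}_{1:0;1}\left(\begin{array}{c}1:-;-;\\ \sigma+1:-;\mu;\end{array}\Big\vert\,x,y\right)=\sum_{r,s\ge0}\frac{(1)_{r+s}}{(\sigma+1)_{r+s}\,(\mu)_s}\,\frac{x^r}{r!}\frac{y^s}{s!}.$$ $\mathcal{A}_{\mu,\sigma}(\mathbb{C})$ is the reproducing kernel Hilbert space of entire functions on $\mathbb{C}$ with reproducing kernel $$\mathcal{K}(z,\overline{w})={}_{2}F_{3}\left(\begin{array}{c}1,1\\ \mu,\sigma+1,\sigma+1\end{array}\Big\vert\, z\bar w\right)=\sum_{n\ge0}\frac{n!}{(\mu)_n(\sigma+1)_n^2}(z\bar w)^n ;$$ it is a closed subspace of $L^2(\mathbb{C},d\nu_{\mu,\sigma})$ (with the inner product of that space), where $$d\nu_{\mu,\sigma}(z)=\frac{2}{\Gamma(\mu)\Gamma^2(\sigma+1)}\,G^{30}_{13}\left(z\bar z\,\Big\vert\,\begin{array}{c}0\\ \mu-1,\sigma,\sigma\end{array}\right)d\varrho(z),\qquad d\varrho(z)=\frac{1}{2\pi}\rho\,d\rho\,d\theta\ \ (z=\rho e^{i\theta}),$$ and for $r>0$ the Meijer G-function is $$G^{30}_{13}\left(r\,\Big\vert\,\begin{array}{c}a_1\\ b_1,b_2,b_3\end{array}\right)=\frac{1}{2\pi i}\int_{c-i\infty}^{c+i\infty}\frac{\Gamma(b_1+s)\Gamma(b_2+s)\Gamma(b_3+s)}{\Gamma(a_1+s)}r^{-s}ds,\quad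 c>\max_j(-\Re b_j).$$ $J_\nu$ is the Bessel function of the first kind of order $\nu$. In the $\sigma=0$ formula, $z^{\frac{1-\mu}{2}}$ and $\sqrt{z}$ use the same branch of $\log z$ (the product is then independent of the branch), and the value at $z=0$ is understood by continuous extension. *)

theory Defs
  imports "HOL-Analysis.Analysis"
begin

section \<open>Special functions\<close>

definition hypergeometric :: "complex list \<Rightarrow> complex list \<Rightarrow> complex \<Rightarrow> complex" where
  "hypergeometric as bs x =
     (\<Sum>n. (\<Prod>a\<leftarrow>as. pochhammer a n) / (\<Prod>b\<leftarrow>bs. pochhammer b n) * x ^ n / fact n)"

text \<open>The Kampe de Feriet function with upper and lower indices 1:0;0 and 1:0;1.\<close>

definition kampe_de_feriet :: "complex \<Rightarrow> complex \<Rightarrow> complex \<Rightarrow> complex \<Rightarrow> complex \<Rightarrow> complex" where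
  "kampe_de_feriet a c d x y =
     (\<Sum>\<^sub>\<infinity>(r, s)\<in>UNIV. pochhammer a (r + s) / (pochhammer c (r + s) * pochhammer d s)
        * (x ^ r / fact r) * (y ^ s / fact s))"

text \<open>The Bessel function of the first kind, on the principal sheet.\<close>

definition bessel_J :: "complex \<Rightarrow> complex \<Rightarrow> complex" where
  "bessel_J \<nu> x =
     (x / 2) powr \<nu> * (\<Sum>k. (- 1) ^ k / (fact k * Gamma (\<nu> + of_nat k + 1)) * (x / 2) ^ (2 * k))"

text \<open>
  The Meijer function with upper indices 3,0 and lower indices 1,3, for positive real argument.
  The Mellin--Barnes integral along the line \<open>Re s = c\<close>, parametrized as \<open>s = c + \<i> t\<close>, is
  the same for every \<open>c > max (- Re b\<^sub>j)\<close>; we fix one such \<open>c\<close>.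
\<close>

definition meijer_G3013 :: "complex \<Rightarrow> complex \<Rightarrow> complex \<Rightarrow> complex \<Rightarrow> real \<Rightarrow> complex" where
  "meijer_G3013 a\<^sub>1 b\<^sub>1 b\<^sub>2 b\<^sub>3 r =
     (let c = Max {- Re b\<^sub>1, - Re b\<^sub>2, - Re b\<^sub>3} + 1 in
      1 / (2 * of_real pi * \<i>) *
      (\<integral>t. (let s = Complex c t in
             Gamma (b\<^sub>1 + s) * Gamma (b\<^sub>2 + s) * Gamma (b\<^sub>3 + s) / Gamma (a\<^sub>1 + s)
               * of_real r powr (- s)) * \<i> \<partial>lborel))"


section \<open>Function spaces\<close>

text \<open>
  Square-integrable functions are represented by functions rather than by classes modulo
  equality almost everywhere, so \<open>l2_inner M\<close> is only semidefinite on \<open>L2 M\<close>.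
\<close>

definition L2 :: "'a measure \<Rightarrow> ('a \<Rightarrow> complex) set" where
  "L2 M = {f \<in> borel_measurable M. integrable M (\<lambda>x. (cmod (f x))\<^sup>2)}"

definition l2_inner :: "'a measure \<Rightarrow> ('a \<Rightarrow> complex) \<Rightarrow> ('a \<Rightarrow> complex) \<Rightarrow> complex" where
  "l2_inner M f g = (\<integral>x. f x * cnj (g x) \<partial>M)"

definition function_hilbert_space ::
  "('a \<Rightarrow> complex) set \<Rightarrow> (('a \<Rightarrow> complex) \<Rightarrow> ('a \<Rightarrow> complex) \<Rightarrow> complex) \<Rightarrow> bool" where
  "function_hilbert_space H ip \<longleftrightarrow>
     (\<lambda>x. 0) \<in> H \<and>
     (\<forall>f\<in>H. \<forall>g\<in>H. (\<lambda>x. f x + g x) \<in> H) \<and>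
     (\<forall>c. \<forall>f\<in>H. (\<lambda>x. c * f x) \<in> H) \<and>
     (\<forall>f\<in>H. \<forall>g\<in>H. \<forall>h\<in>H. ip (\<lambda>x. f x + g x) h = ip f h + ip g h) \<and>
     (\<forall>c. \<forall>f\<in>H. \<forall>g\<in>H. ip (\<lambda>x. c * f x) g = c * ip f g) \<and>
     (\<forall>f\<in>H. \<forall>g\<in>H. ip g f = cnj (ip f g)) \<and>
     (\<forall>f\<in>H. Re (ip f f) \<ge> 0 \<and> (ip f f = 0 \<longrightarrow> f = (\<lambda>x. 0))) \<and>
     (let nrm = (\<lambda>f. sqrt (Re (ip f f))) in
      \<forall>F. (\<forall>n::nat. F n \<in> H) \<and>
          (\<forall>\<epsilon>>0. \<exists>N. \<forall>m\<ge>N. \<forall>n\<ge>N. nrm (\<lambda>x. F m x - F n x) < \<epsilon>) \<longrightarrow>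
          (\<exists>f\<in>H. (\<lambda>n. nrm (\<lambda>x. F n x - f x)) \<longlonglongrightarrow> 0))"

definition reproducing_kernel_hilbert_space ::
  "('a \<Rightarrow> complex) set \<Rightarrow> (('a \<Rightarrow> complex) \<Rightarrow> ('a \<Rightarrow> complex) \<Rightarrow> complex) \<Rightarrow>
   ('a \<Rightarrow> 'a \<Rightarrow> complex) \<Rightarrow> bool" where
  "reproducing_kernel_hilbert_space H ip K \<longleftrightarrow>
     function_hilbert_space H ip \<and>
     (\<forall>w. (\<lambda>z. K z w) \<in> H \<and> (\<forall>f\<in>H. f w = ip f (\<lambda>z. K z w)))"

text \<open>
  On spaces of representatives with a semidefinite form \<open>ip\<close>, a map satisfying this with a
  definite form \<open>ip'\<close> identifies exactly the functions at distance zero (by linearity and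
  isometry), so it induces a unitary operator on the quotient.
\<close>

definition unitary_map ::
  "('a \<Rightarrow> complex) set \<Rightarrow> (('a \<Rightarrow> complex) \<Rightarrow> ('a \<Rightarrow> complex) \<Rightarrow> complex) \<Rightarrow>
   ('b \<Rightarrow> complex) set \<Rightarrow> (('b \<Rightarrow> complex) \<Rightarrow> ('b \<Rightarrow> complex) \<Rightarrow> complex) \<Rightarrow>
   (('a \<Rightarrow> complex) \<Rightarrow> ('b \<Rightarrow> complex)) \<Rightarrow> bool" where
  "unitary_map H ip H' ip' T \<longleftrightarrow>
     (\<forall>f\<in>H. \<forall>g\<in>H. T (\<lambda>x. f x + g x) = (\<lambda>z. T f z + T g z)) \<and>
     (\<forall>c. \<forall>f\<in>H. T (\<lambda>x. c * f x) = (\<lambda>z. c * T f z)) \<and>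
     (\<forall>f\<in>H. \<forall>g\<in>H. ip' (T f) (T g) = ip f g) \<and>
     T ` H = H'"


section \<open>The space of entire functions\<close>

text \<open>
  The measure \<open>\<rho> d\<rho> d\<theta> / (2 \<pi>)\<close> is Lebesgue measure on the plane divided by \<open>2 \<pi>\<close>.
  The Meijer function is complex-valued by definition; for these parameters and positive
  argument its values are real and nonnegative.
\<close>

definition nu_measure :: "real \<Rightarrow> real \<Rightarrow> complex measure" where
  "nu_measure \<mu> \<sigma> = density lborel (\<lambda>z. ennreal (
     2 / (Gamma \<mu> * (Gamma (\<sigma> + 1))\<^sup>2)
     * Re (meijer_G3013 0 (of_real (\<mu> - 1)) (of_real \<sigma>) (of_real \<sigma>) ((cmod z)\<^sup>2))
     * (1 / (2 * pi))))"

definition entire_kernel :: "real \<Rightarrow> real \<Rightarrow> complex \<Rightarrow> complex \<Rightarrow> complex" where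
  "entire_kernel \<mu> \<sigma> z w =
     hypergeometric [1, 1] [of_real \<mu>, of_real (\<sigma> + 1), of_real (\<sigma> + 1)] (z * cnj w)"

text \<open>
  Since the inner product and the kernel are prescribed, there is at most one such space: it is
  the set of limits of linear combinations of the functions \<open>\<lambda>z. entire_kernel \<mu> \<sigma> z w\<close>.
\<close>

definition entire_space :: "real \<Rightarrow> real \<Rightarrow> (complex \<Rightarrow> complex) set" where
  "entire_space \<mu> \<sigma> = (THE H.
     (\<forall>f\<in>H. f holomorphic_on UNIV) \<and>
     H \<subseteq> L2 (nu_measure \<mu> \<sigma>) \<and>
     reproducing_kernel_hilbert_space H (l2_inner (nu_measure \<mu> \<sigma>)) (entire_kernel \<mu> \<sigma>))"


section \<open>The Bargmann-type transform\<close>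

abbreviation half_line :: "real measure" where
  "half_line \<equiv> lebesgue_on {0<..}"

definition bargmann_kernel :: "real \<Rightarrow> real \<Rightarrow> real \<Rightarrow> complex \<Rightarrow> real \<Rightarrow> complex" where
  "bargmann_kernel \<mu> \<sigma> \<beta> z \<xi> =
     of_real (\<xi> powr (\<mu> - 1/2) * exp (- (1/2) * \<beta> * \<xi>\<^sup>2))
     * kampe_de_feriet 1 (of_real (\<sigma> + 1)) (of_real \<mu>) z (- of_real \<beta> * z * of_real (\<xi>\<^sup>2))"

definition bargmann :: "real \<Rightarrow> real \<Rightarrow> real \<Rightarrow> (real \<Rightarrow> complex) \<Rightarrow> complex \<Rightarrow> complex" where
  "bargmann \<mu> \<sigma> \<beta> \<phi> z =
     of_real (sqrt (2 * \<beta> powr \<mu> / Gamma \<mu>))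
     * (\<integral>\<xi>. bargmann_kernel \<mu> \<sigma> \<beta> z \<xi> * \<phi> \<xi> \<partial>half_line)"

text \<open>
  The Bessel form of the transform, with the principal branch of the logarithm in \<open>csqrt\<close>,
  \<open>powr\<close> and \<open>bessel_J\<close>. The argument of \<open>csqrt\<close> lies in the principal range of the power in
  \<open>bessel_J\<close>, so the branches match. At \<open>z = 0\<close> the value is not the intended one (there
  \<open>0 powr a = 0\<close>) and has to be replaced by the limit.
\<close>

definition bargmann_bessel :: "real \<Rightarrow> real \<Rightarrow> (real \<Rightarrow> complex) \<Rightarrow> complex \<Rightarrow> complex" where
  "bargmann_bessel \<mu> \<beta> \<phi> z =
     of_real (sqrt (2 * \<beta> * Gamma \<mu>)) * z powr of_real ((1 - \<mu>) / 2) * exp z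
     * (\<integral>\<xi>. of_real (\<xi> powr (1/2) * exp (- (1/2) * \<beta> * \<xi>\<^sup>2))
            * bessel_J (of_real (\<mu> - 1)) (2 * csqrt (of_real \<beta> * z) * of_real \<xi>) * \<phi> \<xi> \<partial>half_line)"

end

theory Submission
  imports Defs "HOL-Probability.Probability"
begin

text \<open>
  Expanding the kernel along the diagonals \<open>r + s = n\<close> of the double series gives
  \<open>\<Sum>n. e\<^sub>n(z) \<psi>\<^sub>n(\<xi>)\<close>, where \<open>e\<^sub>n\<close> is a normalized monomial and \<open>\<psi>\<^sub>n\<close> is the Laguerre function with
  polynomial part \<open>\<^sub>1F\<^sub>1(-n; \<mu>; \<beta> \<xi>\<^sup>2)\<close>. So the transform maps the orthonormal basis \<open>\<psi>\<^sub>n\<close> to \<open>e\<^sub>n\<close>, and it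
  remains to see that the \<open>e\<^sub>n\<close> are orthonormal for \<open>\<nu>\<close> and span the reproducing kernel space.

  Orthogonality of the monomials is rotation invariance of \<open>\<nu>\<close>. For their norms and for
  positivity, put \<open>r = e\<^sup>u\<close> and \<open>s = 1 - \<sigma> + i t\<close>: up to normalization the Mellin--Barnes integrand
  is the characteristic function of a sum of independent logarithms of two gamma variables and one
  beta variable. It is integrable, so by Levy's inversion formula the Meijer function is the density
  of that sum up to an exponential factor, and the moments of \<open>\<nu>\<close> are products of gamma values.

  For completeness of the \<open>\<psi>\<^sub>n\<close>, a function \<open>g\<close> with Gaussian decay orthogonal to all powers
  \<open>\<xi>\<^sup>2\<^sup>k\<close> is orthogonal to \<open>\<xi>\<^sup>2\<^sup>k exp(- j \<delta> \<xi>\<^sup>2)\<close> for every \<open>j\<close>, by induction on \<open>j\<close> with a fixed step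
  \<open>\<delta>\<close> for which the exponential series is dominated; then the Weierstrass theorem in the variable
  \<open>exp(- \<delta> \<xi>\<^sup>2)\<close> gives \<open>g = 0\<close>.
\<close>


section \<open>Square-integrable functions\<close>

text \<open>The squared seminorm is the basic quantity, so that projections and limits can be
  handled without square roots.\<close>

definition l2_sqnorm :: "'a measure \<Rightarrow> ('a \<Rightarrow> complex) \<Rightarrow> real" where
  "l2_sqnorm M f = (\<integral>x. (cmod (f x))\<^sup>2 \<partial>M)"

lemma L2_measurable [measurable_dest]: "f \<in> L2 M \<Longrightarrow> f \<in> borel_measurable M"
  by (simp add: L2_def)

lemma L2_integrable: "f \<in> L2 M \<Longrightarrow> integrable M (\<lambda>x. (cmod (f x))\<^sup>2)"
  by (simp add: L2_def)

lemma L2_integrable_norm_mult: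
  assumes "f \<in> L2 M" "g \<in> L2 M"
  shows "integrable M (\<lambda>x. cmod (f x) * cmod (g x))"
proof (rule Bochner_Integration.integrable_bound)
  show "integrable M (\<lambda>x. (cmod (f x))\<^sup>2 + (cmod (g x))\<^sup>2)"
    using assms by (intro Bochner_Integration.integrable_add L2_integrable)
  show "(\<lambda>x. cmod (f x) * cmod (g x)) \<in> borel_measurable M"
    using assms[THEN L2_measurable] by measurable
  have "a * b \<le> a\<^sup>2 + b\<^sup>2" if "0 \<le> a" "0 \<le> b" for a b :: real
  proof -
    have "2 * (a * b) \<le> a\<^sup>2 + b\<^sup>2" using sum_squares_bound[of a b] by (simp add: mult.assoc)
    moreover have "0 \<le> a * b" using that by simp
    ultimately show ?thesis by linarith
  qed
  thus "AE x in M. norm (cmod (f x) * cmod (g x)) \<le> norm ((cmod (f x))\<^sup>2 + (cmod (g x))\<^sup>2)"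
    by simp
qed

lemma L2_integrable_mult:
  assumes "f \<in> L2 M" "g \<in> L2 M"
  shows "integrable M (\<lambda>x. f x * g x)"
  using L2_integrable_norm_mult[OF assms] assms[THEN L2_measurable]
  by (elim Bochner_Integration.integrable_bound) (auto simp: norm_mult)

lemma L2_cnj: "f \<in> L2 M \<Longrightarrow> (\<lambda>x. cnj (f x)) \<in> L2 M"
proof -
  have "cnj \<in> borel_measurable borel"
    by (intro borel_measurable_continuous_onI continuous_intros)
  thus "f \<in> L2 M \<Longrightarrow> (\<lambda>x. cnj (f x)) \<in> L2 M"
    by (auto simp: L2_def intro: measurable_compose)
qed

lemma L2_integrable_inner:
  "f \<in> L2 M \<Longrightarrow> g \<in> L2 M \<Longrightarrow> integrable M (\<lambda>x. f x * cnj (g x))"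
  by (intro L2_integrable_mult L2_cnj)

lemma L2_zero: "(\<lambda>x. 0) \<in> L2 M"
  by (simp add: L2_def)

lemma L2_cmult: "f \<in> L2 M \<Longrightarrow> (\<lambda>x. c * f x) \<in> L2 M"
  by (auto simp: L2_def norm_mult power_mult_distrib)

lemma L2_add:
  assumes "f \<in> L2 M" "g \<in> L2 M"
  shows "(\<lambda>x. f x + g x) \<in> L2 M"
  unfolding L2_def
proof (intro CollectI conjI)
  have [measurable]: "f \<in> borel_measurable M" "g \<in> borel_measurable M"
    using assms by (auto dest: L2_measurable)
  show "(\<lambda>x. f x + g x) \<in> borel_measurable M" by measurable
  show "integrable M (\<lambda>x. (cmod (f x + g x))\<^sup>2)"
  proof (rule Bochner_Integration.integrable_bound)
    show "integrable M (\<lambda>x. 2 * (cmod (f x))\<^sup>2 + 2 * (cmod (g x))\<^sup>2)"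
      using assms by (intro Bochner_Integration.integrable_add integrable_mult_right L2_integrable)
    have "(cmod (a + b))\<^sup>2 \<le> 2 * (cmod a)\<^sup>2 + 2 * (cmod b)\<^sup>2" for a b
    proof -
      have "(cmod (a + b))\<^sup>2 \<le> (cmod a + cmod b)\<^sup>2"
        by (intro power_mono norm_triangle_ineq) auto
      also have "\<dots> \<le> 2 * (cmod a)\<^sup>2 + 2 * (cmod b)\<^sup>2"
        using sum_squares_bound[of "cmod a" "cmod b"] by (simp add: power2_sum)
      finally show ?thesis .
    qed
    thus "AE x in M. norm ((cmod (f x + g x))\<^sup>2) \<le> norm (2 * (cmod (f x))\<^sup>2 + 2 * (cmod (g x))\<^sup>2)"
      by simp
  qed measurable
qed

lemma L2_diff: "f \<in> L2 M \<Longrightarrow> g \<in> L2 M \<Longrightarrow> (\<lambda>x. f x - g x) \<in> L2 M"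
  using L2_add[of f M "\<lambda>x. (-1) * g x"] L2_cmult[of g M "-1"] by simp

lemma L2_sum: "(\<And>i. i \<in> I \<Longrightarrow> F i \<in> L2 M) \<Longrightarrow> (\<lambda>x. \<Sum>i\<in>I. F i x) \<in> L2 M"
  by (induction I rule: infinite_finite_induct) (auto simp: L2_zero intro: L2_add)

lemma l2_sqnorm_nonneg: "0 \<le> l2_sqnorm M f"
  unfolding l2_sqnorm_def by (rule Bochner_Integration.integral_nonneg) simp

lemma l2_inner_self: "l2_inner M f f = complex_of_real (l2_sqnorm M f)"
proof -
  have "f x * cnj (f x) = complex_of_real ((cmod (f x))\<^sup>2)" for x
    by (metis complex_norm_square)
  thus ?thesis
    unfolding l2_inner_def l2_sqnorm_def by (simp only: integral_complex_of_real)
qed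

lemma l2_inner_commute: "l2_inner M g f = cnj (l2_inner M f g)"
proof -
  have "cnj (l2_inner M f g) = (\<integral>x. cnj (f x * cnj (g x)) \<partial>M)"
    unfolding l2_inner_def by (rule Bochner_Integration.integral_cnj[symmetric])
  thus ?thesis by (simp add: l2_inner_def mult.commute)
qed

lemma l2_inner_add_left:
  "f \<in> L2 M \<Longrightarrow> g \<in> L2 M \<Longrightarrow> h \<in> L2 M \<Longrightarrow>
    l2_inner M (\<lambda>x. f x + g x) h = l2_inner M f h + l2_inner M g h"
  unfolding l2_inner_def ring_distribs
  by (intro Bochner_Integration.integral_add L2_integrable_inner)

lemma l2_inner_diff_left:
  "f \<in> L2 M \<Longrightarrow> g \<in> L2 M \<Longrightarrow> h \<in> L2 M \<Longrightarrow>
    l2_inner M (\<lambda>x. f x - g x) h = l2_inner M f h - l2_inner M g h"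
  unfolding l2_inner_def ring_distribs
  by (intro Bochner_Integration.integral_diff L2_integrable_inner)

lemma l2_inner_cmult_left: "l2_inner M (\<lambda>x. c * f x) g = c * l2_inner M f g"
  unfolding l2_inner_def mult.assoc by (rule integral_mult_right_zero)

lemma l2_inner_cmult_right: "l2_inner M f (\<lambda>x. c * g x) = cnj c * l2_inner M f g"
  by (subst (1 2) l2_inner_commute) (simp add: l2_inner_cmult_left)

lemma l2_inner_diff_right:
  "f \<in> L2 M \<Longrightarrow> g \<in> L2 M \<Longrightarrow> h \<in> L2 M \<Longrightarrow>
    l2_inner M h (\<lambda>x. f x - g x) = l2_inner M h f - l2_inner M h g"
  by (subst (1 2 3) l2_inner_commute) (simp add: l2_inner_diff_left)

lemma l2_inner_sum_left:
  assumes "\<And>i. i \<in> I \<Longrightarrow> F i \<in> L2 M" "g \<in> L2 M"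
  shows "l2_inner M (\<lambda>x. \<Sum>i\<in>I. F i x) g = (\<Sum>i\<in>I. l2_inner M (F i) g)"
  unfolding l2_inner_def sum_distrib_right
  using assms by (intro Bochner_Integration.integral_sum L2_integrable_inner)

lemma l2_sqnorm_cmult: "l2_sqnorm M (\<lambda>x. c * f x) = (cmod c)\<^sup>2 * l2_sqnorm M f"
  by (simp add: l2_sqnorm_def norm_mult power_mult_distrib)

lemma l2_sqnorm_diff:
  assumes "f \<in> L2 M" "g \<in> L2 M"
  shows "l2_sqnorm M (\<lambda>x. f x - g x) = l2_sqnorm M f + l2_sqnorm M g - 2 * Re (l2_inner M f g)"
proof -
  have "complex_of_real (l2_sqnorm M (\<lambda>x. f x - g x)) =
      l2_inner M f f - l2_inner M f g - (l2_inner M g f - l2_inner M g g)"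
    using assms by (simp add: l2_inner_self[symmetric] l2_inner_diff_left l2_inner_diff_right L2_diff)
  hence "l2_sqnorm M (\<lambda>x. f x - g x) =
      Re (l2_inner M f f - l2_inner M f g - (l2_inner M g f - l2_inner M g g))"
    by (metis Re_complex_of_real)
  moreover have "Re (l2_inner M g f) = Re (l2_inner M f g)"
    by (subst l2_inner_commute) simp
  ultimately show ?thesis by (simp add: l2_inner_self)
qed

text \<open>With c the inner product of f and g, the squared seminorm of f - t c g is a nonnegative
  quadratic in the real variable t, and t = 1 / b is its minimum. As the form is only semidefinite,
  b = 0 is a case of its own: the expression is then affine in t and bounded below only if c =
  0.\<close>

lemma l2_Cauchy_Schwarz:
  assumes "f \<in> L2 M" "g \<in> L2 M"
  shows "(cmod (l2_inner M f g))\<^sup>2 \<le> l2_sqnorm M f * l2_sqnorm M g"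
proof -
  define a b c where "a = l2_sqnorm M f" and "b = l2_sqnorm M g" and "c = l2_inner M f g"
  have ab: "a \<ge> 0" "b \<ge> 0" by (simp_all add: a_def b_def l2_sqnorm_nonneg)
  have *: "0 \<le> a + t\<^sup>2 * (cmod c)\<^sup>2 * b - 2 * t * (cmod c)\<^sup>2" for t :: real
  proof -
    have "0 \<le> l2_sqnorm M (\<lambda>x. f x - (of_real t * c) * g x)" by (rule l2_sqnorm_nonneg)
    also have "\<dots> = a + (cmod (of_real t * c))\<^sup>2 * b - 2 * Re (cnj (of_real t * c) * c)"
      unfolding a_def b_def c_def
      using assms by (subst l2_sqnorm_diff) (simp_all only: L2_cmult l2_sqnorm_cmult l2_inner_cmult_right)
    also have "Re (cnj (of_real t * c) * c) = t * (cmod c)\<^sup>2"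
      by (simp add: cmod_power2) (simp add: power2_eq_square algebra_simps)
    also have "(cmod (of_real t * c))\<^sup>2 = t\<^sup>2 * (cmod c)\<^sup>2"
      by (simp add: norm_mult power_mult_distrib)
    finally show ?thesis by simp
  qed
  show ?thesis
  proof (cases "b = 0")
    case True
    have "c = 0"
    proof (rule ccontr)
      assume "c \<noteq> 0"
      hence "(cmod c)\<^sup>2 > 0" by simp
      \<comment> \<open>At this t the inequality becomes 0 \<le> a - 2 (a + 1), which is false for a
        \<ge> 0.\<close>
      moreover have "0 \<le> a - 2 * ((a + 1) / (cmod c)\<^sup>2) * (cmod c)\<^sup>2"
        using *[of "(a + 1) / (cmod c)\<^sup>2"] True by simp
      ultimately show False using ab by simp
    qed
    thus ?thesis using ab by (simp add: a_def b_def c_def)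
  next
    case False
    hence "b > 0" using ab by simp
    have "0 \<le> a + (1 / b)\<^sup>2 * (cmod c)\<^sup>2 * b - 2 * (1 / b) * (cmod c)\<^sup>2" by (rule *)
    also have "\<dots> = a - (cmod c)\<^sup>2 / b"
      using \<open>b > 0\<close> by (simp add: field_simps power2_eq_square)
    finally show ?thesis using \<open>b > 0\<close> by (simp add: field_simps a_def b_def c_def)
  qed
qed

text \<open>A subsequence with squared distances below 4^-k converges almost everywhere, because d
  \<le> 2^-k + 2^k d^2 makes the telescoping series absolutely summable; Fatou then turns the
  pointwise limit into a norm limit. The subsequence is part of the conclusion since later a norm
  limit has to be identified with a pointwise sum.\<close>

lemma L2_complete:
  fixes F :: "nat \<Rightarrow> 'a \<Rightarrow> complex"
  assumes F: "\<And>n. F n \<in> L2 M"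
    and Cauchy: "\<And>\<epsilon>. \<epsilon> > 0 \<Longrightarrow> \<exists>N. \<forall>m\<ge>N. \<forall>n\<ge>N. l2_sqnorm M (\<lambda>x. F m x - F n x) < \<epsilon>"
  obtains f r where "f \<in> L2 M" "strict_mono (r :: nat \<Rightarrow> nat)" "AE x in M. (\<lambda>k. F (r k) x) \<longlonglongrightarrow> f x"
    "(\<lambda>n. l2_sqnorm M (\<lambda>x. F n x - f x)) \<longlonglongrightarrow> 0"
proof -
  have Fm [measurable]: "F n \<in> borel_measurable M" for n using F by (rule L2_measurable)
  have nn: "(\<integral>\<^sup>+x. ennreal ((cmod (F m x - F n x))\<^sup>2) \<partial>M) = ennreal (l2_sqnorm M (\<lambda>x. F m x - F n x))" for m n
    unfolding l2_sqnorm_def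
    by (intro nn_integral_eq_integral L2_integrable L2_diff F) simp
  define P where "P k N \<longleftrightarrow> (\<forall>m\<ge>N. \<forall>n\<ge>N. l2_sqnorm M (\<lambda>x. F m x - F n x) < (1/4) ^ k)" for k N
  have exP: "\<exists>N. P k N" for k unfolding P_def by (rule Cauchy) simp
  have "\<exists>r. \<forall>k. P k (r k) \<and> r k < r (Suc k)"
  proof (rule dependent_nat_choice)
    show "\<exists>N. P 0 N" by (rule exP)
    fix N k
    obtain N' where "P (Suc k) N'" using exP by blast
    hence "P (Suc k) (max N' (Suc N))" unfolding P_def by auto
    thus "\<exists>N'. P (Suc k) N' \<and> N < N'" by (intro exI[of _ "max N' (Suc N)"]) auto
  qed
  then obtain r where r: "\<And>k. P k (r k)" "\<And>k. r k < r (Suc k)" by blast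
  have mono: "strict_mono r" using r(2) by (simp add: strict_mono_Suc_iff)
  define d where "d k x = cmod (F (r (Suc k)) x - F (r k) x)" for k x
  have [measurable]: "d k \<in> borel_measurable M" for k unfolding d_def by measurable
  have dint: "(\<integral>\<^sup>+x. ennreal ((d k x)\<^sup>2) \<partial>M) \<le> ennreal ((1/4) ^ k)" for k
    unfolding d_def nn using r(1)[of k] r(2)[of k] unfolding P_def
    by (intro ennreal_leI) (auto intro: less_imp_le)
  \<comment> \<open>The weight 2^k against the bound 4^-k leaves the summable 2^-k.\<close>
  have "(\<integral>\<^sup>+x. (\<Sum>k. ennreal (2 ^ k * (d k x)\<^sup>2)) \<partial>M) = (\<Sum>k. \<integral>\<^sup>+x. ennreal (2 ^ k * (d k x)\<^sup>2) \<partial>M)"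
    by (rule nn_integral_suminf) measurable
  also have "\<dots> \<le> (\<Sum>k. ennreal ((1/2) ^ k))"
  proof (rule suminf_le)
    fix k
    have "(\<integral>\<^sup>+x. ennreal (2 ^ k * (d k x)\<^sup>2) \<partial>M) = ennreal (2 ^ k) * (\<integral>\<^sup>+x. ennreal ((d k x)\<^sup>2) \<partial>M)"
      by (subst nn_integral_cmult[symmetric]) (simp_all add: ennreal_mult')
    also have "\<dots> \<le> ennreal (2 ^ k) * ennreal ((1/4) ^ k)" by (intro mult_left_mono dint) simp
    also have "\<dots> = ennreal ((1/2) ^ k)"
      by (subst ennreal_mult'[symmetric]) (simp_all add: power_mult_distrib[symmetric])
    finally show "(\<integral>\<^sup>+x. ennreal (2 ^ k * (d k x)\<^sup>2) \<partial>M) \<le> ennreal ((1/2) ^ k)" .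
  qed simp_all
  also have "\<dots> = ennreal (\<Sum>k. (1/2) ^ k)"
    by (rule suminf_ennreal2) (auto intro: summable_geometric)
  also have "\<dots> < \<infinity>" by simp
  finally have fin: "(\<integral>\<^sup>+x. (\<Sum>k. ennreal (2 ^ k * (d k x)\<^sup>2)) \<partial>M) \<noteq> \<infinity>" by simp
  have conv: "AE x in M. convergent (\<lambda>k. F (r k) x)"
    using nn_integral_PInf_AE[OF _ fin]
  proof (rule AE_mp)
    show "(\<lambda>x. \<Sum>k. ennreal (2 ^ k * (d k x)\<^sup>2)) \<in> borel_measurable M" by measurable
    show "AE x in M. (\<Sum>k. ennreal (2 ^ k * (d k x)\<^sup>2)) \<noteq> \<infinity> \<longrightarrow> convergent (\<lambda>k. F (r k) x)"
    proof (intro AE_I2 impI)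
      fix x assume "(\<Sum>k. ennreal (2 ^ k * (d k x)\<^sup>2)) \<noteq> \<infinity>"
      hence s: "summable (\<lambda>k. 2 ^ k * (d k x)\<^sup>2)"
        by (intro summable_suminf_not_top) auto
      have "summable (\<lambda>k. d k x)"
      proof (rule summable_comparison_test')
        show "summable (\<lambda>k. (1/2) ^ k + 2 ^ k * (d k x)\<^sup>2)"
          by (intro summable_add s summable_geometric) simp
        fix k :: nat
        have d0: "d k x \<ge> 0" by (simp add: d_def)
        show "norm (d k x) \<le> (1/2) ^ k + 2 ^ k * (d k x)\<^sup>2"
        proof (cases "d k x \<le> (1/2) ^ k")
          case True thus ?thesis using d0 by (simp add: add_increasing2)
        next
          case False
          hence "1 \<le> 2 ^ k * d k x" by (simp add: field_simps power_divide)
          \<comment> \<open>Outside the case d \<le> 2^-k the factor 2^k d is at least 1, so d is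
            dominated by the weighted square.\<close>
          hence "d k x \<le> (2 ^ k * d k x) * d k x"
            using d0 mult_right_mono[of 1 "2 ^ k * d k x" "d k x"] by simp
          thus ?thesis using d0 by (simp add: power2_eq_square mult.assoc add_increasing)
        qed
      qed
      hence "summable (\<lambda>k. F (r (Suc k)) x - F (r k) x)"
        unfolding d_def by (rule summable_norm_cancel)
      hence "convergent (\<lambda>n. \<Sum>k<n. F (r (Suc k)) x - F (r k) x)"
        by (simp add: summable_iff_convergent)
      hence "convergent (\<lambda>n. F (r n) x - F (r 0) x)"
        by (simp only: sum_lessThan_telescope[of "\<lambda>k. F (r k) x"])
      hence "convergent (\<lambda>n. (F (r n) x - F (r 0) x) + F (r 0) x)"
        by (intro convergent_add convergent_const)
      thus "convergent (\<lambda>k. F (r k) x)" by simp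
    qed
  qed
  define f where "f x = lim (\<lambda>k. F (r k) x)" for x
  have [measurable]: "f \<in> borel_measurable M" unfolding f_def by measurable
  have lim: "AE x in M. (\<lambda>k. F (r k) x) \<longlonglongrightarrow> f x"
    using conv by eventually_elim (simp add: f_def convergent_LIMSEQ_iff)
  \<comment> \<open>Fatou along the subsequence: a bound on the distance from \<open>F n\<close> to
    all late members passes to the limit function.\<close>
  have fatou: "(\<integral>\<^sup>+x. ennreal ((cmod (F n x - f x))\<^sup>2) \<partial>M) \<le> ennreal \<epsilon>"
    if n: "\<And>m. m \<ge> N \<Longrightarrow> l2_sqnorm M (\<lambda>x. F n x - F m x) \<le> \<epsilon>" for n N \<epsilon>
  proof -
    have "(\<integral>\<^sup>+x. ennreal ((cmod (F n x - f x))\<^sup>2) \<partial>M)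
        = (\<integral>\<^sup>+x. liminf (\<lambda>k. ennreal ((cmod (F n x - F (r k) x))\<^sup>2)) \<partial>M)"
    proof (rule nn_integral_cong_AE, use lim in eventually_elim)
      fix x assume "(\<lambda>k. F (r k) x) \<longlonglongrightarrow> f x"
      hence "(\<lambda>k. ennreal ((cmod (F n x - F (r k) x))\<^sup>2)) \<longlonglongrightarrow> ennreal ((cmod (F n x - f x))\<^sup>2)"
        by (intro tendsto_intros)
      thus "ennreal ((cmod (F n x - f x))\<^sup>2) = liminf (\<lambda>k. ennreal ((cmod (F n x - F (r k) x))\<^sup>2))"
        by (intro lim_imp_Liminf[symmetric]) auto
    qed
    also have "\<dots> \<le> liminf (\<lambda>k. \<integral>\<^sup>+x. ennreal ((cmod (F n x - F (r k) x))\<^sup>2) \<partial>M)"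
      by (rule nn_integral_liminf) measurable
    also have "\<dots> \<le> liminf (\<lambda>k. ennreal \<epsilon>)"
    proof (rule Liminf_mono)
      have "eventually (\<lambda>k. r k \<ge> N) sequentially"
        using seq_suble[OF mono] by (intro eventually_sequentiallyI[of N]) (meson order_trans)
      thus "\<forall>\<^sub>F k in sequentially. (\<integral>\<^sup>+x. ennreal ((cmod (F n x - F (r k) x))\<^sup>2) \<partial>M) \<le> ennreal \<epsilon>"
        by eventually_elim (use n in \<open>auto simp: nn intro!: ennreal_leI\<close>)
    qed
    finally show ?thesis by (simp add: Liminf_const)
  qed
  have diffL2: "(\<lambda>x. F n x - f x) \<in> L2 M" if "\<And>m. m \<ge> N \<Longrightarrow> l2_sqnorm M (\<lambda>x. F n x - F m x) \<le> 1" for n N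
  proof -
    have "(\<integral>\<^sup>+x. ennreal ((cmod (F n x - f x))\<^sup>2) \<partial>M) < \<infinity>"
      using fatou[of N n 1] that by (auto simp: order_le_less_trans)
    thus ?thesis unfolding L2_def by (auto intro!: integrableI_bounded)
  qed
  obtain N where N: "\<forall>m\<ge>N. \<forall>n\<ge>N. l2_sqnorm M (\<lambda>x. F m x - F n x) < 1" using Cauchy[of 1] by auto
  have "(\<lambda>x. F N x - f x) \<in> L2 M" by (rule diffL2[of N]) (use N in \<open>auto intro: less_imp_le\<close>)
  from L2_diff[OF F[of N] this] have fL2: "f \<in> L2 M" by simp
  have "(\<lambda>n. l2_sqnorm M (\<lambda>x. F n x - f x)) \<longlonglongrightarrow> 0"
  proof (rule LIMSEQ_I)
    fix e :: real assume "e > 0"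
    then obtain N where N: "\<forall>m\<ge>N. \<forall>n\<ge>N. l2_sqnorm M (\<lambda>x. F m x - F n x) < e / 2"
      using Cauchy[of "e / 2"] by auto
    have "norm (l2_sqnorm M (\<lambda>x. F n x - f x) - 0) < e" if "n \<ge> N" for n
    proof -
      have "ennreal (l2_sqnorm M (\<lambda>x. F n x - f x)) = (\<integral>\<^sup>+x. ennreal ((cmod (F n x - f x))\<^sup>2) \<partial>M)"
        unfolding l2_sqnorm_def by (intro nn_integral_eq_integral[symmetric] L2_integrable L2_diff F fL2) simp
      also have "\<dots> \<le> ennreal (e / 2)" by (rule fatou[of N]) (use N that in \<open>auto intro: less_imp_le\<close>)
      finally have "l2_sqnorm M (\<lambda>x. F n x - f x) \<le> e / 2" using \<open>e > 0\<close> by (simp add: ennreal_le_iff)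
      thus ?thesis using \<open>e > 0\<close> by (simp add: l2_sqnorm_nonneg)
    qed
    thus "\<exists>no. \<forall>n\<ge>no. norm (l2_sqnorm M (\<lambda>x. F n x - f x) - 0) < e" by blast
  qed
  with fL2 mono lim show ?thesis by (rule that)
qed

section \<open>Orthonormal sequences\<close>

definition l2_orthonormal :: "'a measure \<Rightarrow> (nat \<Rightarrow> 'a \<Rightarrow> complex) \<Rightarrow> bool" where
  "l2_orthonormal M e \<longleftrightarrow> (\<forall>n. e n \<in> L2 M) \<and> (\<forall>m n. l2_inner M (e m) (e n) = (if m = n then 1 else 0))"

lemma l2_orthonormalD:
  assumes "l2_orthonormal M e"
  shows "e n \<in> L2 M" "l2_inner M (e m) (e n) = (if m = n then 1 else 0)"
  using assms by (simp_all add: l2_orthonormal_def)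

lemma l2_inner_lincomb_left:
  assumes "l2_orthonormal M e" "g \<in> L2 M"
  shows "l2_inner M (\<lambda>x. \<Sum>k\<in>I. a k * e k x) g = (\<Sum>k\<in>I. a k * l2_inner M (e k) g)"
  using assms by (subst l2_inner_sum_left) (auto intro: L2_cmult l2_orthonormalD simp: l2_inner_cmult_left)

lemma L2_lincomb: "l2_orthonormal M e \<Longrightarrow> (\<lambda>x. \<Sum>k\<in>I. a k * e k x) \<in> L2 M"
  by (intro L2_sum L2_cmult l2_orthonormalD)

lemma l2_inner_lincomb_basis:
  assumes "l2_orthonormal M e" "finite I"
  shows "l2_inner M (\<lambda>x. \<Sum>k\<in>I. a k * e k x) (e n) = (if n \<in> I then a n else 0)"
proof -
  have "a k * (if k = n then 1 else 0) = (if k = n then a k else 0)" for k by simp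
  thus ?thesis using assms by (simp add: l2_inner_lincomb_left l2_orthonormalD)
qed

lemma l2_sqnorm_lincomb:
  assumes e: "l2_orthonormal M e" and "finite I"
  shows "l2_sqnorm M (\<lambda>x. \<Sum>k\<in>I. a k * e k x) = (\<Sum>k\<in>I. (cmod (a k))\<^sup>2)"
proof -
  let ?f = "\<lambda>x. \<Sum>k\<in>I. a k * e k x"
  have "complex_of_real (l2_sqnorm M ?f) = (\<Sum>k\<in>I. a k * l2_inner M (e k) ?f)"
    by (simp add: l2_inner_self[symmetric] l2_inner_lincomb_left[OF e] L2_lincomb[OF e])
  also have "\<dots> = (\<Sum>k\<in>I. complex_of_real ((cmod (a k))\<^sup>2))"
  proof (rule sum.cong[OF refl])
    fix k assume "k \<in> I"
    hence "l2_inner M (e k) ?f = cnj (a k)"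
      using assms by (subst l2_inner_commute) (simp add: l2_inner_lincomb_basis)
    thus "a k * l2_inner M (e k) ?f = complex_of_real ((cmod (a k))\<^sup>2)"
      by (simp only: complex_norm_square)
  qed
  also have "\<dots> = complex_of_real (\<Sum>k\<in>I. (cmod (a k))\<^sup>2)" by (rule of_real_sum[symmetric])
  finally show ?thesis by (simp only: of_real_eq_iff)
qed

lemma l2_sqnorm_diff_projection:
  assumes e: "l2_orthonormal M e" and I: "finite I" and f: "f \<in> L2 M"
  shows "l2_sqnorm M (\<lambda>x. f x - (\<Sum>k\<in>I. l2_inner M f (e k) * e k x)) =
    l2_sqnorm M f - (\<Sum>k\<in>I. (cmod (l2_inner M f (e k)))\<^sup>2)"
proof -
  let ?p = "\<lambda>x. \<Sum>k\<in>I. l2_inner M f (e k) * e k x"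
  have "l2_inner M ?p f = (\<Sum>k\<in>I. complex_of_real ((cmod (l2_inner M f (e k)))\<^sup>2))"
    unfolding l2_inner_lincomb_left[OF e f]
  proof (rule sum.cong[OF refl])
    fix k
    have "l2_inner M (e k) f = cnj (l2_inner M f (e k))" by (rule l2_inner_commute)
    thus "l2_inner M f (e k) * l2_inner M (e k) f = complex_of_real ((cmod (l2_inner M f (e k)))\<^sup>2)"
      by (simp only: complex_norm_square)
  qed
  hence "Re (l2_inner M f ?p) = (\<Sum>k\<in>I. (cmod (l2_inner M f (e k)))\<^sup>2)"
    by (subst l2_inner_commute) simp
  thus ?thesis
    by (simp add: l2_sqnorm_diff f L2_lincomb[OF e] l2_sqnorm_lincomb[OF e I])
qed

lemma l2_bessel:
  assumes e: "l2_orthonormal M e" and f: "f \<in> L2 M"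
  shows "summable (\<lambda>k. (cmod (l2_inner M f (e k)))\<^sup>2)"
    and "(\<Sum>k. (cmod (l2_inner M f (e k)))\<^sup>2) \<le> l2_sqnorm M f"
proof -
  have *: "(\<Sum>k<n. (cmod (l2_inner M f (e k)))\<^sup>2) \<le> l2_sqnorm M f" for n
    using l2_sqnorm_diff_projection[OF e _ f, of "{..<n}"]
      l2_sqnorm_nonneg[of M "\<lambda>x. f x - (\<Sum>k<n. l2_inner M f (e k) * e k x)"] by simp
  show s: "summable (\<lambda>k. (cmod (l2_inner M f (e k)))\<^sup>2)"
    using *[of "Suc _"]
    by (intro bounded_imp_summable[of _ "l2_sqnorm M f"]) (simp_all only: lessThan_Suc_atMost zero_le_power2)
  show "(\<Sum>k. (cmod (l2_inner M f (e k)))\<^sup>2) \<le> l2_sqnorm M f"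
    by (rule suminf_le_const[OF s *])
qed

lemma l2_inner_tendsto:
  assumes "\<And>n. F n \<in> L2 M" "f \<in> L2 M" "g \<in> L2 M"
    and lim: "(\<lambda>n. l2_sqnorm M (\<lambda>x. F n x - f x)) \<longlonglongrightarrow> 0"
  shows "(\<lambda>n. l2_inner M (F n) g) \<longlonglongrightarrow> l2_inner M f g"
proof -
  have "(\<lambda>n. (cmod (l2_inner M (F n) g - l2_inner M f g))\<^sup>2) \<longlonglongrightarrow> 0"
  proof (rule tendsto_sandwich[OF _ _ tendsto_const])
    show "(\<lambda>n. l2_sqnorm M (\<lambda>x. F n x - f x) * l2_sqnorm M g) \<longlonglongrightarrow> 0"
      using lim by (rule tendsto_mult_left_zero)
    show "\<forall>\<^sub>F n in sequentially. (cmod (l2_inner M (F n) g - l2_inner M f g))\<^sup>2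
        \<le> l2_sqnorm M (\<lambda>x. F n x - f x) * l2_sqnorm M g"
      using assms by (auto simp: l2_inner_diff_left[symmetric] intro!: always_eventually l2_Cauchy_Schwarz L2_diff)
  qed simp
  hence "(\<lambda>n. cmod (l2_inner M (F n) g - l2_inner M f g)) \<longlonglongrightarrow> 0"
    using tendsto_real_sqrt by fastforce
  thus ?thesis by (simp add: tendsto_norm_zero_iff LIM_zero_iff)
qed

text \<open>The coefficients fix f only up to a null set. The almost everywhere convergent
  subsequence of partial sums is what \<open>series_L2\<close> uses to compare f with the pointwise
  sum of the series.\<close>

lemma l2_riesz_fischer:
  assumes e: "l2_orthonormal M e" and a: "summable (\<lambda>k. (cmod (a k))\<^sup>2)"
  obtains f r where "f \<in> L2 M" "strict_mono (r :: nat \<Rightarrow> nat)"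
    "AE x in M. (\<lambda>j. \<Sum>k<r j. a k * e k x) \<longlonglongrightarrow> f x"
    "(\<lambda>n. l2_sqnorm M (\<lambda>x. (\<Sum>k<n. a k * e k x) - f x)) \<longlonglongrightarrow> 0"
    "\<And>n. l2_inner M f (e n) = a n"
proof -
  define F where "F n x = (\<Sum>k<n. a k * e k x)" for n x
  have F: "F n \<in> L2 M" for n unfolding F_def by (intro L2_lincomb e)
  have dist: "l2_sqnorm M (\<lambda>x. F m x - F n x) = (\<Sum>k=n..<m. (cmod (a k))\<^sup>2)" if "n \<le> m" for m n
  proof -
    have "F m x - F n x = (\<Sum>k\<in>{n..<m}. a k * e k x)" for x
      using that sum.atLeastLessThan_concat[of 0 n m "\<lambda>k. a k * e k x"]
      by (simp add: F_def lessThan_atLeast0 algebra_simps)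
    thus ?thesis by (simp add: l2_sqnorm_lincomb[OF e])
  qed
  have swap: "l2_sqnorm M (\<lambda>x. F m x - F n x) = l2_sqnorm M (\<lambda>x. F n x - F m x)" for m n
    by (simp add: l2_sqnorm_def norm_minus_commute)
  have C: "\<exists>N. \<forall>m\<ge>N. \<forall>n\<ge>N. l2_sqnorm M (\<lambda>x. F m x - F n x) < \<epsilon>" if "\<epsilon> > 0" for \<epsilon>
  proof -
    obtain N where N: "\<And>m n. m \<ge> N \<Longrightarrow> norm (\<Sum>k=m..<n. (cmod (a k))\<^sup>2) < \<epsilon>"
      using a \<open>\<epsilon> > 0\<close> unfolding summable_Cauchy by blast
    have "l2_sqnorm M (\<lambda>x. F m x - F n x) < \<epsilon>" if "m \<ge> N" "n \<ge> N" for m n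
    proof (cases "n \<le> m")
      case True thus ?thesis using N[OF that(2), of m] by (simp add: dist)
    next
      case False thus ?thesis using N[OF that(1), of n] by (subst swap) (simp add: dist)
    qed
    thus ?thesis by blast
  qed
  obtain f r where f: "f \<in> L2 M" "strict_mono (r :: nat \<Rightarrow> nat)" "AE x in M. (\<lambda>k. F (r k) x) \<longlonglongrightarrow> f x"
    "(\<lambda>n. l2_sqnorm M (\<lambda>x. F n x - f x)) \<longlonglongrightarrow> 0"
    using L2_complete[of F, OF F C] by blast
  have "l2_inner M f (e n) = a n" for n
  proof (rule LIMSEQ_unique)
    show "(\<lambda>j. l2_inner M (F j) (e n)) \<longlonglongrightarrow> l2_inner M f (e n)"
      by (intro l2_inner_tendsto F f l2_orthonormalD(1)[OF e])
    show "(\<lambda>j. l2_inner M (F j) (e n)) \<longlonglongrightarrow> a n"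
      by (rule tendsto_eventually, rule eventually_sequentiallyI[of "Suc n"])
        (simp add: F_def[abs_def] l2_inner_lincomb_basis[OF e])
  qed
  with f show ?thesis unfolding F_def by (intro that)
qed

text \<open>Assuming norm convergence of the expansion of f, instead of completeness of the system,
  makes this usable both for the Laguerre functions and for the closed span of the monomials in the
  space of \<nu>.\<close>

lemma l2_parseval:
  assumes e: "l2_orthonormal M e" and f: "f \<in> L2 M" and g: "g \<in> L2 M"
    and lim: "(\<lambda>n. l2_sqnorm M (\<lambda>x. (\<Sum>k<n. a k * e k x) - f x)) \<longlonglongrightarrow> 0"
  shows "(\<lambda>k. a k * cnj (l2_inner M g (e k))) sums l2_inner M f g"
proof -
  have "(\<lambda>n. l2_inner M (\<lambda>x. \<Sum>k<n. a k * e k x) g) \<longlonglongrightarrow> l2_inner M f g"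
    by (intro l2_inner_tendsto L2_lincomb e f g lim)
  moreover have "l2_inner M (e k) g = cnj (l2_inner M g (e k))" for k by (rule l2_inner_commute)
  ultimately show ?thesis by (simp add: sums_def l2_inner_lincomb_left[OF e g])
qed

lemma l2_sqnorm_eq_0_AE:
  assumes "f \<in> L2 M" "l2_sqnorm M f = 0"
  shows "AE x in M. f x = 0"
  using assms integral_nonneg_eq_0_iff_AE[OF L2_integrable[OF assms(1)]] by (simp add: l2_sqnorm_def)

text \<open>Riesz-Fischer provides g with the coefficients of f and a convergent expansion. The
  difference f - g is orthogonal to the system, so completeness makes it vanish almost everywhere.
  Completeness speaks of the seminorm because elements are functions, not classes.\<close>

lemma l2_complete_expansion:
  assumes e: "l2_orthonormal M e" and f: "f \<in> L2 M"
    and complete: "\<And>g. g \<in> L2 M \<Longrightarrow> (\<And>n. l2_inner M g (e n) = 0) \<Longrightarrow> l2_sqnorm M g = 0"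
  shows "(\<lambda>n. l2_sqnorm M (\<lambda>x. (\<Sum>k<n. l2_inner M f (e k) * e k x) - f x)) \<longlonglongrightarrow> 0"
proof -
  obtain g where g: "g \<in> L2 M" "(\<lambda>n. l2_sqnorm M (\<lambda>x. (\<Sum>k<n. l2_inner M f (e k) * e k x) - g x)) \<longlonglongrightarrow> 0"
    "\<And>n. l2_inner M g (e n) = l2_inner M f (e n)"
    by (rule l2_riesz_fischer[OF e l2_bessel(1)[OF e f]]) (rule that)
  have fg: "l2_sqnorm M (\<lambda>x. f x - g x) = 0"
    by (intro complete L2_diff f g) (simp add: l2_inner_diff_left f g l2_orthonormalD(1)[OF e])
  have ae: "AE x in M. f x = g x"
    using l2_sqnorm_eq_0_AE[OF L2_diff[OF f g(1)] fg] by simp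
  have [measurable]: "f \<in> borel_measurable M" "g \<in> borel_measurable M" "e k \<in> borel_measurable M" for k
    using f g(1) l2_orthonormalD(1)[OF e] by (auto dest: L2_measurable)
  have "l2_sqnorm M (\<lambda>x. (\<Sum>k<n. l2_inner M f (e k) * e k x) - f x)
      = l2_sqnorm M (\<lambda>x. (\<Sum>k<n. l2_inner M f (e k) * e k x) - g x)" for n
    unfolding l2_sqnorm_def by (rule integral_cong_AE) (use ae in \<open>auto\<close>)
  thus ?thesis using g(2) by simp
qed

section \<open>Reproducing kernels from orthonormal sequences\<close>

text \<open>The sums are pointwise. This picks from each class of the closed span one actual
  function, whose values at single points make sense.\<close>

definition l2_series_space :: "(nat \<Rightarrow> 'a \<Rightarrow> complex) \<Rightarrow> ('a \<Rightarrow> complex) set" where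
  "l2_series_space e = {f. \<exists>a. summable (\<lambda>n. (cmod (a n))\<^sup>2) \<and> f = (\<lambda>x. \<Sum>n. a n * e n x)}"

lemma summable_mult_of_squares:
  fixes a b :: "nat \<Rightarrow> complex"
  assumes "summable (\<lambda>n. (cmod (a n))\<^sup>2)" "summable (\<lambda>n. (cmod (b n))\<^sup>2)"
  shows "summable (\<lambda>n. cmod (a n * b n))"
proof (rule summable_comparison_test')
  show "summable (\<lambda>n. (cmod (a n))\<^sup>2 + (cmod (b n))\<^sup>2)" by (intro summable_add assms)
  fix n :: nat
  have "2 * (cmod (a n) * cmod (b n)) \<le> (cmod (a n))\<^sup>2 + (cmod (b n))\<^sup>2"
    using sum_squares_bound[of "cmod (a n)" "cmod (b n)"] by (simp add: mult.assoc)
  moreover have "0 \<le> cmod (a n) * cmod (b n)" by simp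
  ultimately have "cmod (a n) * cmod (b n) \<le> (cmod (a n))\<^sup>2 + (cmod (b n))\<^sup>2" by linarith
  thus "norm (cmod (a n * b n)) \<le> (cmod (a n))\<^sup>2 + (cmod (b n))\<^sup>2" by (simp add: norm_mult)
qed

lemma summable_norm_sq_add:
  fixes a b :: "nat \<Rightarrow> complex"
  assumes "summable (\<lambda>n. (cmod (a n))\<^sup>2)" "summable (\<lambda>n. (cmod (b n))\<^sup>2)"
  shows "summable (\<lambda>n. (cmod (a n + b n))\<^sup>2)"
proof (rule summable_comparison_test')
  show "summable (\<lambda>n. 2 * (cmod (a n))\<^sup>2 + 2 * (cmod (b n))\<^sup>2)" by (intro summable_add summable_mult assms)
  fix n :: nat
  have "(cmod (a n + b n))\<^sup>2 \<le> (cmod (a n) + cmod (b n))\<^sup>2"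
    by (intro power_mono norm_triangle_ineq) auto
  also have "\<dots> \<le> 2 * (cmod (a n))\<^sup>2 + 2 * (cmod (b n))\<^sup>2"
    using sum_squares_bound[of "cmod (a n)" "cmod (b n)"] by (simp add: power2_sum)
  finally show "norm ((cmod (a n + b n))\<^sup>2) \<le> 2 * (cmod (a n))\<^sup>2 + 2 * (cmod (b n))\<^sup>2" by simp
qed

lemma l2_series_spaceI: "summable (\<lambda>n. (cmod (a n))\<^sup>2) \<Longrightarrow> (\<lambda>x. \<Sum>n. a n * e n x) \<in> l2_series_space e"
  unfolding l2_series_space_def by blast

text \<open>Triangle inequality for squares; the factor 2 is harmless in Cauchy arguments.\<close>

lemma l2_sqnorm_diff_triangle:
  assumes "f \<in> L2 M" "g \<in> L2 M" "h \<in> L2 M"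
  shows "l2_sqnorm M (\<lambda>x. f x - g x) \<le> 2 * l2_sqnorm M (\<lambda>x. f x - h x) + 2 * l2_sqnorm M (\<lambda>x. g x - h x)"
proof -
  have le: "(cmod (a - b))\<^sup>2 \<le> 2 * (cmod (a - c))\<^sup>2 + 2 * (cmod (b - c))\<^sup>2" for a b c
  proof -
    have "cmod (a - b) \<le> cmod (a - c) + cmod (b - c)" by (metis norm_triangle_sub dist_norm dist_triangle2)
    hence "(cmod (a - b))\<^sup>2 \<le> (cmod (a - c) + cmod (b - c))\<^sup>2" by (intro power_mono) auto
    also have "\<dots> \<le> 2 * (cmod (a - c))\<^sup>2 + 2 * (cmod (b - c))\<^sup>2"
      using sum_squares_bound[of "cmod (a - c)" "cmod (b - c)"] by (simp add: power2_sum)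
    finally show ?thesis .
  qed
  have "l2_sqnorm M (\<lambda>x. f x - g x) \<le> (\<integral>x. 2 * (cmod (f x - h x))\<^sup>2 + 2 * (cmod (g x - h x))\<^sup>2 \<partial>M)"
    unfolding l2_sqnorm_def using assms
    by (intro integral_mono Bochner_Integration.integrable_add integrable_mult_right L2_integrable L2_diff le)
  also have "\<dots> = 2 * l2_sqnorm M (\<lambda>x. f x - h x) + 2 * l2_sqnorm M (\<lambda>x. g x - h x)"
    unfolding l2_sqnorm_def using assms
    by (subst Bochner_Integration.integral_add) (auto intro!: integrable_mult_right L2_integrable L2_diff)
  finally show ?thesis .
qed

lemma function_hilbert_spaceD:
  assumes "function_hilbert_space H ip"
  shows "(\<lambda>x. 0) \<in> H" "f \<in> H \<Longrightarrow> g \<in> H \<Longrightarrow> (\<lambda>x. f x + g x) \<in> H" "f \<in> H \<Longrightarrow> (\<lambda>x. c * f x) \<in> H"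
  using assms by (simp_all add: function_hilbert_space_def)

lemma function_hilbert_space_sum:
  assumes "function_hilbert_space H ip" "\<And>i. i \<in> I \<Longrightarrow> F i \<in> H"
  shows "(\<lambda>x. \<Sum>i\<in>I. F i x) \<in> H"
  using assms(2) function_hilbert_spaceD[OF assms(1)]
  by (induction I rule: infinite_finite_induct) simp_all

lemma function_hilbert_space_complete:
  fixes F :: "nat \<Rightarrow> 'a \<Rightarrow> complex"
  assumes "function_hilbert_space H (l2_inner M)" "\<And>n. F n \<in> H"
    and "\<And>\<epsilon>. \<epsilon> > 0 \<Longrightarrow> \<exists>N. \<forall>m\<ge>N. \<forall>n\<ge>N. sqrt (l2_sqnorm M (\<lambda>x. F m x - F n x)) < \<epsilon>"
  obtains f where "f \<in> H" "(\<lambda>n. sqrt (l2_sqnorm M (\<lambda>x. F n x - f x))) \<longlonglongrightarrow> 0"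
proof -
  have "\<forall>F. (\<forall>n::nat. F n \<in> H) \<and>
      (\<forall>\<epsilon>>0. \<exists>N. \<forall>m\<ge>N. \<forall>n\<ge>N. sqrt (l2_sqnorm M (\<lambda>x. F m x - F n x)) < \<epsilon>) \<longrightarrow>
      (\<exists>f\<in>H. (\<lambda>n. sqrt (l2_sqnorm M (\<lambda>x. F n x - f x))) \<longlonglongrightarrow> 0)"
    using assms(1) unfolding function_hilbert_space_def Let_def l2_inner_self Re_complex_of_real by (elim conjE)
  from this[rule_format, of F, OF conjI] have "\<exists>f\<in>H. (\<lambda>n. sqrt (l2_sqnorm M (\<lambda>x. F n x - f x))) \<longlonglongrightarrow> 0"
    using assms(2,3) by simp
  thus ?thesis using that by (elim bexE)
qed

text \<open>Square summability at every point is the boundedness of point evaluations on the span: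
  by Cauchy-Schwarz, every square-summable coefficient sequence then gives a series that converges
  absolutely at every point.\<close>

locale l2_features =
  fixes M :: "'a measure" and e :: "nat \<Rightarrow> 'a \<Rightarrow> complex"
  assumes orthonormal: "l2_orthonormal M e"
    and square_summable: "\<And>x. summable (\<lambda>n. (cmod (e n x))\<^sup>2)"
begin

definition kernel :: "'a \<Rightarrow> 'a \<Rightarrow> complex" where
  "kernel x y = (\<Sum>n. cnj (e n y) * e n x)"

lemma summable_norm_series: "summable (\<lambda>n. (cmod (a n))\<^sup>2) \<Longrightarrow> summable (\<lambda>n. cmod (a n * e n x))"
  by (intro summable_mult_of_squares square_summable)

lemma sums_series: "summable (\<lambda>n. (cmod (a n))\<^sup>2) \<Longrightarrow> (\<lambda>n. a n * e n x) sums (\<Sum>n. a n * e n x)"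
  by (rule summable_sums[OF summable_norm_cancel[OF summable_norm_series]])

text \<open>The pointwise sum and the norm limit are both limits of the same partial sums, the
  latter almost everywhere along a subsequence; hence they agree almost everywhere and the
  properties of the norm limit carry over.\<close>

lemma series_L2:
  assumes a: "summable (\<lambda>n. (cmod (a n))\<^sup>2)"
  defines "f \<equiv> \<lambda>x. \<Sum>n. a n * e n x"
  shows "f \<in> L2 M"
    and "l2_inner M f (e n) = a n"
    and "(\<lambda>n. l2_sqnorm M (\<lambda>x. (\<Sum>k<n. a k * e k x) - f x)) \<longlonglongrightarrow> 0"
proof -
  have [measurable]: "e n \<in> borel_measurable M" for n
    using l2_orthonormalD(1)[OF orthonormal] by (rule L2_measurable)
  have lim: "(\<lambda>n. \<Sum>k<n. a k * e k x) \<longlonglongrightarrow> f x" for x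
    using sums_series[OF a, of x] by (simp add: sums_def f_def)
  have fm [measurable]: "f \<in> borel_measurable M"
    by (rule borel_measurable_LIMSEQ_metric[where f = "\<lambda>n x. \<Sum>k<n. a k * e k x"]) (use lim in auto)
  obtain g r where g: "g \<in> L2 M" "strict_mono (r :: nat \<Rightarrow> nat)"
    "AE x in M. (\<lambda>j. \<Sum>k<r j. a k * e k x) \<longlonglongrightarrow> g x"
    "(\<lambda>n. l2_sqnorm M (\<lambda>x. (\<Sum>k<n. a k * e k x) - g x)) \<longlonglongrightarrow> 0"
    "\<And>n. l2_inner M g (e n) = a n"
    by (rule l2_riesz_fischer[OF orthonormal a]) (rule that)
  have [measurable]: "g \<in> borel_measurable M" using g(1) by (rule L2_measurable)
  have fg: "AE x in M. g x = f x"
    using g(3)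
  proof eventually_elim
    fix x assume "(\<lambda>j. \<Sum>k<r j. a k * e k x) \<longlonglongrightarrow> g x"
    moreover have "(\<lambda>j. \<Sum>k<r j. a k * e k x) \<longlonglongrightarrow> f x"
      using LIMSEQ_subseq_LIMSEQ[OF lim g(2)] by (simp add: o_def)
    ultimately show "g x = f x" by (rule LIMSEQ_unique)
  qed
  have "integrable M (\<lambda>x. (cmod (f x))\<^sup>2)"
    by (rule integrable_cong_AE_imp[OF L2_integrable[OF g(1)]]) (use fg in auto)
  thus "f \<in> L2 M" by (simp add: L2_def fm)
  have "l2_inner M f (e n) = l2_inner M g (e n)"
    unfolding l2_inner_def
  proof (rule integral_cong_AE)
    have "(\<lambda>x. cnj (e n x)) \<in> borel_measurable M"
      using L2_cnj[OF l2_orthonormalD(1)[OF orthonormal]] by (rule L2_measurable)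
    thus "(\<lambda>x. f x * cnj (e n x)) \<in> borel_measurable M" "(\<lambda>x. g x * cnj (e n x)) \<in> borel_measurable M"
      by measurable
  qed (use fg in auto)
  thus "l2_inner M f (e n) = a n" by (simp add: g)
  have "l2_sqnorm M (\<lambda>x. (\<Sum>k<n. a k * e k x) - f x) = l2_sqnorm M (\<lambda>x. (\<Sum>k<n. a k * e k x) - g x)" for n
    unfolding l2_sqnorm_def by (rule integral_cong_AE) (use fg in auto)
  thus "(\<lambda>n. l2_sqnorm M (\<lambda>x. (\<Sum>k<n. a k * e k x) - f x)) \<longlonglongrightarrow> 0" using g(4) by simp
qed

lemma series_inner:
  assumes a: "summable (\<lambda>n. (cmod (a n))\<^sup>2)" and g: "g \<in> L2 M"
  shows "(\<lambda>k. a k * cnj (l2_inner M g (e k))) sums l2_inner M (\<lambda>x. \<Sum>n. a n * e n x) g"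
  by (rule l2_parseval[OF orthonormal series_L2(1)[OF a] g series_L2(3)[OF a]])

lemma series_sqnorm:
  assumes a: "summable (\<lambda>n. (cmod (a n))\<^sup>2)"
  shows "l2_sqnorm M (\<lambda>x. \<Sum>n. a n * e n x) = (\<Sum>n. (cmod (a n))\<^sup>2)"
proof -
  have "(\<lambda>k. a k * cnj (a k)) sums l2_inner M (\<lambda>x. \<Sum>n. a n * e n x) (\<lambda>x. \<Sum>n. a n * e n x)"
    using series_inner[OF a series_L2(1)[OF a]] by (simp only: series_L2(2)[OF a])
  hence "(\<lambda>k. complex_of_real ((cmod (a k))\<^sup>2)) sums complex_of_real (l2_sqnorm M (\<lambda>x. \<Sum>n. a n * e n x))"
    by (simp only: complex_norm_square l2_inner_self)
  thus ?thesis by (simp only: sums_of_real_iff) (rule sums_unique)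
qed

lemma series_space_L2: "l2_series_space e \<subseteq> L2 M"
  unfolding l2_series_space_def using series_L2(1) by blast

lemma series_space_expansion:
  assumes "f \<in> l2_series_space e"
  shows "summable (\<lambda>n. (cmod (l2_inner M f (e n)))\<^sup>2)" "f = (\<lambda>x. \<Sum>n. l2_inner M f (e n) * e n x)"
  using assms unfolding l2_series_space_def by (auto simp: series_L2(2))

lemma kernel_in_space: "(\<lambda>x. kernel x y) \<in> l2_series_space e"
  unfolding kernel_def by (intro l2_series_spaceI) (simp add: square_summable)

text \<open>Here f is any square-integrable function, and the right-hand side is the value at y of
  its orthogonal projection onto the closed span. This generality is what the uniqueness argument
  draws on.\<close>

lemma inner_kernel:
  assumes "f \<in> L2 M"
  shows "l2_inner M f (\<lambda>x. kernel x y) = (\<Sum>n. l2_inner M f (e n) * e n y)"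
proof -
  have "(\<lambda>n. cnj (e n y) * cnj (l2_inner M f (e n))) sums l2_inner M (\<lambda>x. kernel x y) f"
    unfolding kernel_def by (intro series_inner assms) (simp add: square_summable)
  hence "(\<lambda>n. cnj (cnj (e n y) * cnj (l2_inner M f (e n)))) sums cnj (l2_inner M (\<lambda>x. kernel x y) f)"
    by (simp only: sums_cnj)
  thus ?thesis by (subst l2_inner_commute) (simp add: sums_iff mult.commute)
qed

lemma reproducing: "f \<in> l2_series_space e \<Longrightarrow> f y = l2_inner M f (\<lambda>x. kernel x y)"
  using series_space_expansion(2)[of f] series_space_L2 by (subst inner_kernel) (auto dest: fun_cong)

lemma function_hilbert_space_series: "function_hilbert_space (l2_series_space e) (l2_inner M)"
proof -
  let ?H = "l2_series_space e"
  have L2: "f \<in> ?H \<Longrightarrow> f \<in> L2 M" for f using series_space_L2 by blast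
  have zero: "(\<lambda>x. 0) \<in> ?H" using l2_series_spaceI[of "\<lambda>n. 0" e] by simp
  have cmult: "(\<lambda>x. c * f x) \<in> ?H" if f: "f \<in> ?H" for c f
  proof -
    obtain a where a: "summable (\<lambda>n. (cmod (a n))\<^sup>2)" "f = (\<lambda>x. \<Sum>n. a n * e n x)"
      using f unfolding l2_series_space_def by blast
    have "(\<lambda>x. c * f x) = (\<lambda>x. \<Sum>n. (c * a n) * e n x)"
      unfolding a mult.assoc
      by (intro ext suminf_mult[symmetric] sums_summable[OF sums_series[OF a(1)]])
    moreover have "summable (\<lambda>n. (cmod (c * a n))\<^sup>2)"
      by (simp add: norm_mult power_mult_distrib summable_mult a)
    ultimately show ?thesis by (simp only: l2_series_spaceI)
  qed
  have add: "(\<lambda>x. f x + g x) \<in> ?H" if f: "f \<in> ?H" and g: "g \<in> ?H" for f g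
  proof -
    obtain a where a: "summable (\<lambda>n. (cmod (a n))\<^sup>2)" "f = (\<lambda>x. \<Sum>n. a n * e n x)"
      using f unfolding l2_series_space_def by blast
    obtain b where b: "summable (\<lambda>n. (cmod (b n))\<^sup>2)" "g = (\<lambda>x. \<Sum>n. b n * e n x)"
      using g unfolding l2_series_space_def by blast
    have "(\<lambda>x. f x + g x) = (\<lambda>x. \<Sum>n. (a n + b n) * e n x)"
      unfolding a b ring_distribs
      by (intro ext suminf_add sums_summable[OF sums_series[OF a(1)]] sums_summable[OF sums_series[OF b(1)]])
    thus ?thesis by (simp only: l2_series_spaceI summable_norm_sq_add a(1) b(1))
  qed
  \<comment> \<open>A function of seminorm zero has vanishing coefficients, and since the expansion
    holds pointwise it is zero everywhere, not just almost everywhere.\<close>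
  have definite: "f = (\<lambda>x. 0)" if f: "f \<in> ?H" and 0: "l2_sqnorm M f = 0" for f
  proof -
    have "l2_inner M f (e n) = 0" for n
      using l2_Cauchy_Schwarz[OF L2[OF f] l2_orthonormalD(1)[OF orthonormal], of n] 0 by simp
    thus ?thesis using series_space_expansion(2)[OF f] by simp
  qed
  have complete: "\<exists>f\<in>?H. (\<lambda>n. sqrt (l2_sqnorm M (\<lambda>x. F n x - f x))) \<longlonglongrightarrow> 0"
    if F: "\<And>n::nat. F n \<in> ?H"
      and C: "\<And>\<epsilon>. \<epsilon> > 0 \<Longrightarrow> \<exists>N. \<forall>m\<ge>N. \<forall>n\<ge>N. sqrt (l2_sqnorm M (\<lambda>x. F m x - F n x)) < \<epsilon>" for F
  proof -
    have C': "\<exists>N. \<forall>m\<ge>N. \<forall>n\<ge>N. l2_sqnorm M (\<lambda>x. F m x - F n x) < \<epsilon>" if "\<epsilon> > 0" for \<epsilon>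
      using C[of "sqrt \<epsilon>"] that by simp
    obtain g where g: "g \<in> L2 M" "(\<lambda>n. l2_sqnorm M (\<lambda>x. F n x - g x)) \<longlonglongrightarrow> 0"
      using L2_complete[of F, OF L2[OF F] C'] by blast
    \<comment> \<open>The norm limit g need not be a pointwise series. Its projection f is one, and
      replacing g by f does not increase the distance to any \<open>F n\<close>, by Bessel's
      inequality.\<close>
    define f where "f x = (\<Sum>n. l2_inner M g (e n) * e n x)" for x
    note bessel = l2_bessel[OF orthonormal g(1)]
    have f: "f \<in> ?H" unfolding f_def by (intro l2_series_spaceI bessel)
    have cf: "l2_inner M f (e n) = l2_inner M g (e n)" for n
      unfolding f_def by (intro series_L2(2) bessel)
    have "l2_sqnorm M (\<lambda>x. F n x - f x) \<le> l2_sqnorm M (\<lambda>x. F n x - g x)" for n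
    proof -
      have Ff: "(\<lambda>x. F n x - f x) \<in> ?H" using add[OF F[of n] cmult[OF f, of "-1"]] by simp
      have "l2_inner M (\<lambda>x. F n x - f x) (e k) = l2_inner M (\<lambda>x. F n x - g x) (e k)" for k
        by (simp add: l2_inner_diff_left L2 F f g l2_orthonormalD(1)[OF orthonormal] cf)
      hence "(\<lambda>x. F n x - f x) = (\<lambda>x. \<Sum>k. l2_inner M (\<lambda>x. F n x - g x) (e k) * e k x)"
        using series_space_expansion(2)[OF Ff] by simp
      hence "l2_sqnorm M (\<lambda>x. F n x - f x) = (\<Sum>k. (cmod (l2_inner M (\<lambda>x. F n x - g x) (e k)))\<^sup>2)"
        by (simp only:) (intro series_sqnorm l2_bessel[OF orthonormal] L2_diff L2 F g)
      also have "\<dots> \<le> l2_sqnorm M (\<lambda>x. F n x - g x)"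
        by (intro l2_bessel[OF orthonormal] L2_diff L2 F g)
      finally show ?thesis .
    qed
    hence "(\<lambda>n. l2_sqnorm M (\<lambda>x. F n x - f x)) \<longlonglongrightarrow> 0"
      by (intro tendsto_sandwich[OF _ _ tendsto_const g(2)] always_eventually allI l2_sqnorm_nonneg)
    hence "(\<lambda>n. sqrt (l2_sqnorm M (\<lambda>x. F n x - f x))) \<longlonglongrightarrow> sqrt 0" by (rule tendsto_real_sqrt)
    with f show ?thesis by auto
  qed
  show ?thesis
    unfolding function_hilbert_space_def Let_def l2_inner_self
    using zero cmult add definite complete
    by (auto simp: l2_inner_add_left L2 l2_inner_cmult_left l2_sqnorm_nonneg intro!: l2_inner_commute)
qed

lemma reproducing_kernel_hilbert_space_series:
  "reproducing_kernel_hilbert_space (l2_series_space e) (l2_inner M) kernel"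
  unfolding reproducing_kernel_hilbert_space_def
  using function_hilbert_space_series kernel_in_space reproducing by blast

section \<open>Uniqueness of the space with a prescribed kernel\<close>

lemma rkhs_subset_series_space:
  assumes "reproducing_kernel_hilbert_space H (l2_inner M) kernel" "H \<subseteq> L2 M"
  shows "H \<subseteq> l2_series_space e"
proof
  fix f assume f: "f \<in> H"
  hence fL2: "f \<in> L2 M" using assms by blast
  \<comment> \<open>The reproducing property of H together with \<open>inner_kernel\<close> writes f
    at every point as its own Fourier series.\<close>
  have "f = (\<lambda>y. l2_inner M f (\<lambda>x. kernel x y))"
    using assms(1) f unfolding reproducing_kernel_hilbert_space_def by blast
  hence "f = (\<lambda>y. \<Sum>n. l2_inner M f (e n) * e n y)" using fL2 by (simp only: inner_kernel)
  thus "f \<in> l2_series_space e"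
    using l2_series_spaceI[OF l2_bessel(1)[OF orthonormal fL2], of e] by simp
qed

text \<open>Completeness of H yields a norm limit g in H, which a priori differs from f on a null
  set. Both spaces reproduce with the same kernel, and inner products with kernel functions pass to
  the limit, so f and g have equal values everywhere.\<close>

lemma rkhs_closed:
  fixes F :: "nat \<Rightarrow> 'a \<Rightarrow> complex"
  assumes H: "reproducing_kernel_hilbert_space H (l2_inner M) kernel" "H \<subseteq> L2 M"
    and F: "\<And>n. F n \<in> H" and f: "f \<in> l2_series_space e"
    and lim: "(\<lambda>n. l2_sqnorm M (\<lambda>x. F n x - f x)) \<longlonglongrightarrow> 0"
  shows "f \<in> H"
proof -
  have hs: "function_hilbert_space H (l2_inner M)"
    using H(1) by (simp add: reproducing_kernel_hilbert_space_def)
  have FL2: "F n \<in> L2 M" for n using F H(2) by blast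
  have fL2: "f \<in> L2 M" using f series_space_L2 by blast
  have "\<exists>N. \<forall>m\<ge>N. \<forall>n\<ge>N. sqrt (l2_sqnorm M (\<lambda>x. F m x - F n x)) < \<epsilon>" if "\<epsilon> > 0" for \<epsilon>
  proof -
    \<comment> \<open>The quarter makes up for the two factors 2 in
      \<open>l2_sqnorm_diff_triangle\<close>.\<close>
    have "eventually (\<lambda>n. l2_sqnorm M (\<lambda>x. F n x - f x) < \<epsilon>\<^sup>2 / 4) sequentially"
      using that by (intro order_tendstoD(2)[OF lim]) simp
    then obtain N where N: "\<And>n. n \<ge> N \<Longrightarrow> l2_sqnorm M (\<lambda>x. F n x - f x) < \<epsilon>\<^sup>2 / 4"
      by (auto simp: eventually_sequentially)
    have "sqrt (l2_sqnorm M (\<lambda>x. F m x - F n x)) < \<epsilon>" if "m \<ge> N" "n \<ge> N" for m n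
    proof -
      have "l2_sqnorm M (\<lambda>x. F m x - F n x) < \<epsilon>\<^sup>2"
        using l2_sqnorm_diff_triangle[OF FL2[of m] FL2[of n] fL2] N[OF that(1)] N[OF that(2)] by linarith
      thus ?thesis using \<open>\<epsilon> > 0\<close> by (simp add: real_sqrt_less_iff real_less_lsqrt l2_sqnorm_nonneg)
    qed
    thus ?thesis by blast
  qed
  then obtain g where g: "g \<in> H" "(\<lambda>n. sqrt (l2_sqnorm M (\<lambda>x. F n x - g x))) \<longlonglongrightarrow> 0"
    using function_hilbert_space_complete[OF hs, of F] F by blast
  have gL2: "g \<in> L2 M" using g H(2) by blast
  have "(\<lambda>n. (sqrt (l2_sqnorm M (\<lambda>x. F n x - g x)))\<^sup>2) \<longlonglongrightarrow> 0\<^sup>2"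
    by (intro tendsto_power g)
  hence g': "(\<lambda>n. l2_sqnorm M (\<lambda>x. F n x - g x)) \<longlonglongrightarrow> 0" by (simp add: l2_sqnorm_nonneg)
  have "f y = g y" for y
  proof -
    have K: "(\<lambda>x. kernel x y) \<in> L2 M" using kernel_in_space series_space_L2 by blast
    have "l2_inner M f (\<lambda>x. kernel x y) = l2_inner M g (\<lambda>x. kernel x y)"
      by (rule LIMSEQ_unique[OF l2_inner_tendsto[OF FL2 fL2 K lim] l2_inner_tendsto[OF FL2 gL2 K g']])
    moreover have "g y = l2_inner M g (\<lambda>x. kernel x y)"
      using H(1) g(1) unfolding reproducing_kernel_hilbert_space_def by blast
    ultimately show ?thesis using reproducing[OF f] by simp
  qed
  hence "f = g" by blast
  thus ?thesis using g(1) by simp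
qed

lemma series_space_subset_rkhs:
  assumes H: "reproducing_kernel_hilbert_space H (l2_inner M) kernel" "H \<subseteq> L2 M"
    and e: "\<And>n. e n \<in> H"
  shows "l2_series_space e \<subseteq> H"
proof
  fix f assume f: "f \<in> l2_series_space e"
  then obtain a where a: "summable (\<lambda>n. (cmod (a n))\<^sup>2)" "f = (\<lambda>x. \<Sum>n. a n * e n x)"
    unfolding l2_series_space_def by blast
  have hs: "function_hilbert_space H (l2_inner M)"
    using H(1) by (simp add: reproducing_kernel_hilbert_space_def)
  show "f \<in> H"
  proof (rule rkhs_closed[OF H _ f])
    show "(\<lambda>x. \<Sum>k<n. a k * e k x) \<in> H" for n
      by (intro function_hilbert_space_sum[OF hs] function_hilbert_spaceD(3)[OF hs] e)
    show "(\<lambda>n. l2_sqnorm M (\<lambda>x. (\<Sum>k<n. a k * e k x) - f x)) \<longlonglongrightarrow> 0"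
      unfolding a(2) by (rule series_L2(3)[OF a(1)])
  qed
qed

text \<open>Isometry compares two Parseval identities with the same coefficients: in the source by
  completeness of \<psi>, in the target because images are series in \<open>e\<close> by assumption.
  Surjectivity is Riesz-Fischer in the source.\<close>

lemma unitary_map_expansion:
  assumes \<psi>: "l2_orthonormal N \<psi>"
    and complete: "\<And>g. g \<in> L2 N \<Longrightarrow> (\<And>n. l2_inner N g (\<psi> n) = 0) \<Longrightarrow> l2_sqnorm N g = 0"
    and T: "\<And>f. f \<in> L2 N \<Longrightarrow> T f = (\<lambda>x. \<Sum>n. l2_inner N f (\<psi> n) * e n x)"
  shows "unitary_map (L2 N) (l2_inner N) (l2_series_space e) (l2_inner M) T"
  unfolding unitary_map_def
proof (intro conjI ballI allI)
  note bessel = l2_bessel(1)[OF \<psi>]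
  fix f assume f: "f \<in> L2 N"
  show "T (\<lambda>x. c * f x) = (\<lambda>z. c * T f z)" for c
    unfolding T[OF f] T[OF L2_cmult[OF f]] l2_inner_cmult_left mult.assoc
    by (intro ext suminf_mult sums_summable[OF sums_series[OF bessel[OF f]]])
  fix g assume g: "g \<in> L2 N"
  show "T (\<lambda>x. f x + g x) = (\<lambda>z. T f z + T g z)"
    unfolding T[OF f] T[OF g] T[OF L2_add[OF f g]]
    by (simp add: l2_inner_add_left f g l2_orthonormalD(1)[OF \<psi>] ring_distribs)
      (intro ext suminf_add[symmetric] sums_summable[OF sums_series[OF bessel[OF f]]]
        sums_summable[OF sums_series[OF bessel[OF g]]])
  have "(\<lambda>k. l2_inner N f (\<psi> k) * cnj (l2_inner M (T g) (e k))) sums l2_inner M (T f) (T g)"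
    unfolding T[OF f] T[OF g] by (intro series_inner bessel series_L2(1) f g)
  hence "(\<lambda>k. l2_inner N f (\<psi> k) * cnj (l2_inner N g (\<psi> k))) sums l2_inner M (T f) (T g)"
    unfolding T[OF g] series_L2(2)[OF bessel[OF g]] .
  moreover have "(\<lambda>k. l2_inner N f (\<psi> k) * cnj (l2_inner N g (\<psi> k))) sums l2_inner N f g"
    by (rule l2_parseval[OF \<psi> f g l2_complete_expansion[OF \<psi> f complete]])
  ultimately show "l2_inner M (T f) (T g) = l2_inner N f g" by (rule sums_unique2)
next
  show "T ` L2 N = l2_series_space e"
  proof safe
    fix f assume f: "f \<in> L2 N"
    show "T f \<in> l2_series_space e"
      unfolding T[OF f] by (intro l2_series_spaceI l2_bessel(1)[OF \<psi> f])
  next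
    fix h assume "h \<in> l2_series_space e"
    then obtain a where a: "summable (\<lambda>n. (cmod (a n))\<^sup>2)" "h = (\<lambda>x. \<Sum>n. a n * e n x)"
      unfolding l2_series_space_def by blast
    obtain f where f: "f \<in> L2 N" "\<And>n. l2_inner N f (\<psi> n) = a n"
      by (rule l2_riesz_fischer[OF \<psi> a(1)]) (rule that)
    have "h = T f" using f a by (simp add: T)
    thus "h \<in> T ` L2 N" using f(1) by (rule image_eqI)
  qed
qed

end

text \<open>
  The monomials are recovered one after the other from the kernel functions at small \<open>t > 0\<close>:
  after removing the lower terms, \<open>kernel z t\<close> is a multiple of \<open>t ^ n * (e n z + O(t))\<close>.
\<close>

lemma monomial_in_rkhs:
  fixes e :: "nat \<Rightarrow> complex \<Rightarrow> complex" and c :: "nat \<Rightarrow> real"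
  assumes "l2_features M e"
    and e: "\<And>n z. e n z = of_real (c n) * z ^ n" and c: "\<And>n. c n > 0"
    and H: "reproducing_kernel_hilbert_space H (l2_inner M) (l2_features.kernel e)" "H \<subseteq> L2 M"
  shows "e n \<in> H"
proof (induction n rule: less_induct)
  case (less n)
  interpret l2_features M e by fact
  have hs: "function_hilbert_space H (l2_inner M)"
    using H(1) by (simp add: reproducing_kernel_hilbert_space_def)
  \<comment> \<open>Square summability at the point 1 is summability of the squared
    coefficients.\<close>
  have csum: "summable (\<lambda>k. (c k)\<^sup>2)"
    using square_summable[of 1] by (simp add: e)
  define t where "t m = 1 / real (Suc m)" for m
  have t: "0 < t m" "t m \<le> 1" for m by (simp_all add: t_def)
  define F where "F m z = (kernel z (of_real (t m)) - (\<Sum>k<n. of_real (c k * t m ^ k) * e k z)) / of_real (c n * t m ^ n)"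
    for m z
  \<comment> \<open>These are the coefficients of \<open>F m\<close>: zero below n, one at n, and
    beyond n with the factor \<open>t m ^ (k - n)\<close>.\<close>
  define a where "a m k = (if k < n then 0 else of_real (c k * t m ^ k / (c n * t m ^ n)) :: complex)" for m k
  have ek: "e k (of_real x) = of_real (c k * x ^ k)" for k x by (simp add: e)
  have FH: "F m \<in> H" for m
  proof -
    have "(\<lambda>z. (1 / of_real (c n * t m ^ n)) * (kernel z (of_real (t m)) + (-1) * (\<Sum>k<n. of_real (c k * t m ^ k) * e k z))) \<in> H"
    proof (intro function_hilbert_spaceD[OF hs] function_hilbert_space_sum[OF hs])
      show "(\<lambda>z. kernel z (of_real (t m))) \<in> H"
        using H(1) unfolding reproducing_kernel_hilbert_space_def by blast
      show "e k \<in> H" if "k \<in> {..<n}" for k using less that by simp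
    qed
    thus ?thesis unfolding F_def by simp
  qed
  have asum: "summable (\<lambda>k. (cmod (a m k))\<^sup>2)" for m
  proof (rule summable_comparison_test')
    show "summable (\<lambda>k. (c k)\<^sup>2 * (1 / (c n * t m ^ n))\<^sup>2)" by (intro summable_mult2 csum)
    fix k :: nat
    have "(c k * t m ^ k / (c n * t m ^ n))\<^sup>2 = (c k)\<^sup>2 * (1 / (c n * t m ^ n))\<^sup>2 * (t m ^ k)\<^sup>2"
      by (simp add: power_mult_distrib power_divide)
    also have "\<dots> \<le> (c k)\<^sup>2 * (1 / (c n * t m ^ n))\<^sup>2 * 1"
      using t[of m] by (intro mult_left_mono power_le_one) auto
    finally show "norm ((cmod (a m k))\<^sup>2) \<le> (c k)\<^sup>2 * (1 / (c n * t m ^ n))\<^sup>2"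
      by (auto simp: a_def power_divide simp del: of_real_mult of_real_divide of_real_power)
  qed
  have F: "F m z = (\<Sum>k. a m k * e k z)" for m z
  proof -
    let ?w = "complex_of_real (t m)"
    have "(\<lambda>k. cnj (e k ?w) * e k z) sums kernel z ?w"
      unfolding kernel_def by (intro sums_series) (simp add: square_summable)
    hence "(\<lambda>k. of_real (c k * t m ^ k) * e k z) sums kernel z ?w" by (simp only: ek complex_cnj_complex_of_real)
    moreover have "(\<lambda>k. if k \<in> {..<n} then of_real (c k * t m ^ k) * e k z else 0) sums (\<Sum>k<n. of_real (c k * t m ^ k) * e k z)"
      by (rule sums_If_finite_set) simp
    ultimately have "(\<lambda>k. (of_real (c k * t m ^ k) * e k z - (if k \<in> {..<n} then of_real (c k * t m ^ k) * e k z else 0))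
        / of_real (c n * t m ^ n)) sums F m z"
      unfolding F_def by (intro sums_divide sums_diff)
    also have "(\<lambda>k. (of_real (c k * t m ^ k) * e k z - (if k \<in> {..<n} then of_real (c k * t m ^ k) * e k z else 0))
        / of_real (c n * t m ^ n)) = (\<lambda>k. a m k * e k z)"
      by (auto simp: a_def fun_eq_iff)
    finally show ?thesis by (rule sums_unique)
  qed
  show ?case
  proof (rule rkhs_closed[OF H FH])
    have delta: "e n = (\<lambda>x. \<Sum>k. (if k = n then 1 else 0) * e k x)"
      using sums_unique[OF sums_If_finite_set[of "{n}" "\<lambda>k. e k x" for x]] by (simp add: if_distrib[of "\<lambda>y. y * _"] cong: if_cong)
    have dsum: "summable (\<lambda>k. (cmod (if k = n then 1 else 0))\<^sup>2)"
      by (rule summable_finite[of "{n}"]) auto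
    show "e n \<in> l2_series_space e"
      by (subst delta) (rule l2_series_spaceI[OF dsum])
    \<comment> \<open>Every coefficient beyond n has at least one factor \<open>t m\<close>, and
      \<open>t m\<close> is at most 1, so the square of \<open>t m\<close> comes out of the whole
      tail.\<close>
    define S where "S = (\<Sum>k. (c k)\<^sup>2) / (c n)\<^sup>2"
    have le: "l2_sqnorm M (\<lambda>x. F m x - e n x) \<le> (t m)\<^sup>2 * S" for m
    proof -
      define b where "b k = a m k - (if k = n then 1 else 0)" for k
      have bsum: "summable (\<lambda>k. (cmod (b k))\<^sup>2)"
        using summable_norm_sq_add[OF asum[of m], of "\<lambda>k. - (if k = n then 1 else 0)"] dsum
        by (simp add: b_def[abs_def])
      have "F m x - e n x = (\<Sum>k. b k * e k x)" for x
      proof -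
        have "F m x - e n x = (\<Sum>k. a m k * e k x) - (\<Sum>k. (if k = n then 1 else 0) * e k x)"
          by (simp only: F fun_cong[OF delta, symmetric])
        also have "\<dots> = (\<Sum>k. a m k * e k x - (if k = n then 1 else 0) * e k x)"
          by (intro suminf_diff sums_summable[OF sums_series[OF asum]] sums_summable[OF sums_series[OF dsum]])
        finally show ?thesis by (simp only: b_def left_diff_distrib)
      qed
      hence "l2_sqnorm M (\<lambda>x. F m x - e n x) = (\<Sum>k. (cmod (b k))\<^sup>2)"
        by (simp only: series_sqnorm[OF bsum])
      also have "\<dots> \<le> (\<Sum>k. (t m)\<^sup>2 * ((c k)\<^sup>2 / (c n)\<^sup>2))"
      proof (rule suminf_le[OF _ bsum])
        show "summable (\<lambda>k. (t m)\<^sup>2 * ((c k)\<^sup>2 / (c n)\<^sup>2))" by (intro summable_mult summable_divide csum)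
        fix k
        consider "k < n" | "k = n" | "k > n" by linarith
        thus "(cmod (b k))\<^sup>2 \<le> (t m)\<^sup>2 * ((c k)\<^sup>2 / (c n)\<^sup>2)"
        proof cases
          case 3
          then obtain j where j: "k = Suc (n + j)" by (metis less_iff_Suc_add)
          have "b k = of_real (t m * t m ^ j * (c k / c n))"
            using c[of n] t[of m] by (simp add: b_def a_def j power_add field_simps)
          hence "(cmod (b k))\<^sup>2 = (t m * t m ^ j * (c k / c n))\<^sup>2"
            by (simp only: norm_of_real power2_abs)
          also have "\<dots> = (t m)\<^sup>2 * ((c k)\<^sup>2 / (c n)\<^sup>2) * (t m ^ j)\<^sup>2"
            by (simp add: power_mult_distrib power_divide mult_ac)
          also have "\<dots> \<le> (t m)\<^sup>2 * ((c k)\<^sup>2 / (c n)\<^sup>2) * 1"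
            using t[of m] by (intro mult_left_mono power_le_one) auto
          finally show ?thesis by simp
        qed (use c[of n] t[of m] in \<open>auto simp: b_def a_def\<close>)
      qed
      also have "\<dots> = (t m)\<^sup>2 * S"
        unfolding S_def by (simp add: suminf_mult summable_divide csum suminf_divide)
      finally show ?thesis .
    qed
    have "t \<longlonglongrightarrow> 0"
      unfolding t_def using LIMSEQ_inverse_real_of_nat by (simp only: inverse_eq_divide)
    hence "(\<lambda>m. (t m)\<^sup>2 * S) \<longlonglongrightarrow> 0\<^sup>2 * S" by (intro tendsto_intros)
    hence lim: "(\<lambda>m. (t m)\<^sup>2 * S) \<longlonglongrightarrow> 0" by simp
    show "(\<lambda>m. l2_sqnorm M (\<lambda>x. F m x - e n x)) \<longlonglongrightarrow> 0"
      by (rule tendsto_sandwich[OF _ _ tendsto_const lim]) (simp_all add: l2_sqnorm_nonneg le)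
  qed
qed

theorem rkhs_of_monomials_unique:
  fixes e :: "nat \<Rightarrow> complex \<Rightarrow> complex" and c :: "nat \<Rightarrow> real"
  assumes "l2_features M e"
    and "\<And>n z. e n z = of_real (c n) * z ^ n" and "\<And>n. c n > 0"
    and "reproducing_kernel_hilbert_space H (l2_inner M) (l2_features.kernel e)" "H \<subseteq> L2 M"
  shows "H = l2_series_space e"
proof -
  interpret l2_features M e by fact
  show ?thesis
    using rkhs_subset_series_space[OF assms(4,5)] series_space_subset_rkhs[OF assms(4,5)]
      monomial_in_rkhs[OF assms] by blast
qed

section \<open>Densities of laws with integrable characteristic function\<close>

text \<open>The Fourier inversion integral of the characteristic function. Taking the real part
  makes it a candidate for a density by type.\<close>

definition char_inverse :: "real measure \<Rightarrow> real \<Rightarrow> real" where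
  "char_inverse M x = Re (CLBINT t. iexp (- (t * x)) * char M t) / (2 * pi)"

context real_distribution
begin

lemma isCont_char_inverse:
  assumes "integrable lborel (char M)"
  shows "isCont (char_inverse M) x"
  unfolding continuous_at_sequentially
proof safe
  fix X assume X: "X \<longlonglongrightarrow> x"
  have "(\<lambda>n. CLBINT t. iexp (- (t * X n)) * char M t) \<longlonglongrightarrow> (CLBINT t. iexp (- (t * x)) * char M t)"
    by (rule integral_dominated_convergence[where w="\<lambda>t. cmod (char M t)"])
       (use assms in \<open>auto intro!: tendsto_intros X AE_I2 simp: norm_mult\<close>)
  thus "(char_inverse M \<circ> X) \<longlonglongrightarrow> char_inverse M x"
    unfolding comp_def char_inverse_def by (intro tendsto_intros) auto
qed

lemma char_inverse_measurable:
  "integrable lborel (char M) \<Longrightarrow> char_inverse M \<in> borel_measurable borel"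
  by (intro borel_measurable_continuous_onI continuous_at_imp_continuous_on ballI isCont_char_inverse)

lemma integral_iexp_Icc:
  assumes "a \<le> b" "t \<noteq> 0"
  shows "(CLBINT x. indicator {a..b} x *\<^sub>R iexp (- (t * x))) = (iexp (- (t * a)) - iexp (- (t * b))) / (\<i> * t)"
proof -
  have "((\<lambda>x. iexp (- (t * x)) / (- \<i> * t)) has_vector_derivative iexp (- (t * x))) (at x within {a..b})" for x
  proof -
    have "((\<lambda>x. exp (\<i> * - (complex_of_real t * x)) / (- \<i> * t)) has_field_derivative exp (\<i> * - (complex_of_real t * x))) (at (complex_of_real x))"
      using assms(2) by (auto intro!: derivative_eq_intros simp: field_simps)
    from has_vector_derivative_real_field[OF this] show ?thesis by (simp add: has_vector_derivative_at_within)
  qed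
  hence "(CLBINT x. indicator {a..b} x *\<^sub>R iexp (- (t * x))) = iexp (- (t * b)) / (- \<i> * t) - iexp (- (t * a)) / (- \<i> * t)"
    using assms(1) by (intro integral_FTC_Icc) (auto intro!: continuous_intros)
  thus ?thesis by (simp add: diff_divide_distrib)
qed

text \<open>Levy's formula gives the probability as a limit of truncated integrals. Integrability of
  the characteristic function replaces the limit by an absolutely convergent integral, and Fubini
  applies once the difference quotient of exponentials is written as an integral over
  [a, b].\<close>

lemma measure_Ioc_char_inverse:
  assumes int: "integrable lborel (char M)" and atoms: "\<And>x. measure M {x} = 0" and ab: "a \<le> b"
  shows "measure M {a<..b} = (\<integral>x. indicator {a..b} x * char_inverse M x \<partial>lborel)"
proof -
  define F where "F t = (iexp (- (t * a)) - iexp (- (t * b))) / (\<i> * t) * char M t" for t :: real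
  have F_bound: "cmod (F t) \<le> (b - a) * cmod (char M t)" for t
  proof (cases "t = 0")
    case False
    have "cmod ((iexp (- (t * a)) - iexp (- (t * b))) / (\<i> * t)) \<le> b - a"
      using Levy_Inversion_aux2[of "-b" "-a" t] ab False by simp
    thus ?thesis unfolding F_def norm_mult[of _ "char M t"] by (intro mult_right_mono) auto
  qed (use ab in \<open>simp add: F_def\<close>)
  have Fm [measurable]: "F \<in> borel_measurable borel" unfolding F_def by measurable
  have lim: "(\<lambda>n::nat. 1 / (2 * pi) * (CLBINT t=-real n..real n. F t)) \<longlonglongrightarrow> 1 / (2 * pi) * (CLBINT t. F t)"
  proof (intro tendsto_intros)
    have "(\<lambda>n. CLBINT t. indicator {-real n..real n} t *\<^sub>R F t) \<longlonglongrightarrow> (CLBINT t. F t)"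
    proof (rule integral_dominated_convergence[where w="\<lambda>t. (b - a) * cmod (char M t)"])
      show "AE t in lborel. (\<lambda>n. indicator {-real n..real n} t *\<^sub>R F t) \<longlonglongrightarrow> F t"
      proof (intro AE_I2 tendsto_eventually)
        fix t :: real
        obtain N where "\<bar>t\<bar> \<le> real N" using real_arch_simple by blast
        thus "\<forall>\<^sub>F n in sequentially. indicator {-real n..real n} t *\<^sub>R F t = F t"
          by (intro eventually_sequentiallyI[of N]) (auto simp: indicator_def)
      qed
      show "AE t in lborel. norm (indicator {-real n..real n} t *\<^sub>R F t) \<le> (b - a) * cmod (char M t)" for n
        using F_bound ab by (auto intro!: AE_I2 mult_nonneg_nonneg simp: indicator_def)
    qed (use int in auto)
    thus "(\<lambda>n. CLBINT t=-real n..real n. F t) \<longlonglongrightarrow> (CLBINT t. F t)"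
      by (subst interval_integral_Icc) (auto simp: set_lebesgue_integral_def)
  qed
  have "(\<lambda>n::nat. 1 / (2 * pi) * (CLBINT t=-real n..real n. F t)) \<longlonglongrightarrow> complex_of_real (measure M {a<..b})"
    using Levy_Inversion[OF ab atoms atoms] unfolding F_def by simp
  from LIMSEQ_unique[OF this lim]
  have *: "complex_of_real (measure M {a<..b}) = 1 / (2 * pi) * (CLBINT t. F t)" .
  have "(CLBINT t. F t) = (CLBINT t. CLBINT x. indicator {a..b} x *\<^sub>R (iexp (- (t * x)) * char M t))"
  proof (rule integral_cong_AE)
    \<comment> \<open>At t = 0 division by zero makes \<open>F t\<close> equal to 0 instead of the
      limiting value; a single point does not matter.\<close>
    have "AE t in lborel. t \<noteq> (0::real)" by (rule AE_lborel_singleton)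
    thus "AE t in lborel. F t = (CLBINT x. indicator {a..b} x *\<^sub>R (iexp (- (t * x)) * char M t))"
    proof eventually_elim
      fix t :: real assume t: "t \<noteq> 0"
      have "(CLBINT x. indicator {a..b} x *\<^sub>R (iexp (- (t * x)) * char M t)) =
        (CLBINT x. indicator {a..b} x *\<^sub>R iexp (- (t * x)) * char M t)" by simp
      also have "\<dots> = F t" by (subst integral_mult_left_zero) (simp only: F_def integral_iexp_Icc[OF ab t])
      finally show "F t = (CLBINT x. indicator {a..b} x *\<^sub>R (iexp (- (t * x)) * char M t))" ..
    qed
  qed measurable
  also have "\<dots> = (CLBINT x. CLBINT t. indicator {a..b} x *\<^sub>R (iexp (- (t * x)) * char M t))"
  proof (rule lborel_pair.Fubini_integral[symmetric])
    show "integrable (lborel \<Otimes>\<^sub>M lborel) (\<lambda>(t, x). indicator {a..b} x *\<^sub>R (iexp (- (t * x)) * char M t))"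
    proof (rule lborel_pair.Fubini_integrable)
      have "(LBINT x. norm (indicator {a..b} x *\<^sub>R (iexp (- (t * x)) * char M t))) = (b - a) * cmod (char M t)" for t
        using ab by (simp add: norm_mult)
      thus "integrable lborel (\<lambda>t. LBINT x. norm (case (t, x) of (t, x) \<Rightarrow> indicator {a..b} x *\<^sub>R (iexp (- (t * x)) * char M t)))"
        using int by simp
      show "AE t in lborel. integrable lborel (\<lambda>x. case (t, x) of (t, x) \<Rightarrow> indicator {a..b} x *\<^sub>R (iexp (- (t * x)) * char M t))"
        by (intro AE_I2) (auto intro!: borel_integrable_compact continuous_intros)
    qed measurable
  qed
  also have "\<dots> = (CLBINT x. indicator {a..b} x *\<^sub>R (CLBINT t. iexp (- (t * x)) * char M t))" by simp
  finally have F_eq: "(CLBINT t. F t) = (CLBINT x. indicator {a..b} x *\<^sub>R (CLBINT t. iexp (- (t * x)) * char M t))" .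
  have "integrable lborel (\<lambda>x. indicator {a..b} x *\<^sub>R (CLBINT t. iexp (- (t * x)) * char M t))"
  proof (rule borel_integrable_compact)
    show "continuous_on {a..b} (\<lambda>x. CLBINT t. iexp (- (t * x)) * char M t)"
      unfolding continuous_on_sequentially comp_def
    proof safe
      fix X :: "nat \<Rightarrow> real" and x :: real assume "X \<longlonglongrightarrow> x"
      thus "(\<lambda>n. CLBINT t. iexp (- (t * X n)) * char M t) \<longlonglongrightarrow> (CLBINT t. iexp (- (t * x)) * char M t)"
        by (intro integral_dominated_convergence[where w="\<lambda>t. cmod (char M t)"])
           (use int in \<open>auto intro!: tendsto_intros AE_I2 simp: norm_mult\<close>)
    qed
  qed simp
  hence "Re (CLBINT t. F t) = (LBINT x. Re (indicator {a..b} x *\<^sub>R (CLBINT t. iexp (- (t * x)) * char M t)))"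
    unfolding F_eq by (rule integral_Re[symmetric])
  hence "Re (CLBINT t. F t) / (2 * pi) = (\<integral>x. indicator {a..b} x * char_inverse M x \<partial>lborel)"
    by (simp add: char_inverse_def flip: integral_divide_zero)
  moreover have "measure M {a<..b} = Re (1 / (2 * pi) * (CLBINT t. F t))"
    using * by (metis Re_complex_of_real)
  ultimately show ?thesis by simp
qed

text \<open>By continuity a negative value would persist on a short interval to the right, and that
  interval would have negative probability.\<close>

lemma char_inverse_nonneg:
  assumes int: "integrable lborel (char M)" and atoms: "\<And>x. measure M {x} = 0"
  shows "char_inverse M x \<ge> 0"
proof (rule ccontr)
  let ?q = "char_inverse M"
  assume "\<not> ?q x \<ge> 0"
  hence "eventually (\<lambda>y. ?q y < ?q x / 2) (at x)"
    using isCont_char_inverse[OF int, of x] unfolding isCont_def by (intro order_tendstoD(2)) auto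
  then obtain d where d: "d > 0" "\<And>y. y \<noteq> x \<Longrightarrow> dist y x < d \<Longrightarrow> ?q y < ?q x / 2"
    unfolding eventually_at by auto
  define b where "b = x + d / 2"
  have le: "?q y \<le> ?q x / 2" if "y \<in> {x..b}" for y
  proof (cases "y = x")
    case True thus ?thesis using \<open>\<not> ?q x \<ge> 0\<close> by simp
  next
    case False
    have "dist y x < d" using that d(1) by (auto simp: b_def dist_real_def)
    thus ?thesis using d(2)[OF False] by simp
  qed
  have "0 \<le> measure M {x<..b}" by simp
  also have "\<dots> = (\<integral>y. indicator {x..b} y * ?q y \<partial>lborel)"
    using d(1) by (intro measure_Ioc_char_inverse int atoms) (simp add: b_def)
  also have "\<dots> \<le> (\<integral>y. indicator {x..b} y * (?q x / 2) \<partial>lborel)"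
  proof (rule integral_mono)
    show "integrable lborel (\<lambda>y. indicator {x..b} y * ?q y)"
      using borel_integrable_compact[of "{x..b}" ?q] isCont_char_inverse[OF int]
      by (auto intro: continuous_at_imp_continuous_on)
    show "integrable lborel (\<lambda>y. indicator {x..b} y * (?q x / 2))"
      by (intro integrable_mult_left integrable_real_indicator) (simp_all add: emeasure_lborel_Icc_eq)
  qed (use le in \<open>auto simp: indicator_def\<close>)
  also have "\<dots> = (b - x) * (?q x / 2)" using d(1) by (simp add: b_def)
  also have "\<dots> < 0" using d(1) \<open>\<not> ?q x \<ge> 0\<close> by (intro mult_pos_neg) (auto simp: b_def)
  finally show False by simp
qed

theorem density_char_inverse:
  assumes int: "integrable lborel (char M)" and atoms: "\<And>x. measure M {x} = 0"
  shows "M = density lborel (\<lambda>x. ennreal (char_inverse M x))"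
proof (rule measure_eqI_lessThan)
  let ?q = "char_inverse M" and ?D = "density lborel (\<lambda>x. ennreal (char_inverse M x))"
  have [measurable]: "?q \<in> borel_measurable borel" by (rule char_inverse_measurable[OF int])
  show "sets M = sets borel" "sets ?D = sets borel" by simp_all
  show "emeasure M {x<..} < \<infinity>" for x by (simp add: emeasure_eq_measure)
  have Ioc: "emeasure M {a<..b} = emeasure ?D {a<..b}" if "a \<le> b" for a b
  proof -
    have i: "integrable lborel (\<lambda>y. indicator {a..b} y * ?q y)"
      using borel_integrable_compact[of "{a..b}" ?q] isCont_char_inverse[OF int]
      by (auto intro: continuous_at_imp_continuous_on)
    have "emeasure ?D {a<..b} = (\<integral>\<^sup>+y. ennreal (?q y) * indicator {a<..b} y \<partial>lborel)"
      by (rule emeasure_density) auto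
    also have "\<dots> = (\<integral>\<^sup>+y. ennreal (indicator {a..b} y * ?q y) \<partial>lborel)"
    proof (rule nn_integral_cong_AE)
      have "AE y in lborel. y \<noteq> a" by (rule AE_lborel_singleton)
      thus "AE y in lborel. ennreal (?q y) * indicator {a<..b} y = ennreal (indicator {a..b} y * ?q y)"
        by eventually_elim (auto simp: indicator_def)
    qed
    also have "\<dots> = ennreal (\<integral>y. indicator {a..b} y * ?q y \<partial>lborel)"
      by (intro nn_integral_eq_integral i AE_I2) (simp add: char_inverse_nonneg int atoms)
    also have "\<dots> = emeasure M {a<..b}"
      by (simp add: emeasure_eq_measure measure_Ioc_char_inverse[OF int atoms that])
    finally show ?thesis ..
  qed
  fix x :: real
  \<comment> \<open>Intervals on which the two measures are known to agree exhaust the half-line, so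
    continuity from below extends the agreement.\<close>
  have U: "(\<Union>n. {x<..x + real n}) = {x<..}"
  proof safe
    fix y assume "y > x"
    obtain n where "y - x \<le> real n" using real_arch_simple by blast
    with \<open>y > x\<close> show "y \<in> (\<Union>n. {x<..x + real n})" by (intro UN_I[of n]) auto
  qed auto
  have inc: "incseq (\<lambda>n. {x<..x + real n})" by (auto simp: incseq_def)
  have "emeasure M {x<..} = (SUP n. emeasure M {x<..x + real n})"
    by (subst SUP_emeasure_incseq) (use inc in \<open>auto simp: U\<close>)
  also have "\<dots> = (SUP n. emeasure ?D {x<..x + real n})" by (simp add: Ioc)
  also have "\<dots> = emeasure ?D {x<..}"
    by (subst SUP_emeasure_incseq) (use inc in \<open>auto simp: U\<close>)
  finally show "emeasure M {x<..} = emeasure ?D {x<..}" .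
qed

end

section \<open>Logarithms of gamma and beta variables\<close>

text \<open>The substitution rule is available on compact intervals, and monotone convergence along
  [exp (-n - 1), exp (n + 1)] extends it to the positive axis.\<close>

lemma nn_integral_exp_substitution:
  fixes f :: "real \<Rightarrow> ennreal"
  assumes [measurable]: "f \<in> borel_measurable borel"
  shows "(\<integral>\<^sup>+x. f x * indicator {0<..} x \<partial>lborel) = (\<integral>\<^sup>+u. f (exp u) * ennreal (exp u) \<partial>lborel)"
proof -
  \<comment> \<open>With \<open>Suc n\<close> the interval has positive length already at n =
    0.\<close>
  have sub: "(\<integral>\<^sup>+x. f x * indicator {exp (- real (Suc n))..exp (real (Suc n))} x \<partial>lborel) =
      (\<integral>\<^sup>+u. f (exp u) * ennreal (exp u) * indicator {- real (Suc n)..real (Suc n)} u \<partial>lborel)" for n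
    by (rule nn_integral_substitution_aux) (auto intro!: derivative_eq_intros continuous_intros)
  have ind_mono: "indicator {exp (- real (Suc m))..exp (real (Suc m))} x \<le> (indicator {exp (- real (Suc n))..exp (real (Suc n))} x :: ennreal)"
    if "m \<le> n" for m n and x :: real
  proof (rule indicator_leI)
    have "exp (- real (Suc n)) \<le> exp (- real (Suc m))" "exp (real (Suc m)) \<le> exp (real (Suc n))"
      using that by (simp_all del: of_nat_Suc)
    thus "x \<in> {exp (- real (Suc m))..exp (real (Suc m))} \<Longrightarrow> x \<in> {exp (- real (Suc n))..exp (real (Suc n))}"
      unfolding atLeastAtMost_iff by linarith
  qed
  have "(\<integral>\<^sup>+x. f x * indicator {0<..} x \<partial>lborel) =
      (\<integral>\<^sup>+x. (SUP n. f x * indicator {exp (- real (Suc n))..exp (real (Suc n))} x) \<partial>lborel)"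
  proof (rule nn_integral_cong)
    fix x :: real
    have mono: "mono (\<lambda>n. f x * indicator {exp (- real (Suc n))..exp (real (Suc n))} x)"
      by (rule monoI, rule mult_left_mono[OF ind_mono]) simp_all
    show "f x * indicator {0<..} x = (SUP n. f x * indicator {exp (- real (Suc n))..exp (real (Suc n))} x)"
    proof (cases "x > 0")
      case True
      obtain N where N: "\<bar>ln x\<bar> \<le> real N" using real_arch_simple by blast
      have "(\<lambda>n. f x * indicator {exp (- real (Suc n))..exp (real (Suc n))} x) \<longlonglongrightarrow> f x * indicator {0<..} x"
      proof (rule tendsto_eventually, rule eventually_sequentiallyI[of N])
        fix n assume "N \<le> n"
        hence "- real (Suc n) \<le> ln x" "ln x \<le> real (Suc n)" using N by auto
        hence "exp (- real (Suc n)) \<le> exp (ln x)" "exp (ln x) \<le> exp (real (Suc n))" by (simp_all only: exp_le_cancel_iff)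
        hence "x \<in> {exp (- real (Suc n))..exp (real (Suc n))}" using True by simp
        thus "f x * indicator {exp (- real (Suc n))..exp (real (Suc n))} x = f x * indicator {0<..} x"
          using True by simp
      qed
      from LIMSEQ_unique[OF this LIMSEQ_SUP[OF mono]] show ?thesis .
    next
      case False
      hence "indicator {exp (- real (Suc n))..exp (real (Suc n))} x = (0::ennreal)" for n
        using exp_gt_zero[of "- real (Suc n)"] by (auto simp: indicator_def simp del: exp_gt_zero)
      thus ?thesis using False by simp
    qed
  qed
  also have "\<dots> = (SUP n. \<integral>\<^sup>+x. f x * indicator {exp (- real (Suc n))..exp (real (Suc n))} x \<partial>lborel)"
    by (rule nn_integral_monotone_convergence_SUP)
      (auto simp: incseq_def le_fun_def simp del: of_nat_Suc intro!: mult_left_mono ind_mono)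
  also have "\<dots> = (SUP n. \<integral>\<^sup>+u. f (exp u) * ennreal (exp u) * indicator {- real (Suc n)..real (Suc n)} u \<partial>lborel)"
    by (simp only: sub)
  also have "\<dots> = (\<integral>\<^sup>+u. (SUP n. f (exp u) * ennreal (exp u) * indicator {- real (Suc n)..real (Suc n)} u) \<partial>lborel)"
    by (rule nn_integral_monotone_convergence_SUP[symmetric]) (auto simp: incseq_def le_fun_def indicator_def)
  also have "\<dots> = (\<integral>\<^sup>+u. f (exp u) * ennreal (exp u) \<partial>lborel)"
  proof (rule nn_integral_cong)
    fix u :: real
    have mono: "mono (\<lambda>n. f (exp u) * ennreal (exp u) * indicator {- real (Suc n)..real (Suc n)} u)"
      by (rule monoI, rule mult_left_mono) (auto simp: indicator_def)
    obtain N where N: "\<bar>u\<bar> \<le> real N" using real_arch_simple by blast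
    have "(\<lambda>n. f (exp u) * ennreal (exp u) * indicator {- real (Suc n)..real (Suc n)} u) \<longlonglongrightarrow> f (exp u) * ennreal (exp u)"
      by (rule tendsto_eventually, rule eventually_sequentiallyI[of N]) (use N in \<open>auto simp: indicator_def\<close>)
    from LIMSEQ_unique[OF LIMSEQ_SUP[OF mono] this]
    show "(SUP n. f (exp u) * ennreal (exp u) * indicator {- real (Suc n)..real (Suc n)} u) = f (exp u) * ennreal (exp u)" .
  qed
  finally show ?thesis .
qed

text \<open>The substitution x = exp u at the level of measures, so that it also serves Bochner
  integrals of complex functions.\<close>

lemma distr_exp_lborel:
  "distr (density lborel (\<lambda>u. ennreal (exp u))) borel exp = density lborel (indicator {0<..} :: real \<Rightarrow> ennreal)"
proof (rule measure_eqI)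
  fix A :: "real set" assume "A \<in> sets (distr (density lborel (\<lambda>u. ennreal (exp u))) borel exp)"
  hence [measurable]: "A \<in> sets borel" by simp
  have [measurable]: "exp -` A \<in> sets borel"
    using measurable_sets[of exp borel borel A] by simp
  have "emeasure (distr (density lborel (\<lambda>u. ennreal (exp u))) borel exp) A =
      (\<integral>\<^sup>+u. ennreal (exp u) * indicator (exp -` A) u \<partial>lborel)"
    by (subst emeasure_distr, measurable) (simp add: emeasure_density)
  also have "\<dots> = (\<integral>\<^sup>+u. indicator A (exp u) * ennreal (exp u) \<partial>lborel)"
    by (intro nn_integral_cong) (auto simp: indicator_def)
  also have "\<dots> = (\<integral>\<^sup>+x. indicator A x * indicator {0<..} x \<partial>lborel)"
    by (rule nn_integral_exp_substitution[symmetric]) measurable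
  also have "\<dots> = emeasure (density lborel (indicator {0<..} :: real \<Rightarrow> ennreal)) A"
    by (subst emeasure_density) (simp_all add: mult.commute)
  finally show "emeasure (distr (density lborel (\<lambda>u. ennreal (exp u))) borel exp) A =
    emeasure (density lborel (indicator {0<..} :: real \<Rightarrow> ennreal)) A" .
qed simp

text \<open>Euler's integral after x = exp u. In this form the imaginary part of s acts as the
  frequency of a Fourier transform.\<close>

lemma has_bochner_integral_Gamma_log:
  assumes s: "Re s > 0"
  shows "has_bochner_integral lborel (\<lambda>u. exp (s * of_real u - of_real (exp u))) (Gamma s)"
proof -
  \<comment> \<open>Writing the power through \<open>ln\<close> and setting it to 0 off the positive
    axis gives a Borel function on the whole line.\<close>
  define g where "g x = (if x > 0 then exp ((s - 1) * of_real (ln x)) / of_real (exp x) else 0)" for x :: real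
  have gm [measurable]: "g \<in> borel_measurable borel"
    unfolding g_def by measurable
  have g_eq: "complex_of_real x powr (s - 1) / of_real (exp x) = g x" if "x \<in> {0<..}" for x
    using that by (simp add: g_def powr_def Ln_of_real)
  have abs: "set_integrable lebesgue {0<..} g"
    using absolutely_integrable_Gamma_integral'[OF s] by (rule set_integrable_cong[THEN iffD1, rotated -1]) (simp_all add: g_eq)
  have "integrable lborel (\<lambda>x. indicator {0<..} x *\<^sub>R g x)"
    using abs unfolding set_integrable_def by (subst (asm) integrable_completion) auto
  hence i1: "integrable (density lborel (indicator {0<..})) g"
    using integrable_density[of g lborel "indicator {0<..}"] by (simp add: ennreal_indicator)
  have "(\<integral>x. indicator {0<..} x *\<^sub>R g x \<partial>lborel) = (LINT x:{0<..}|lebesgue. g x)"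
    unfolding set_lebesgue_integral_def by (rule integral_completion[symmetric]) measurable
  also have "\<dots> = integral {0<..} g"
    using abs by (rule set_lebesgue_integral_eq_integral)
  also have "\<dots> = Gamma s"
    by (rule integral_unique, rule has_integral_eq[OF g_eq Gamma_integral_complex'[OF s]])
  finally have i2: "integral\<^sup>L (density lborel (indicator {0<..})) g = Gamma s"
    using integral_density[of g lborel "indicator {0<..}"] by (simp add: ennreal_indicator)
  have eq: "exp u *\<^sub>R g (exp u) = exp (s * of_real u - of_real (exp u))" for u
  proof -
    have "g (exp u) = exp ((s - 1) * of_real u) / exp (of_real (exp u))"
      by (simp add: g_def flip: exp_of_real)
    thus ?thesis
      by (simp add: scaleR_conv_of_real flip: exp_of_real exp_add exp_diff) (simp add: algebra_simps)
  qed
  have "integrable (density lborel (\<lambda>u. ennreal (exp u))) (\<lambda>u. g (exp u))"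
    using i1 unfolding distr_exp_lborel[symmetric] by (subst (asm) integrable_distr_eq) auto
  hence "integrable lborel (\<lambda>u. exp u *\<^sub>R g (exp u))"
    by (subst (asm) integrable_density) auto
  moreover have "(\<integral>u. exp u *\<^sub>R g (exp u) \<partial>lborel) = Gamma s"
    using i2 unfolding distr_exp_lborel[symmetric]
    by (subst (asm) integral_distr) (auto simp: integral_density)
  ultimately show ?thesis unfolding eq by (simp add: has_bochner_integral_iff)
qed

lemma nn_integral_Gamma_log:
  assumes a: "a > (0::real)"
  shows "(\<integral>\<^sup>+u. ennreal (exp (a * u - exp u)) \<partial>lborel) = ennreal (Gamma a)"
proof -
  have "has_bochner_integral lborel (\<lambda>u. Re (exp (of_real a * of_real u - of_real (exp u)))) (Re (Gamma (of_real a)))"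
    by (intro has_bochner_integral_bounded_linear[OF bounded_linear_Re] has_bochner_integral_Gamma_log) (use a in simp)
  also have "(\<lambda>u. Re (exp (of_real a * of_real u - of_real (exp u)))) = (\<lambda>u. exp (a * u - exp u))"
    by (simp add: fun_eq_iff Re_exp)
  also have "Re (Gamma (of_real a)) = Gamma a" by (simp add: Gamma_complex_of_real)
  finally show ?thesis
    by (subst nn_integral_eq_integral) (auto simp: has_bochner_integral_iff)
qed

text \<open>The law of ln X, where X has the gamma law with shape \<open>a\<close> and rate
  1.\<close>

definition log_gamma_measure :: "real \<Rightarrow> real measure" where
  "log_gamma_measure a = density lborel (\<lambda>u. ennreal (exp (a * u - exp u) / Gamma a))"

lemma sets_log_gamma [simp, measurable_cong]: "sets (log_gamma_measure a) = sets borel"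
  by (simp add: log_gamma_measure_def)

lemma space_log_gamma [simp]: "space (log_gamma_measure a) = UNIV"
  by (simp add: log_gamma_measure_def)

lemma nn_integral_exp_log_gamma:
  assumes "a > 0" "a + s > 0"
  shows "(\<integral>\<^sup>+u. ennreal (exp (s * u)) \<partial>log_gamma_measure a) = ennreal (Gamma (a + s) / Gamma a)"
proof -
  have "(\<integral>\<^sup>+u. ennreal (exp (s * u)) \<partial>log_gamma_measure a) =
      (\<integral>\<^sup>+u. ennreal (exp (a * u - exp u) / Gamma a) * ennreal (exp (s * u)) \<partial>lborel)"
    unfolding log_gamma_measure_def by (rule nn_integral_density) auto
  also have "\<dots> = (\<integral>\<^sup>+u. ennreal (exp ((a + s) * u - exp u)) * ennreal (1 / Gamma a) \<partial>lborel)"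
  proof (rule nn_integral_cong)
    fix u
    have "exp (a * u - exp u) / Gamma a * exp (s * u) = exp ((a + s) * u - exp u) * (1 / Gamma a)"
      by (simp add: field_simps flip: exp_add)
    thus "ennreal (exp (a * u - exp u) / Gamma a) * ennreal (exp (s * u)) =
        ennreal (exp ((a + s) * u - exp u)) * ennreal (1 / Gamma a)"
      using assms(1) by (simp add: less_imp_le flip: ennreal_mult'')
  qed
  also have "\<dots> = ennreal (Gamma (a + s)) * ennreal (1 / Gamma a)"
    by (subst nn_integral_multc) (simp_all add: nn_integral_Gamma_log assms)
  also have "\<dots> = ennreal (Gamma (a + s) / Gamma a)"
    using assms by (simp add: less_imp_le flip: ennreal_mult'')
  finally show ?thesis .
qed

lemma real_distribution_log_gamma:
  assumes "a > 0"
  shows "real_distribution (log_gamma_measure a)"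
proof (intro real_distribution.intro real_distribution_axioms.intro prob_spaceI)
  have "emeasure (log_gamma_measure a) (space (log_gamma_measure a)) = (\<integral>\<^sup>+u. ennreal (exp (0 * u)) \<partial>log_gamma_measure a)"
    by simp
  also have "\<dots> = 1" using nn_integral_exp_log_gamma[of a 0] assms Gamma_real_pos[OF assms] by simp
  finally show "emeasure (log_gamma_measure a) (space (log_gamma_measure a)) = 1" .
qed simp

lemma char_log_gamma:
  assumes "a > 0"
  shows "char (log_gamma_measure a) t = Gamma (Complex a t) / of_real (Gamma a)"
proof -
  have G: "Gamma a > 0" using assms by (rule Gamma_real_pos)
  have "char (log_gamma_measure a) t = (CLBINT u. (exp (a * u - exp u) / Gamma a) *\<^sub>R iexp (t * u))"
    unfolding char_def log_gamma_measure_def using G by (subst integral_density) auto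
  also have "\<dots> = (CLBINT u. exp (Complex a t * of_real u - of_real (exp u)) / of_real (Gamma a))"
  proof (rule Bochner_Integration.integral_cong[OF refl])
    fix u
    have "exp (Complex a t * of_real u - of_real (exp u)) = of_real (exp (a * u - exp u)) * iexp (t * u)"
      by (simp add: Complex_eq algebra_simps flip: exp_of_real exp_add)
    thus "(exp (a * u - exp u) / Gamma a) *\<^sub>R iexp (t * u) = exp (Complex a t * of_real u - of_real (exp u)) / of_real (Gamma a)"
      by (simp add: scaleR_conv_of_real)
  qed
  also have "\<dots> = Gamma (Complex a t) / of_real (Gamma a)"
    using has_bochner_integral_Gamma_log[of "Complex a t"] assms
    by (simp add: has_bochner_integral_iff)
  finally show ?thesis .
qed

section \<open>Convolutions: sums of independent logarithms\<close>

lemma real_distribution_convolution: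
  assumes "real_distribution M" "real_distribution N"
  shows "real_distribution (M \<star> N)"
proof -
  interpret M: real_distribution M by fact
  interpret N: real_distribution N by fact
  interpret pair_prob_space M N ..
  show ?thesis
    unfolding convolution_def
    by (intro real_distribution.intro real_distribution_axioms.intro prob_space_distr) auto
qed

lemma char_convolution:
  assumes "real_distribution M" "real_distribution N"
  shows "char (M \<star> N) t = char M t * char N t"
proof -
  interpret M: real_distribution M by fact
  interpret N: real_distribution N by fact
  interpret pair_prob_space M N ..
  have "char (M \<star> N) t = (CLINT p|M \<Otimes>\<^sub>M N. iexp (t * fst p) * iexp (t * snd p))"
    unfolding char_def convolution_def
    by (subst integral_distr) (auto simp: case_prod_beta ring_distribs exp_add intro!: Bochner_Integration.integral_cong)
  also have "\<dots> = (CLINT x|M. CLINT y|N. iexp (t * x) * iexp (t * y))"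
    using integral_fst'[of "\<lambda>p. iexp (t * fst p) * iexp (t * snd p)"]
    by (simp add: integrable_const_bound[where B=1] norm_mult case_prod_beta)
  also have "\<dots> = char M t * char N t" by (simp add: char_def)
  finally show ?thesis .
qed

lemma nn_integral_exp_convolution:
  assumes "real_distribution M" "real_distribution N"
  shows "(\<integral>\<^sup>+u. ennreal (exp (s * u)) \<partial>(M \<star> N)) =
    (\<integral>\<^sup>+u. ennreal (exp (s * u)) \<partial>M) * (\<integral>\<^sup>+u. ennreal (exp (s * u)) \<partial>N)"
proof -
  interpret M: real_distribution M by fact
  interpret N: real_distribution N by fact
  have "(\<integral>\<^sup>+u. ennreal (exp (s * u)) \<partial>(M \<star> N)) = (\<integral>\<^sup>+x. \<integral>\<^sup>+y. ennreal (exp (s * x)) * ennreal (exp (s * y)) \<partial>N \<partial>M)"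
    by (subst nn_integral_convolution)
       (auto simp: M.finite_measure_axioms N.finite_measure_axioms ring_distribs exp_add ennreal_mult')
  also have "\<dots> = (\<integral>\<^sup>+x. ennreal (exp (s * x)) * (\<integral>\<^sup>+y. ennreal (exp (s * y)) \<partial>N) \<partial>M)"
    by (subst nn_integral_cmult) auto
  also have "\<dots> = (\<integral>\<^sup>+u. ennreal (exp (s * u)) \<partial>M) * (\<integral>\<^sup>+u. ennreal (exp (s * u)) \<partial>N)"
    by (subst nn_integral_multc) auto
  finally show ?thesis .
qed

text \<open>One factor with a density suffices to exclude atoms, even if the other is a point
  mass.\<close>

lemma measure_convolution_log_gamma_singleton:
  assumes "real_distribution N" "a > 0"
  shows "measure (N \<star> log_gamma_measure a) {x} = 0"
proof -
  interpret N: real_distribution N by fact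
  interpret L: real_distribution "log_gamma_measure a" using assms(2) by (rule real_distribution_log_gamma)
  have "emeasure (log_gamma_measure a) {b. b + c \<in> {x}} = 0" for c
  proof -
    have "{b. b + c \<in> {x}} = {x - c}" by auto
    moreover have "emeasure (log_gamma_measure a) {x - c} = 0"
      unfolding log_gamma_measure_def
      by (subst emeasure_density) (auto simp: nn_integral_0_iff_AE intro!: AE_mp[OF AE_lborel_singleton[of "x - c"]])
    ultimately show ?thesis by simp
  qed
  hence "emeasure (N \<star> log_gamma_measure a) {x} = 0"
    by (subst convolution_emeasure) (auto simp: N.finite_measure_axioms L.finite_measure_axioms)
  thus ?thesis by (simp add: measure_def)
qed

text \<open>The law of ln X, where X has the beta law with parameters 1 and \<open>b\<close>, that
  is, density b (1 - x)^(b - 1) on (0, 1); the factor \<open>exp u\<close> is the Jacobian.\<close>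

definition log_beta_measure :: "real \<Rightarrow> real measure" where
  "log_beta_measure b = density lborel (\<lambda>u. ennreal (if u < 0 then b * exp u * (1 - exp u) powr (b - 1) else 0))"

lemma sets_log_beta [simp, measurable_cong]: "sets (log_beta_measure b) = sets borel"
  by (simp add: log_beta_measure_def)

text \<open>Finiteness is what convolution asks for. That the total mass is one comes out of the
  convolution identity afterwards.\<close>

lemma finite_log_beta:
  assumes b: "b > 0"
  shows "finite_measure (log_beta_measure b)"
proof (rule finite_measureI)
  have "emeasure (log_beta_measure b) (space (log_beta_measure b)) =
      (\<integral>\<^sup>+u. ennreal (if u < 0 then b * exp u * (1 - exp u) powr (b - 1) else 0) \<partial>lborel)"
    by (simp add: log_beta_measure_def emeasure_density)
  also have "\<dots> = (\<integral>\<^sup>+u. ennreal (if exp u < 1 then b * (1 - exp u) powr (b - 1) else 0) * ennreal (exp u) \<partial>lborel)"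
    using b by (intro nn_integral_cong) (auto simp: mult_ac simp flip: ennreal_mult'')
  also have "\<dots> = (\<integral>\<^sup>+x. ennreal (if x < 1 then b * (1 - x) powr (b - 1) else 0) * indicator {0<..} x \<partial>lborel)"
    by (rule nn_integral_exp_substitution[symmetric]) measurable
  also have "\<dots> \<le> (\<integral>\<^sup>+x. ennreal b * ennreal (indicator {0..1} x * (x powr (1 - 1) * (1 - x) powr (b - 1))) \<partial>lborel)"
    using b by (intro nn_integral_mono) (auto simp: indicator_def simp flip: ennreal_mult'')
  also have "\<dots> = ennreal b * ennreal (Beta 1 b)"
    by (subst nn_integral_cmult) (use nn_integral_has_integral_lebesgue[OF _ has_integral_Beta_real[of 1 b]] b in auto)
  also have "\<dots> < \<infinity>" by (simp add: ennreal_mult_less_top)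
  finally show "emeasure (log_beta_measure b) (space (log_beta_measure b)) \<noteq> \<infinity>" by simp
qed

text \<open>The beta-gamma relation: for X beta (1, b) and Y gamma (1 + b) independent, X Y is gamma
  with shape 1. For fixed x the convolution integral becomes, with v = exp y and w = v - exp x,
  Euler's integral for \<Gamma>(b).\<close>

lemma convolution_log_beta_log_gamma:
  assumes b: "b > 0"
  shows "log_beta_measure b \<star> log_gamma_measure (1 + b) = log_gamma_measure 1"
proof -
  let ?n = "\<lambda>u. ennreal (if u < 0 then b * exp u * (1 - exp u) powr (b - 1) else 0)"
  let ?l = "\<lambda>u. ennreal (exp ((1 + b) * u - exp u) / Gamma (1 + b))"
  interpret L: real_distribution "log_gamma_measure (1 + b)"
    using b by (intro real_distribution_log_gamma) simp
  have "(\<integral>\<^sup>+y. ?n (x - y) * ?l y \<partial>lborel) = ennreal (exp (1 * x - exp x) / Gamma 1)" for x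
  proof -
    define g where "g v = ennreal (indicator {0<..} (v - exp x) * (v - exp x) powr (b - 1) / exp (v - exp x))
      * ennreal (exp (x - exp x) / Gamma b)" for v
    have [measurable]: "g \<in> borel_measurable borel" unfolding g_def by measurable
    have Gb: "Gamma b > 0" using b by (rule Gamma_real_pos)
    have "?n (x - y) * ?l y = g (exp y) * ennreal (exp y)" for y
    proof (cases "x < y")
      case True
      define d where "d = exp y - exp x"
      have d: "d > 0" using True by (simp add: d_def)
      \<comment> \<open>The shifted variable d of Euler's integral appears after taking out exp
        (-y); the powers of exp y then combine to the Jacobian.\<close>
      have "1 - exp (x - y) = d * exp (- y)" by (simp add: d_def field_simps exp_diff exp_minus)
      hence "(1 - exp (x - y)) powr (b - 1) = d powr (b - 1) * exp (- y * (b - 1))"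
        using d by (simp add: powr_mult powr_def[of "exp _"])
      hence "b * exp (x - y) * (1 - exp (x - y)) powr (b - 1) * (exp ((1 + b) * y - exp y) / Gamma (1 + b)) =
          d powr (b - 1) * (b / Gamma (1 + b)) * (exp (x - y) * exp (- y * (b - 1)) * exp ((1 + b) * y - exp y))"
        by simp
      also have "b / Gamma (1 + b) = 1 / Gamma b"
      proof -
        have "b \<notin> \<int>\<^sub>\<le>\<^sub>0" using b by (auto simp: nonpos_Ints_def)
        thus ?thesis using b Gb Gamma_plus1[of b] by (simp add: add.commute)
      qed
      also have "exp (x - y) * exp (- y * (b - 1)) * exp ((1 + b) * y - exp y) = exp (- d) * exp (x - exp x) * exp y"
        by (simp add: d_def flip: exp_add) (simp add: algebra_simps)
      finally have "b * exp (x - y) * (1 - exp (x - y)) powr (b - 1) * (exp ((1 + b) * y - exp y) / Gamma (1 + b)) =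
          (indicator {0<..} d * d powr (b - 1) / exp d) * (exp (x - exp x) / Gamma b) * exp y"
        using d by (simp add: exp_minus field_simps)
      moreover have "(indicator {0<..} d * d powr (b - 1) / exp d) \<ge> 0" by simp
      ultimately show ?thesis
        using True b Gb unfolding g_def d_def[symmetric]
        by (simp add: less_imp_le flip: ennreal_mult' ennreal_mult'')
    qed (auto simp: g_def)
    hence "(\<integral>\<^sup>+y. ?n (x - y) * ?l y \<partial>lborel) = (\<integral>\<^sup>+y. g (exp y) * ennreal (exp y) \<partial>lborel)" by simp
    also have "\<dots> = (\<integral>\<^sup>+v. g v * indicator {0<..} v \<partial>lborel)"
      by (rule nn_integral_exp_substitution[symmetric]) measurable
    also have "\<dots> = (\<integral>\<^sup>+v. g v \<partial>lborel)"
    proof (rule nn_integral_cong)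
      fix v :: real
      have "indicator {0<..} (v - exp x) = (0::real)" if "v \<le> 0"
        using that exp_gt_zero[of x] by (auto simp: indicator_def simp del: exp_gt_zero)
      thus "g v * indicator {0<..} v = g v" by (cases "v > 0") (auto simp: g_def)
    qed
    also have "\<dots> = (\<integral>\<^sup>+w. g (exp x + 1 * w) \<partial>lborel)"
      by (subst nn_integral_real_affine[of g 1 "exp x"]) simp_all
    also have "\<dots> = (\<integral>\<^sup>+w. ennreal (indicator {0..} w * w powr (b - 1) / exp w) * ennreal (exp (x - exp x) / Gamma b) \<partial>lborel)"
      by (intro nn_integral_cong) (auto simp: g_def indicator_def)
    also have "\<dots> = ennreal (Gamma b) * ennreal (exp (x - exp x) / Gamma b)"
      by (subst nn_integral_multc) (simp_all add: Gamma_conv_nn_integral_real[OF b, symmetric])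
    also have "\<dots> = ennreal (exp (1 * x - exp x) / Gamma 1)"
      using Gb by (simp add: less_imp_le flip: ennreal_mult'')
    finally show ?thesis .
  qed
  hence "density lborel (\<lambda>x. \<integral>\<^sup>+y. ?n (x - y) * ?l y \<partial>lborel) = log_gamma_measure 1"
    by (simp only: log_gamma_measure_def)
  moreover have "density lborel ?n \<star> density lborel ?l = density lborel (\<lambda>x. \<integral>\<^sup>+y. ?n (x - y) * ?l y \<partial>lborel)"
    using finite_log_beta[OF b] L.finite_measure_axioms
    by (intro convolution_density) (simp_all add: log_beta_measure_def log_gamma_measure_def)
  ultimately show ?thesis by (simp only: log_beta_measure_def log_gamma_measure_def[of "1 + b"])
qed

text \<open>
  The factor \<open>\<Gamma>(\<sigma> + s) / \<Gamma>(s)\<close> of the Mellin--Barnes integrand is, up to normalization, the Mellin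
  transform of a beta law; at \<open>\<sigma> = 0\<close> it is a point mass.
\<close>

lemma log_gamma_factor:
  assumes "\<sigma> \<le> 0"
  obtains N where "real_distribution N" "N \<star> log_gamma_measure (1 - \<sigma>) = log_gamma_measure 1"
proof (cases "\<sigma> = 0")
  case True
  interpret L: real_distribution "log_gamma_measure 1" by (rule real_distribution_log_gamma) simp
  have "real_distribution (return borel (0::real))"
    by (intro real_distribution.intro real_distribution_axioms.intro prob_space_return) simp_all
  moreover from this interpret R: real_distribution "return borel (0::real)" .
  have "return borel (0::real) \<star> log_gamma_measure 1 = log_gamma_measure 1"
  proof (rule measure_eqI)
    fix A assume "A \<in> sets (return borel (0::real) \<star> log_gamma_measure 1)"
    hence [measurable]: "A \<in> sets borel" by simp
    have m: "(\<lambda>x. emeasure (log_gamma_measure 1) {a. a + x \<in> A}) \<in> borel_measurable borel"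
    proof -
      have "(\<lambda>x. emeasure (log_gamma_measure 1) {a. a + x \<in> A}) = (\<lambda>x. \<integral>\<^sup>+a. indicator A (a + x) \<partial>log_gamma_measure 1)"
      proof
        fix x
        have [measurable]: "{a. a + x \<in> A} \<in> sets borel"
          using measurable_sets[of "\<lambda>a. a + x" borel borel A] by (simp add: vimage_def)
        have "emeasure (log_gamma_measure 1) {a. a + x \<in> A} = (\<integral>\<^sup>+a. indicator {a. a + x \<in> A} a \<partial>log_gamma_measure 1)"
          by simp
        also have "\<dots> = (\<integral>\<^sup>+a. indicator A (a + x) \<partial>log_gamma_measure 1)"
          by (intro nn_integral_cong) (auto simp: indicator_def)
        finally show "emeasure (log_gamma_measure 1) {a. a + x \<in> A} = (\<integral>\<^sup>+a. indicator A (a + x) \<partial>log_gamma_measure 1)" .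
      qed
      also have "\<dots> \<in> borel_measurable borel" by measurable
      finally show ?thesis .
    qed
    have "emeasure (return borel (0::real) \<star> log_gamma_measure 1) A =
        (\<integral>\<^sup>+x. emeasure (log_gamma_measure 1) {a. a + x \<in> A} \<partial>return borel 0)"
      by (rule convolution_emeasure) (simp_all add: R.finite_measure_axioms L.finite_measure_axioms)
    also have "\<dots> = emeasure (log_gamma_measure 1) A" by (subst nn_integral_return) (simp_all add: m)
    finally show "emeasure (return borel (0::real) \<star> log_gamma_measure 1) A = emeasure (log_gamma_measure 1) A" .
  qed simp
  ultimately show ?thesis using that True by simp
next
  case False
  hence b: "- \<sigma> > 0" using assms by simp
  let ?N = "log_beta_measure (- \<sigma>)" and ?L = "log_gamma_measure (1 - \<sigma>)"
  have conv: "?N \<star> ?L = log_gamma_measure 1" using convolution_log_beta_log_gamma[OF b] by simp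
  interpret L: real_distribution ?L using b by (intro real_distribution_log_gamma) simp
  interpret L1: real_distribution "log_gamma_measure 1" by (rule real_distribution_log_gamma) simp
  \<comment> \<open>The mass of a convolution is the product of the masses, so the beta factor has
    mass one.\<close>
  have "1 = (\<integral>\<^sup>+x. 1 \<partial>(?N \<star> ?L))" unfolding conv using L1.emeasure_space_1 by simp
  also have "\<dots> = (\<integral>\<^sup>+x. \<integral>\<^sup>+y. 1 \<partial>?L \<partial>?N)"
    by (rule nn_integral_convolution) (simp_all add: finite_log_beta[OF b] L.finite_measure_axioms)
  also have "\<dots> = emeasure ?N (space ?N)" using L.emeasure_space_1 by simp
  finally have "real_distribution ?N"
    by (intro real_distribution.intro real_distribution_axioms.intro prob_spaceI) simp_all
  with conv show ?thesis by (intro that)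
qed

text \<open>A characteristic function is bounded by one, hence |\<Gamma>(b + i t)| \<le>
  \<Gamma>(b). Using this at b = a + 2 and dividing by s (s + 1) yields quadratic decay, enough for
  integrability.\<close>

lemma norm_Gamma_le:
  assumes "a > 0"
  shows "norm (Gamma (Complex a t)) \<le> Gamma (a + 2) / min (a\<^sup>2) 1 * inverse (1 + t\<^sup>2)"
proof -
  let ?s = "Complex a t"
  have le: "norm (Gamma (Complex b t)) \<le> Gamma b" if "b > 0" for b
  proof -
    interpret L: real_distribution "log_gamma_measure b" using that by (rule real_distribution_log_gamma)
    show ?thesis
      using L.cmod_char_le_1[of t] Gamma_real_pos[OF that] char_log_gamma[OF that, of t]
      by (simp add: norm_divide)
  qed
  have s: "?s \<noteq> 0" "?s + 1 \<noteq> 0" "?s \<notin> \<int>\<^sub>\<le>\<^sub>0" "?s + 1 \<notin> \<int>\<^sub>\<le>\<^sub>0"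
    using assms by (auto simp: complex_eq_iff nonpos_Ints_def)
  have "Gamma (?s + 2) = (?s + 1) * (?s * Gamma ?s)"
    using Gamma_plus1[of "?s + 1"] Gamma_plus1[of ?s] s
    by (simp add: add.assoc)
  hence eq: "norm (Gamma ?s) * (norm ?s * norm (?s + 1)) = norm (Gamma (?s + 2))"
    by (simp add: norm_mult mult_ac)
  have "?s + 2 = Complex (a + 2) t" by (simp add: complex_eq_iff)
  hence le2: "norm (Gamma ?s) * (norm ?s * norm (?s + 1)) \<le> Gamma (a + 2)"
    using eq le[of "a + 2"] assms by simp
  have "min (a\<^sup>2) 1 * (1 + t\<^sup>2) \<le> norm ?s * norm (?s + 1)"
  proof -
    have "min (a\<^sup>2) 1 * (1 + t\<^sup>2) = min (a\<^sup>2) 1 + min (a\<^sup>2) 1 * t\<^sup>2" by (simp add: algebra_simps)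
    also have "\<dots> \<le> a\<^sup>2 + 1 * t\<^sup>2" by (intro add_mono mult_right_mono) auto
    also have "\<dots> = (norm ?s)\<^sup>2" by (simp add: cmod_power2)
    also have "\<dots> = norm ?s * norm ?s" by (simp add: power2_eq_square)
    also have "\<dots> \<le> norm ?s * norm (?s + 1)"
      using assms by (intro mult_left_mono) (auto simp: cmod_def intro!: real_sqrt_le_mono power_mono)
    finally show ?thesis .
  qed
  hence "norm (Gamma ?s) * (min (a\<^sup>2) 1 * (1 + t\<^sup>2)) \<le> Gamma (a + 2)"
    using le2 by (meson mult_left_mono norm_ge_zero order_trans)
  moreover have "min (a\<^sup>2) 1 * (1 + t\<^sup>2) > 0" using assms by (auto simp: add_pos_nonneg)
  ultimately have "norm (Gamma ?s) \<le> Gamma (a + 2) / (min (a\<^sup>2) 1 * (1 + t\<^sup>2))"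
    by (simp only: pos_le_divide_eq)
  thus ?thesis by (simp only: divide_inverse inverse_mult_distrib mult.assoc)
qed

lemma integrable_inverse_1_plus_square: "integrable lborel (\<lambda>t::real. inverse (1 + t\<^sup>2))"
  using Sinc_Integral.integrable_inverse_1_plus_square by (simp add: set_integrable_def)

section \<open>The Meijer function as a density\<close>

context
  fixes \<mu> \<sigma> :: real
  assumes \<mu>: "\<mu> > 3/2" and \<sigma>: "-1 < \<sigma>" "\<sigma> \<le> 0"
begin

abbreviation "meijer_re \<equiv> \<lambda>r. Re (meijer_G3013 0 (of_real (\<mu> - 1)) (of_real \<sigma>) (of_real \<sigma>) r)"

text \<open>P is the law of the sum of log-gamma variables with shapes 1 and \<mu> - \<sigma> and a
  third variable whose law N satisfies \<open>log_gamma_factor\<close>. The exponential in the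
  Meijer identity is |r^(-s)| for r = exp u on the line Re s = 1 - \<sigma>. The moments are those
  with exponent n + \<sigma> because integrating r^n against the Meijer function contributes n - (1
  - \<sigma>), and the Jacobian adds 1.\<close>

lemma meijer_law:
  obtains P where "real_distribution P"
    "P = density lborel (\<lambda>u. ennreal (char_inverse P u))"
    "char_inverse P \<in> borel_measurable borel" "\<And>u. char_inverse P u \<ge> 0"
    "\<And>u. meijer_re (exp u) = Gamma (\<mu> - \<sigma>) / Gamma (1 - \<sigma>) * exp (- ((1 - \<sigma>) * u)) * char_inverse P u"
    "\<And>n. (\<integral>\<^sup>+u. ennreal (exp ((real n + \<sigma>) * u)) \<partial>P) =
      ennreal (Gamma (\<mu> + n) * (Gamma (\<sigma> + 1 + n))\<^sup>2 * Gamma (1 - \<sigma>) / (Gamma (\<mu> - \<sigma>) * fact n))"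
proof -
  obtain N where N: "real_distribution N" "N \<star> log_gamma_measure (1 - \<sigma>) = log_gamma_measure 1"
    using log_gamma_factor[OF \<sigma>(2)] by blast
  have L1: "real_distribution (log_gamma_measure 1)" by (rule real_distribution_log_gamma) simp
  have L\<sigma>: "real_distribution (log_gamma_measure (1 - \<sigma>))" using \<sigma> by (intro real_distribution_log_gamma) simp
  have a: "\<mu> - \<sigma> > 0" using \<mu> \<sigma> by simp
  have L\<mu>: "real_distribution (log_gamma_measure (\<mu> - \<sigma>))" using a by (rule real_distribution_log_gamma)
  interpret N: real_distribution N by (rule N)
  interpret L1: real_distribution "log_gamma_measure 1" by (rule L1)
  have NL: "real_distribution (log_gamma_measure 1 \<star> N)" by (intro real_distribution_convolution L1 N)
  define P where "P = ((log_gamma_measure 1 \<star> N) \<star> log_gamma_measure (\<mu> - \<sigma>))"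
  interpret P: real_distribution P unfolding P_def by (intro real_distribution_convolution NL L\<mu>)
  interpret NL: real_distribution "log_gamma_measure 1 \<star> N" by (rule NL)
  have G0: "Gamma (\<mu> - \<sigma>) > 0" "Gamma (1 - \<sigma>) > 0" using a \<sigma> by (simp_all add: Gamma_real_pos)
  have char_P: "char P t = char (log_gamma_measure 1 \<star> N) t * (Gamma (Complex (\<mu> - \<sigma>) t) / of_real (Gamma (\<mu> - \<sigma>)))" for t
    unfolding P_def using a by (simp add: char_convolution NL L\<mu> char_log_gamma)
  \<comment> \<open>The decay comes from the factor with shape \<mu> - \<sigma> alone; the remaining
    characteristic function is bounded by one.\<close>
  have int: "integrable lborel (char P)"
  proof (rule Bochner_Integration.integrable_bound)
    let ?C = "Gamma (\<mu> - \<sigma> + 2) / min ((\<mu> - \<sigma>)\<^sup>2) 1 / Gamma (\<mu> - \<sigma>)"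
    show "integrable lborel (\<lambda>t::real. ?C * inverse (1 + t\<^sup>2))"
      by (intro integrable_mult_right integrable_inverse_1_plus_square)
    show "AE t in lborel. norm (char P t) \<le> norm (?C * inverse (1 + t\<^sup>2))"
    proof (rule AE_I2)
      fix t :: real
      have "norm (char P t) = norm (char (log_gamma_measure 1 \<star> N) t) * (norm (Gamma (Complex (\<mu> - \<sigma>) t)) / Gamma (\<mu> - \<sigma>))"
        unfolding char_P norm_mult norm_divide using G0 by simp
      also have "\<dots> \<le> 1 * ((Gamma (\<mu> - \<sigma> + 2) / min ((\<mu> - \<sigma>)\<^sup>2) 1 * inverse (1 + t\<^sup>2)) / Gamma (\<mu> - \<sigma>))"
        using G0 a by (intro mult_mono divide_right_mono norm_Gamma_le NL.cmod_char_le_1) auto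
      also have "\<dots> = ?C * inverse (1 + t\<^sup>2)" by simp
      also have "\<dots> \<le> norm (?C * inverse (1 + t\<^sup>2))" unfolding real_norm_def by (rule abs_ge_self)
      finally show "norm (char P t) \<le> norm (?C * inverse (1 + t\<^sup>2))" .
    qed
  qed simp
  have atoms: "measure P {x} = 0" for x
    unfolding P_def by (rule measure_convolution_log_gamma_singleton[OF NL a])
  \<comment> \<open>N is known only through its convolution identity, so its transform is obtained
    by division.\<close>
  have char_N: "char N t = Gamma (Complex 1 t) * of_real (Gamma (1 - \<sigma>)) / Gamma (Complex (1 - \<sigma>) t)" for t
  proof -
    have "char N t * char (log_gamma_measure (1 - \<sigma>)) t = char (log_gamma_measure 1) t"
      unfolding N(2)[symmetric] by (rule char_convolution[symmetric, OF N(1) L\<sigma>])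
    hence "char N t * (Gamma (Complex (1 - \<sigma>) t) / of_real (Gamma (1 - \<sigma>))) = Gamma (Complex 1 t)"
      using \<sigma> by (simp add: char_log_gamma)
    \<comment> \<open>\<open>Gamma\<close> takes the value 0 exactly at its poles, so nonvanishing
      amounts to 1 - \<sigma> + i t not being a nonpositive integer.\<close>
    moreover have "Gamma (Complex (1 - \<sigma>) t) \<noteq> 0"
    proof
      assume "Gamma (Complex (1 - \<sigma>) t) = 0"
      then obtain n where "Complex (1 - \<sigma>) t = of_int n" "n \<le> 0"
        by (auto simp: Gamma_eq_zero_iff elim!: nonpos_Ints_cases)
      hence "1 - \<sigma> = of_int n" "n \<le> 0" by (simp_all add: complex_eq_iff)
      thus False using \<sigma> by linarith
    qed
    ultimately show ?thesis using G0 by (simp add: field_simps)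
  qed
  have char_P': "char P t * of_real (Gamma (\<mu> - \<sigma>) / Gamma (1 - \<sigma>)) =
      Gamma (Complex (\<mu> - \<sigma>) t) * Gamma (Complex 1 t) * Gamma (Complex 1 t) / Gamma (Complex (1 - \<sigma>) t)" for t
    unfolding char_P using G0
    by (simp add: char_convolution L1 N char_log_gamma char_N)
  have meijer: "meijer_re (exp u) = Gamma (\<mu> - \<sigma>) / Gamma (1 - \<sigma>) * exp (- ((1 - \<sigma>) * u)) * char_inverse P u" for u
  proof -
    let ?k = "Gamma (\<mu> - \<sigma>) / Gamma (1 - \<sigma>) * exp (- ((1 - \<sigma>) * u))"
    \<comment> \<open>Since - \<sigma> \<ge> 0 > 1 - \<mu>, the maximum is - \<sigma>.\<close>
    have Max: "Max {- Re (of_real (\<mu> - 1)), - Re (of_real \<sigma>), - Re (of_real \<sigma>)} + 1 = 1 - \<sigma>"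
      using \<mu> \<sigma> by simp
    have "(let s = Complex (1 - \<sigma>) t in Gamma (of_real (\<mu> - 1) + s) * Gamma (of_real \<sigma> + s) * Gamma (of_real \<sigma> + s)
        / Gamma (0 + s) * of_real (exp u) powr (- s)) * \<i> = of_real ?k * \<i> * (iexp (- (t * u)) * char P t)" for t
    proof -
      have s: "of_real (\<mu> - 1) + Complex (1 - \<sigma>) t = Complex (\<mu> - \<sigma>) t"
        "of_real \<sigma> + Complex (1 - \<sigma>) t = Complex 1 t" by (simp_all add: complex_eq_iff)
      have "of_real (exp u) powr (- Complex (1 - \<sigma>) t) = exp (- Complex (1 - \<sigma>) t * of_real u)"
        by (simp add: powr_def Ln_of_real)
      also have "\<dots> = of_real (exp (- ((1 - \<sigma>) * u))) * iexp (- (t * u))"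
        by (simp add: Complex_eq algebra_simps flip: exp_of_real exp_add)
      finally have p: "of_real (exp u) powr (- Complex (1 - \<sigma>) t) = of_real (exp (- ((1 - \<sigma>) * u))) * iexp (- (t * u))" .
      show ?thesis
        unfolding Let_def s p add_0 char_P'[symmetric] by simp
    qed
    hence "meijer_G3013 0 (of_real (\<mu> - 1)) (of_real \<sigma>) (of_real \<sigma>) (exp u) =
        1 / (2 * of_real pi * \<i>) * (CLBINT t. of_real ?k * \<i> * (iexp (- (t * u)) * char P t))"
      unfolding meijer_G3013_def Max by (simp only: Let_def)
    also have "\<dots> = of_real (?k / (2 * pi)) * (CLBINT t. iexp (- (t * u)) * char P t)"
      by (subst integral_mult_right_zero) (simp add: mult_ac)
    finally have "meijer_re (exp u) = Re (of_real (?k / (2 * pi)) * (CLBINT t. iexp (- (t * u)) * char P t))" by simp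
    also have "\<dots> = ?k / (2 * pi) * Re (CLBINT t. iexp (- (t * u)) * char P t)" by (simp only: times_complex.sel Re_complex_of_real Im_complex_of_real mult_zero_left diff_zero)
    also have "\<dots> = ?k * char_inverse P u" by (simp add: char_inverse_def)
    finally show ?thesis .
  qed
  have moments: "(\<integral>\<^sup>+u. ennreal (exp ((real n + \<sigma>) * u)) \<partial>P) =
      ennreal (Gamma (\<mu> + n) * (Gamma (\<sigma> + 1 + n))\<^sup>2 * Gamma (1 - \<sigma>) / (Gamma (\<mu> - \<sigma>) * fact n))" for n :: nat
  proof -
    define m where "m = (\<integral>\<^sup>+u. ennreal (exp ((real n + \<sigma>) * u)) \<partial>N)"
    have Gn: "Gamma (1 + (real n + \<sigma>)) > 0" "Gamma (\<mu> + real n) > 0" using \<sigma> \<mu> by (simp_all add: Gamma_real_pos)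
    \<comment> \<open>The moment of N follows by division as well; the known factor is \<Gamma>(1 -
      \<sigma> + n + \<sigma>) = n!.\<close>
    have "m * ennreal (Gamma (1 - \<sigma> + (real n + \<sigma>)) / Gamma (1 - \<sigma>)) = ennreal (Gamma (1 + (real n + \<sigma>)))"
      using nn_integral_exp_convolution[OF N(1) L\<sigma>, of "real n + \<sigma>"] \<sigma>
      unfolding N(2) m_def by (simp add: nn_integral_exp_log_gamma)
    also have "Gamma (1 - \<sigma> + (real n + \<sigma>)) = fact n" by (simp add: Gamma_fact)
    finally have "m * ennreal (fact n / Gamma (1 - \<sigma>)) * ennreal (Gamma (1 - \<sigma>) / fact n) =
        ennreal (Gamma (1 + (real n + \<sigma>))) * ennreal (Gamma (1 - \<sigma>) / fact n)" by simp
    also have "m * ennreal (fact n / Gamma (1 - \<sigma>)) * ennreal (Gamma (1 - \<sigma>) / fact n) = m"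
      using G0 by (simp add: mult.assoc less_imp_le flip: ennreal_mult'')
    finally have m: "m = ennreal (Gamma (1 + (real n + \<sigma>)) * (Gamma (1 - \<sigma>) / fact n))"
      using Gn G0 by (simp add: less_imp_le flip: ennreal_mult'')
    have "(\<integral>\<^sup>+u. ennreal (exp ((real n + \<sigma>) * u)) \<partial>P) =
        ennreal (Gamma (1 + (real n + \<sigma>))) * m * ennreal (Gamma (\<mu> + real n) / Gamma (\<mu> - \<sigma>))"
      unfolding P_def using a \<sigma> \<mu>
      by (simp add: nn_integral_exp_convolution NL L\<mu> L1 N nn_integral_exp_log_gamma m_def)
    also have "\<dots> = ennreal (Gamma (1 + (real n + \<sigma>)) * (Gamma (1 + (real n + \<sigma>)) * (Gamma (1 - \<sigma>) / fact n))
        * (Gamma (\<mu> + real n) / Gamma (\<mu> - \<sigma>)))"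
      unfolding m using Gn G0 by (simp add: less_imp_le flip: ennreal_mult'')
    finally show ?thesis by (simp add: power2_eq_square mult_ac add_ac)
  qed
  show ?thesis
    by (rule that[OF P.real_distribution_axioms P.density_char_inverse[OF int atoms]
      P.char_inverse_measurable[OF int] P.char_inverse_nonneg[OF int atoms] meijer moments])
qed

lemma meijer_nonneg: "meijer_re r \<ge> 0" if "r \<ge> 0"
proof (cases "r = 0")
  \<comment> \<open>\<open>0 powr w\<close> is 0, so the integrand vanishes identically at r =
    0.\<close>
  case True thus ?thesis by (simp add: meijer_G3013_def)
next
  case False
  obtain P where P: "\<And>u. char_inverse P u \<ge> 0"
    "\<And>u. meijer_re (exp u) = Gamma (\<mu> - \<sigma>) / Gamma (1 - \<sigma>) * exp (- ((1 - \<sigma>) * u)) * char_inverse P u"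
    using meijer_law by metis
  have "meijer_re (exp (ln r)) \<ge> 0" unfolding P(2) using \<mu> \<sigma> P(1) by (simp add: Gamma_real_pos less_imp_le)
  thus ?thesis using False that by simp
qed

lemma meijer_at_0: "meijer_re 0 = 0"
  by (simp add: meijer_G3013_def)

text \<open>The indicator is there because \<open>meijer_law\<close> determines the function on the
  positive axis only.\<close>

lemma meijer_measurable: "(\<lambda>r. indicator {0<..} r * meijer_re r) \<in> borel_measurable borel"
proof -
  obtain P where P: "char_inverse P \<in> borel_measurable borel"
    "\<And>u. meijer_re (exp u) = Gamma (\<mu> - \<sigma>) / Gamma (1 - \<sigma>) * exp (- ((1 - \<sigma>) * u)) * char_inverse P u"
    using meijer_law by metis
  note [measurable] = P(1)
  have "(\<lambda>r. indicator {0<..} r * meijer_re r) = (\<lambda>r. indicator {0<..} r *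
      (Gamma (\<mu> - \<sigma>) / Gamma (1 - \<sigma>) * exp (- ((1 - \<sigma>) * ln r)) * char_inverse P (ln r)))"
  proof
    fix r :: real
    show "indicator {0<..} r * meijer_re r = indicator {0<..} r *
        (Gamma (\<mu> - \<sigma>) / Gamma (1 - \<sigma>) * exp (- ((1 - \<sigma>) * ln r)) * char_inverse P (ln r))"
      using P(2)[of "ln r"] by (cases "r > 0") simp_all
  qed
  thus ?thesis by simp
qed

lemma nn_integral_meijer:
  "(\<integral>\<^sup>+r. ennreal (r ^ n * meijer_re r) * indicator {0<..} r \<partial>lborel) =
    ennreal (Gamma (\<mu> + n) * (Gamma (\<sigma> + 1 + n))\<^sup>2 / fact n)"
proof -
  obtain P where P: "real_distribution P"
    "P = density lborel (\<lambda>u. ennreal (char_inverse P u))"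
    "char_inverse P \<in> borel_measurable borel" "\<And>u. char_inverse P u \<ge> 0"
    "\<And>u. meijer_re (exp u) = Gamma (\<mu> - \<sigma>) / Gamma (1 - \<sigma>) * exp (- ((1 - \<sigma>) * u)) * char_inverse P u"
    "\<And>n. (\<integral>\<^sup>+u. ennreal (exp ((real n + \<sigma>) * u)) \<partial>P) =
      ennreal (Gamma (\<mu> + n) * (Gamma (\<sigma> + 1 + n))\<^sup>2 * Gamma (1 - \<sigma>) / (Gamma (\<mu> - \<sigma>) * fact n))"
    by (rule meijer_law) (rule that)
  note [measurable] = P(3) meijer_measurable
  define K where "K = Gamma (\<mu> - \<sigma>) / Gamma (1 - \<sigma>)"
  have K: "K > 0" using \<mu> \<sigma> by (simp add: K_def Gamma_real_pos)
  have "(\<integral>\<^sup>+r. ennreal (r ^ n * meijer_re r) * indicator {0<..} r \<partial>lborel) =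
      (\<integral>\<^sup>+r. ennreal (r ^ n * (indicator {0<..} r * meijer_re r)) * indicator {0<..} r \<partial>lborel)"
    by (intro nn_integral_cong) (auto simp: indicator_def)
  also have "\<dots> = (\<integral>\<^sup>+u. ennreal (exp u ^ n * (indicator {0<..} (exp u) * meijer_re (exp u))) * ennreal (exp u) \<partial>lborel)"
    by (rule nn_integral_exp_substitution) measurable
  also have "\<dots> = (\<integral>\<^sup>+u. ennreal K * (ennreal (char_inverse P u) * ennreal (exp ((real n + \<sigma>) * u))) \<partial>lborel)"
  proof (rule nn_integral_cong)
    fix u
    have "exp u ^ n * (indicator {0<..} (exp u) * meijer_re (exp u)) * exp u =
        K * char_inverse P u * (exp (real n * u) * exp (- ((1 - \<sigma>) * u)) * exp u)"
      unfolding P(5) K_def by (simp add: exp_of_nat_mult)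
    also have "exp (real n * u) * exp (- ((1 - \<sigma>) * u)) * exp u = exp ((real n + \<sigma>) * u)"
      by (simp add: algebra_simps flip: exp_add)
    finally show "ennreal (exp u ^ n * (indicator {0<..} (exp u) * meijer_re (exp u))) * ennreal (exp u) =
        ennreal K * (ennreal (char_inverse P u) * ennreal (exp ((real n + \<sigma>) * u)))"
      using P(4)[of u] K by (simp add: mult.assoc less_imp_le flip: ennreal_mult'' del: indicator_simps)
  qed
  also have "\<dots> = ennreal K * (\<integral>\<^sup>+u. ennreal (char_inverse P u) * ennreal (exp ((real n + \<sigma>) * u)) \<partial>lborel)"
    by (rule nn_integral_cmult) measurable
  also have "(\<integral>\<^sup>+u. ennreal (char_inverse P u) * ennreal (exp ((real n + \<sigma>) * u)) \<partial>lborel) =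
      (\<integral>\<^sup>+u. ennreal (exp ((real n + \<sigma>) * u)) \<partial>density lborel (\<lambda>u. ennreal (char_inverse P u)))"
    by (rule nn_integral_density[symmetric]) measurable
  also have "\<dots> = (\<integral>\<^sup>+u. ennreal (exp ((real n + \<sigma>) * u)) \<partial>P)" by (simp only: P(2)[symmetric])
  also have "ennreal K * \<dots> = ennreal (Gamma (\<mu> + n) * (Gamma (\<sigma> + 1 + n))\<^sup>2 / fact n)"
  proof -
    have "Gamma (\<mu> - \<sigma>) > 0" "Gamma (1 - \<sigma>) > 0" "Gamma (\<mu> + n) > 0" using \<mu> \<sigma> by (simp_all add: Gamma_real_pos)
    thus ?thesis unfolding P(6) using K by (simp add: K_def less_imp_le flip: ennreal_mult')
  qed
  finally show ?thesis .
qed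

end

section \<open>Radial measures on the plane\<close>

text \<open>This gives access to one coordinate at a time, as the shears below require.\<close>

lemma lborel_complex_eq_distr:
  "(lborel :: complex measure) = distr (lborel \<Otimes>\<^sub>M lborel) borel (\<lambda>(x, y). Complex x y)"
proof (rule lborel_eqI)
  fix l u :: complex
  assume lu: "\<And>b. b \<in> Basis \<Longrightarrow> l \<bullet> b \<le> u \<bullet> b"
  have le: "Re l \<le> Re u" "Im l \<le> Im u"
    using lu[of 1] lu[of \<i>] by (simp_all add: Basis_complex_def)
  have [measurable]: "(\<lambda>(x, y). Complex x y) \<in> borel_measurable (lborel \<Otimes>\<^sub>M lborel)"
    unfolding case_prod_beta Complex_eq by measurable
  have "(\<lambda>(x, y). Complex x y) -` box l u = {Re l<..<Re u} \<times> {Im l<..<Im u}"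
    by (auto simp: in_box_complex_iff)
  hence "emeasure (distr (lborel \<Otimes>\<^sub>M lborel) borel (\<lambda>(x, y). Complex x y)) (box l u) =
      emeasure (lborel \<Otimes>\<^sub>M lborel) ({Re l<..<Re u} \<times> {Im l<..<Im u})"
    by (subst emeasure_distr) (simp_all add: space_pair_measure)
  also have "\<dots> = ennreal ((Re u - Re l) * (Im u - Im l))"
    using le by (subst lborel.emeasure_pair_measure_Times) (simp_all add: ennreal_mult')
  finally show "emeasure (distr (lborel \<Otimes>\<^sub>M lborel) borel (\<lambda>(x, y). Complex x y)) (box l u) =
      ennreal (\<Prod>b\<in>Basis. (u - l) \<bullet> b)"
    by (simp add: Basis_complex_def)
qed simp

lemma nn_integral_lborel_complex:
  assumes [measurable]: "f \<in> borel_measurable borel"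
  shows "(\<integral>\<^sup>+z. f z \<partial>lborel) = (\<integral>\<^sup>+x. \<integral>\<^sup>+y. f (Complex x y) \<partial>lborel \<partial>lborel)"
    and "(\<integral>\<^sup>+z. f z \<partial>lborel) = (\<integral>\<^sup>+y. \<integral>\<^sup>+x. f (Complex x y) \<partial>lborel \<partial>lborel)"
proof -
  have [measurable]: "(\<lambda>(x, y). Complex x y) \<in> borel_measurable (lborel \<Otimes>\<^sub>M lborel)"
    unfolding case_prod_beta Complex_eq by measurable
  have "(\<integral>\<^sup>+z. f z \<partial>lborel) = (\<integral>\<^sup>+p. f (case p of (x, y) \<Rightarrow> Complex x y) \<partial>(lborel \<Otimes>\<^sub>M lborel))"
    by (subst lborel_complex_eq_distr, subst nn_integral_distr) simp_all
  also have "\<dots> = (\<integral>\<^sup>+p. (case p of (x, y) \<Rightarrow> f (Complex x y)) \<partial>(lborel \<Otimes>\<^sub>M lborel))"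
    by (intro nn_integral_cong) (auto split: prod.split)
  finally have *: "(\<integral>\<^sup>+z. f z \<partial>lborel) = (\<integral>\<^sup>+p. (case p of (x, y) \<Rightarrow> f (Complex x y)) \<partial>(lborel \<Otimes>\<^sub>M lborel))" .
  have [measurable]: "(\<lambda>(x, y). f (Complex x y)) \<in> borel_measurable (lborel \<Otimes>\<^sub>M lborel)"
    using measurable_compose[of "\<lambda>(x, y). Complex x y" "lborel \<Otimes>\<^sub>M lborel" borel f borel]
    by (simp add: case_prod_beta)
  show "(\<integral>\<^sup>+z. f z \<partial>lborel) = (\<integral>\<^sup>+x. \<integral>\<^sup>+y. f (Complex x y) \<partial>lborel \<partial>lborel)"
    unfolding * by (subst lborel.nn_integral_fst[symmetric]) simp_all
  show "(\<integral>\<^sup>+z. f z \<partial>lborel) = (\<integral>\<^sup>+y. \<integral>\<^sup>+x. f (Complex x y) \<partial>lborel \<partial>lborel)"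
    unfolding * by (subst lborel_pair.nn_integral_snd[symmetric]) simp_all
qed

text \<open>A shear translates each horizontal or each vertical line within itself, so Tonelli and
  translation invariance are enough.\<close>

lemma nn_integral_lborel_shear:
  assumes [measurable]: "f \<in> borel_measurable borel"
  shows "(\<integral>\<^sup>+z. f (Complex (Re z + a * Im z) (Im z)) \<partial>lborel) = (\<integral>\<^sup>+z. f z \<partial>lborel)"
    and "(\<integral>\<^sup>+z. f (Complex (Re z) (Im z + a * Re z)) \<partial>lborel) = (\<integral>\<^sup>+z. f z \<partial>lborel)"
proof -
  have trans: "(\<integral>\<^sup>+x. g (x + t) \<partial>lborel) = (\<integral>\<^sup>+x. g x \<partial>lborel)" if "g \<in> borel_measurable borel" for g :: "real \<Rightarrow> ennreal" and t
    using nn_integral_real_affine[OF that, of 1 t] by (simp add: add.commute)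
  have [measurable]: "(\<lambda>x. f (Complex x y)) \<in> borel_measurable borel" "(\<lambda>y. f (Complex x y)) \<in> borel_measurable borel" for x y
    unfolding Complex_eq by measurable
  have "(\<integral>\<^sup>+z. f (Complex (Re z + a * Im z) (Im z)) \<partial>lborel) = (\<integral>\<^sup>+y. \<integral>\<^sup>+x. f (Complex (x + a * y) y) \<partial>lborel \<partial>lborel)"
    by (subst nn_integral_lborel_complex(2)) (simp_all add: Complex_eq)
  also have "\<dots> = (\<integral>\<^sup>+z. f z \<partial>lborel)"
    by (subst nn_integral_lborel_complex(2)) (simp_all add: trans[of "\<lambda>x. f (Complex x _)"])
  finally show "(\<integral>\<^sup>+z. f (Complex (Re z + a * Im z) (Im z)) \<partial>lborel) = (\<integral>\<^sup>+z. f z \<partial>lborel)" .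
  have "(\<integral>\<^sup>+z. f (Complex (Re z) (Im z + a * Re z)) \<partial>lborel) = (\<integral>\<^sup>+x. \<integral>\<^sup>+y. f (Complex x (y + a * x)) \<partial>lborel \<partial>lborel)"
    by (subst nn_integral_lborel_complex(1)) (simp_all add: Complex_eq)
  also have "\<dots> = (\<integral>\<^sup>+z. f z \<partial>lborel)"
    by (subst nn_integral_lborel_complex(1)) (simp_all add: trans[of "\<lambda>y. f (Complex _ y)"])
  finally show "(\<integral>\<^sup>+z. f (Complex (Re z) (Im z + a * Re z)) \<partial>lborel) = (\<integral>\<^sup>+z. f z \<partial>lborel)" .
qed

text \<open>A rotation by less than a half turn is a product of three shears.\<close>

lemma distr_lborel_rotation:
  assumes u: "cmod u = 1" "u \<noteq> -1"
  shows "distr lborel borel (\<lambda>z. u * z) = lborel"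
proof (rule measure_eqI)
  fix A assume "A \<in> sets (distr lborel borel (\<lambda>z. u * z))"
  hence [measurable]: "A \<in> sets borel" by simp
  define c s where "c = Re u" and "s = Im u"
  have cs: "c\<^sup>2 + s\<^sup>2 = 1" using u(1) by (simp add: c_def s_def cmod_def)
  have "c \<noteq> -1"
  proof
    assume "c = -1"
    hence "s = 0" using cs by simp
    thus False using u(2) \<open>c = -1\<close> by (simp add: c_def s_def complex_eq_iff)
  qed
  hence c: "1 + c \<noteq> 0" by (metis add_eq_0_iff)
  \<comment> \<open>For u = exp (i \<theta>) this is - tan (\<theta> / 2), the coefficient of the
    two horizontal shears around a vertical one with coefficient sin \<theta>. The denominator
    vanishes exactly at the half turn.\<close>
  define a where "a = - s / (1 + c)"
  have as: "a * s = c - 1" "a * (1 + c) = - s"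
    using c cs by (simp_all add: a_def field_simps power2_eq_square)
  define f where "f z = (indicator A z :: ennreal)" for z
  have [measurable]: "f \<in> borel_measurable borel" unfolding f_def by measurable
  have Tm: "(\<lambda>z. g (Complex (Re z + a * Im z) (Im z))) \<in> borel_measurable borel"
    "(\<lambda>z. g (Complex (Re z) (Im z + s * Re z))) \<in> borel_measurable borel"
    if [measurable]: "g \<in> borel_measurable borel" for g :: "complex \<Rightarrow> ennreal"
    unfolding Complex_eq by measurable
  have rot: "u * z = Complex (Re z + a * Im z + a * (Im z + s * (Re z + a * Im z))) (Im z + s * (Re z + a * Im z))" for z
  proof -
    have 1: "Im z + s * (Re z + a * Im z) = s * Re z + (1 + a * s) * Im z" by (simp add: algebra_simps)
    have 2: "Re z + a * Im z + a * (s * Re z + c * Im z) = (1 + a * s) * Re z + (a + a * c) * Im z"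
      by (simp add: algebra_simps)
    have 3: "1 + a * s = c" using as(1) by simp
    have 4: "a + a * c = - s" using as(2) by (simp add: algebra_simps)
    show ?thesis unfolding 1 3 2 4 by (simp add: complex_eq_iff c_def s_def)
  qed
  let ?g1 = "\<lambda>z. f (Complex (Re z + a * Im z) (Im z))"
  let ?g2 = "\<lambda>z. ?g1 (Complex (Re z) (Im z + s * Re z))"
  have m1: "?g1 \<in> borel_measurable borel" by (rule Tm) measurable
  have m2: "?g2 \<in> borel_measurable borel" using Tm(2)[OF m1] by simp
  have "emeasure (distr lborel borel (\<lambda>z. u * z)) A = (\<integral>\<^sup>+z. f z \<partial>distr lborel borel (\<lambda>z. u * z))"
    unfolding f_def by simp
  also have "\<dots> = (\<integral>\<^sup>+z. f (u * z) \<partial>lborel)" by (rule nn_integral_distr) simp_all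
  also have "\<dots> = (\<integral>\<^sup>+z. ?g2 (Complex (Re z + a * Im z) (Im z)) \<partial>lborel)" by (simp add: rot)
  also have "\<dots> = (\<integral>\<^sup>+z. ?g2 z \<partial>lborel)" using nn_integral_lborel_shear(1)[OF m2, of a] by simp
  also have "\<dots> = (\<integral>\<^sup>+z. ?g1 z \<partial>lborel)" using nn_integral_lborel_shear(2)[OF m1, of s] by simp
  also have "\<dots> = (\<integral>\<^sup>+z. f z \<partial>lborel)" by (rule nn_integral_lborel_shear(1)) simp
  also have "\<dots> = emeasure lborel A" unfolding f_def by simp
  finally show "emeasure (distr lborel borel (\<lambda>z. u * z)) A = emeasure lborel A" .
qed simp

text \<open>The disc of radius sqrt r has area \<pi> r, so the squared modulus has constant density
  \<pi>. This takes the place of polar coordinates for radial integrands.\<close>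

lemma distr_lborel_cmod_square:
  "distr (lborel :: complex measure) borel (\<lambda>z. (cmod z)\<^sup>2) = density lborel (\<lambda>r. ennreal pi * indicator {0<..} r)"
    (is "?M = ?N")
proof (rule measure_eqI_generator_eq)
  let ?E = "range (\<lambda>r::real. {..r})"
  show "Int_stable ?E" by (auto simp: Int_stable_def)
  show "?E \<subseteq> Pow UNIV" by simp
  show "sets ?M = sigma_sets UNIV ?E" "sets ?N = sigma_sets UNIV ?E"
    by (simp_all add: borel_eq_atMost)
  show "range (\<lambda>n. {..real n}) \<subseteq> ?E" by auto
  show "(\<Union>n. {..real n}) = UNIV" using real_arch_simple by auto
  have M: "emeasure ?M {..r} = (if r \<ge> 0 then ennreal (pi * r) else 0)" for r
  proof -
    have "emeasure ?M {..r} = emeasure lborel {z::complex. (cmod z)\<^sup>2 \<le> r}"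
      by (subst emeasure_distr) (simp_all add: vimage_def)
    also have "\<dots> = (if r \<ge> 0 then ennreal (pi * r) else 0)"
    proof (cases "r \<ge> 0")
      case True
      have "{z::complex. (cmod z)\<^sup>2 \<le> r} = cball 0 (sqrt r)"
        using True by (auto simp: real_le_rsqrt sqrt_le_D intro: real_le_rsqrt) (metis real_sqrt_pow2 power_mono norm_ge_zero)
      thus ?thesis using True by (simp add: emeasure_cball unit_ball_vol_2)
    next
      case False
      hence "{z::complex. (cmod z)\<^sup>2 \<le> r} = {}"
        using zero_le_power2 by (auto simp: not_le intro: less_le_trans)
      thus ?thesis using False by simp
    qed
    finally show ?thesis .
  qed
  show "emeasure ?M {..real n} \<noteq> \<infinity>" for n by (simp add: M)
  fix X assume "X \<in> ?E"
  then obtain r where X: "X = {..r}" by auto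
  have "emeasure ?N {..r} = (\<integral>\<^sup>+x. ennreal pi * indicator {0<..} x * indicator {..r} x \<partial>lborel)"
    by (rule emeasure_density) simp_all
  also have "\<dots> = (\<integral>\<^sup>+x. ennreal pi * indicator {0<..r} x \<partial>lborel)"
    by (intro nn_integral_cong) (auto simp: indicator_def)
  also have "\<dots> = ennreal pi * emeasure lborel {0<..r}" by (rule nn_integral_cmult_indicator) simp
  also have "\<dots> = (if r \<ge> 0 then ennreal (pi * r) else 0)" by (simp add: ennreal_mult')
  finally show "emeasure ?M X = emeasure ?N X" by (simp only: X M)
qed

lemma nn_integral_radial:
  assumes [measurable]: "f \<in> borel_measurable borel"
  shows "(\<integral>\<^sup>+z. f ((cmod z)\<^sup>2) \<partial>lborel) = ennreal pi * (\<integral>\<^sup>+r. f r * indicator {0<..} r \<partial>lborel)"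
proof -
  have "(\<integral>\<^sup>+z. f ((cmod z)\<^sup>2) \<partial>lborel) = (\<integral>\<^sup>+r. f r \<partial>distr (lborel :: complex measure) borel (\<lambda>z. (cmod z)\<^sup>2))"
    by (rule nn_integral_distr[symmetric]) simp_all
  also have "\<dots> = (\<integral>\<^sup>+r. ennreal pi * indicator {0<..} r * f r \<partial>lborel)"
    unfolding distr_lborel_cmod_square by (rule nn_integral_density) simp_all
  also have "\<dots> = (\<integral>\<^sup>+r. ennreal pi * (f r * indicator {0<..} r) \<partial>lborel)"
    by (intro nn_integral_cong) (simp add: mult_ac)
  also have "\<dots> = ennreal pi * (\<integral>\<^sup>+r. f r * indicator {0<..} r \<partial>lborel)"
    by (rule nn_integral_cmult) simp
  finally show ?thesis .
qed

text \<open>A rotation by u preserves the measure and multiplies the integrand by a unimodular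
  constant. If that constant is not 1, the integral equals a nontrivial multiple of itself.\<close>

lemma radial_density_orthogonal:
  fixes k :: "real \<Rightarrow> real"
  assumes [measurable]: "k \<in> borel_measurable borel" and k: "\<And>r. k r \<ge> 0" and nm: "n \<noteq> m"
  shows "(\<integral>z. z ^ n * cnj (z ^ m) \<partial>density lborel (\<lambda>z. ennreal (k ((cmod z)\<^sup>2)))) = 0"
proof -
  define d where "d = (if n < m then m - n else n - m)"
  have d: "d > 0" using nm by (simp add: d_def)
  \<comment> \<open>A quarter turn divided by d = |n - m|: then u^d = i, so the constant is i or -i,
    and the angle is small enough to avoid the excluded half turn.\<close>
  define u where "u = cis (pi / (2 * real d))"
  have "u ^ d = cis (real d * (pi / (2 * real d)))" unfolding u_def by (rule Complex.DeMoivre)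
  also have "real d * (pi / (2 * real d)) = pi / 2" using d by simp
  finally have u: "cmod u = 1" "u ^ d = \<i>" by (simp_all add: u_def)
  have uu: "u * cnj u = 1" using complex_norm_square[of u] u(1) by simp
  have "0 \<le> pi / (2 * real d)" "pi / (2 * real d) \<le> pi / 2"
    using d by (auto simp: field_simps)
  hence "cos (pi / (2 * real d)) \<ge> 0"
    using pi_gt_zero by (intro cos_ge_zero) linarith+
  hence "u \<noteq> -1" by (auto simp: u_def complex_eq_iff)
  have cu: "u ^ n * cnj (u ^ m) \<noteq> 1"
  proof (cases "n < m")
    case True
    hence "m = n + d" by (simp add: d_def)
    hence "u ^ n * cnj (u ^ m) = (u * cnj u) ^ n * cnj (u ^ d)" by (simp add: power_add power_mult_distrib)
    thus ?thesis by (simp add: uu u(2) complex_eq_iff)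
  next
    case False
    hence "n = m + d" using nm by (simp add: d_def)
    hence "u ^ n * cnj (u ^ m) = (u * cnj u) ^ m * u ^ d" by (simp add: power_add power_mult_distrib)
    thus ?thesis by (simp add: uu u(2) complex_eq_iff)
  qed
  have "cnj \<in> borel_measurable borel"
    by (intro borel_measurable_continuous_onI continuous_intros)
  note [measurable] = measurable_compose[OF _ this]
  define g where "g z = k ((cmod z)\<^sup>2) *\<^sub>R (z ^ n * cnj (z ^ m))" for z
  have [measurable]: "g \<in> borel_measurable borel" unfolding g_def by measurable
  have I: "(\<integral>z. z ^ n * cnj (z ^ m) \<partial>density lborel (\<lambda>z. ennreal (k ((cmod z)\<^sup>2)))) = (\<integral>z. g z \<partial>lborel)"
    unfolding g_def by (rule integral_density) (simp_all add: k)
  have "(\<integral>z. g z \<partial>lborel) = (\<integral>z. g z \<partial>distr lborel borel (\<lambda>z. u * z))"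
    by (simp only: distr_lborel_rotation[OF u(1) \<open>u \<noteq> -1\<close>])
  also have "\<dots> = (\<integral>z. g (u * z) \<partial>lborel)" by (rule integral_distr) simp_all
  also have "\<dots> = (\<integral>z. (u ^ n * cnj (u ^ m)) * g z \<partial>lborel)"
    by (simp add: g_def norm_mult u(1) power_mult_distrib mult_ac scaleR_conv_of_real)
  also have "\<dots> = (u ^ n * cnj (u ^ m)) * (\<integral>z. g z \<partial>lborel)" by (rule integral_mult_right_zero)
  finally show ?thesis unfolding I using cu by simp
qed

section \<open>The space of entire functions\<close>

text \<open>Its square is the n-th Taylor coefficient of the kernel in the variable z * cnj
  w.\<close>

definition entire_coeff :: "real \<Rightarrow> real \<Rightarrow> nat \<Rightarrow> real" where
  "entire_coeff \<mu> \<sigma> n = sqrt (fact n / pochhammer \<mu> n) / pochhammer (\<sigma> + 1) n"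

definition entire_basis :: "real \<Rightarrow> real \<Rightarrow> nat \<Rightarrow> complex \<Rightarrow> complex" where
  "entire_basis \<mu> \<sigma> n z = of_real (entire_coeff \<mu> \<sigma> n) * z ^ n"

lemma pochhammer_eq_Gamma_quotient:
  "a > 0 \<Longrightarrow> pochhammer a n = Gamma (a + real n) / Gamma (a::real)"
  by (rule pochhammer_Gamma) (auto simp: nonpos_Ints_def)

lemma holomorphic_on_power_series:
  fixes a :: "nat \<Rightarrow> complex"
  assumes "\<And>z. summable (\<lambda>n. a n * z ^ n)"
  shows "(\<lambda>z. \<Sum>n. a n * z ^ n) holomorphic_on UNIV"
  using termdiffs_strong_converges_everywhere[OF assms]
  by (auto simp: holomorphic_on_def field_differentiable_def)

context
  fixes \<mu> \<sigma> :: real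
  assumes \<mu>: "\<mu> > 3/2" and \<sigma>: "-1 < \<sigma>" "\<sigma> \<le> 0"
begin

lemma entire_coeff_pos: "entire_coeff \<mu> \<sigma> n > 0"
  using \<mu> \<sigma> by (simp add: entire_coeff_def pochhammer_pos)

lemma entire_coeff_square: "(entire_coeff \<mu> \<sigma> n)\<^sup>2 = fact n / (pochhammer \<mu> n * (pochhammer (\<sigma> + 1) n)\<^sup>2)"
  using \<mu> \<sigma> by (simp add: entire_coeff_def power_divide less_imp_le pochhammer_pos)

text \<open>The factors 2 and 1 / (2 \<pi>) combine to 1 / \<pi>. The indicator makes the radial
  density Borel on the whole line, and at z = 0 it changes nothing by
  \<open>meijer_at_0\<close>.\<close>

lemma nu_measure_eq:
  defines "k \<equiv> \<lambda>r. 1 / (Gamma \<mu> * (Gamma (\<sigma> + 1))\<^sup>2 * pi) *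
    (indicator {0<..} r * Re (meijer_G3013 0 (of_real (\<mu> - 1)) (of_real \<sigma>) (of_real \<sigma>) r))"
  shows "nu_measure \<mu> \<sigma> = density lborel (\<lambda>z. ennreal (k ((cmod z)\<^sup>2)))"
    and "k \<in> borel_measurable borel" and "\<And>r. k r \<ge> 0"
proof -
  have G: "Gamma \<mu> > 0" "Gamma (\<sigma> + 1) > 0" using \<mu> \<sigma> by (simp_all add: Gamma_real_pos)
  show "nu_measure \<mu> \<sigma> = density lborel (\<lambda>z. ennreal (k ((cmod z)\<^sup>2)))"
    unfolding nu_measure_def
  proof (rule arg_cong[where f = "density lborel"], rule ext)
    fix z :: complex
    have "2 / (Gamma \<mu> * (Gamma (\<sigma> + 1))\<^sup>2)
      * Re (meijer_G3013 0 (of_real (\<mu> - 1)) (of_real \<sigma>) (of_real \<sigma>) ((cmod z)\<^sup>2)) * (1 / (2 * pi)) = k ((cmod z)\<^sup>2)"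
      using meijer_at_0[OF \<mu> \<sigma>] by (cases "z = 0") (simp_all add: k_def)
    thus "ennreal (2 / (Gamma \<mu> * (Gamma (\<sigma> + 1))\<^sup>2)
      * Re (meijer_G3013 0 (of_real (\<mu> - 1)) (of_real \<sigma>) (of_real \<sigma>) ((cmod z)\<^sup>2)) * (1 / (2 * pi))) = ennreal (k ((cmod z)\<^sup>2))"
      by (simp only:)
  qed
  show "k \<in> borel_measurable borel"
    unfolding k_def by (intro borel_measurable_times borel_measurable_const meijer_measurable \<mu> \<sigma>)
  show "k r \<ge> 0" for r
    unfolding k_def using meijer_nonneg[OF \<mu> \<sigma>, of r] G by (auto simp: indicator_def)
qed

lemma sets_nu [simp, measurable_cong]: "sets (nu_measure \<mu> \<sigma>) = sets borel"
  by (simp add: nu_measure_def)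

text \<open>These moments are the reciprocals of the squared coefficients, which is why the kernel
  fits the measure. The \<pi> of the area cancels the one in the density.\<close>

lemma nn_integral_nu_power:
  "(\<integral>\<^sup>+z. ennreal ((cmod z) ^ (2 * n)) \<partial>nu_measure \<mu> \<sigma>) =
    ennreal (pochhammer \<mu> n * (pochhammer (\<sigma> + 1) n)\<^sup>2 / fact n)"
proof -
  let ?G = "\<lambda>r. Re (meijer_G3013 0 (of_real (\<mu> - 1)) (of_real \<sigma>) (of_real \<sigma>) r)"
  have G: "Gamma \<mu> > 0" "Gamma (\<sigma> + 1) > 0" "Gamma (\<mu> + n) > 0" using \<mu> \<sigma> by (simp_all add: Gamma_real_pos)
  define C where "C = 1 / (Gamma \<mu> * (Gamma (\<sigma> + 1))\<^sup>2 * pi)"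
  have C: "C > 0" using G by (simp add: C_def)
  define k where "k r = C * (indicator {0<..} r * ?G r)" for r
  have k: "k \<in> borel_measurable borel" "\<And>r. k r \<ge> 0" and nu: "nu_measure \<mu> \<sigma> = density lborel (\<lambda>z. ennreal (k ((cmod z)\<^sup>2)))"
    using nu_measure_eq unfolding k_def[abs_def] C_def by auto
  note [measurable] = k(1) meijer_measurable[OF \<mu> \<sigma>]
  have "(\<integral>\<^sup>+z. ennreal ((cmod z) ^ (2 * n)) \<partial>nu_measure \<mu> \<sigma>) =
      (\<integral>\<^sup>+z. ennreal (k ((cmod z)\<^sup>2)) * ennreal (((cmod z)\<^sup>2) ^ n) \<partial>lborel)"
    unfolding nu by (subst nn_integral_density) (simp_all add: power_mult)
  also have "\<dots> = ennreal pi * (\<integral>\<^sup>+r. ennreal (k r) * ennreal (r ^ n) * indicator {0<..} r \<partial>lborel)"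
    by (rule nn_integral_radial) measurable
  also have "(\<integral>\<^sup>+r. ennreal (k r) * ennreal (r ^ n) * indicator {0<..} r \<partial>lborel) =
      (\<integral>\<^sup>+r. ennreal C * (ennreal (r ^ n * (indicator {0<..} r * ?G r)) * indicator {0<..} r) \<partial>lborel)"
  proof (rule nn_integral_cong)
    fix r :: real
    show "ennreal (k r) * ennreal (r ^ n) * indicator {0<..} r =
        ennreal C * (ennreal (r ^ n * (indicator {0<..} r * ?G r)) * indicator {0<..} r)"
    proof (cases "r > 0")
      case True
      hence "?G r \<ge> 0" by (intro meijer_nonneg[OF \<mu> \<sigma>]) simp
      thus ?thesis using True C by (simp add: k_def less_imp_le mult_ac flip: ennreal_mult'')
    qed simp
  qed
  also have "\<dots> = ennreal C * (\<integral>\<^sup>+r. ennreal (r ^ n * (indicator {0<..} r * ?G r)) * indicator {0<..} r \<partial>lborel)"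
    by (rule nn_integral_cmult) measurable
  also have "(\<integral>\<^sup>+r. ennreal (r ^ n * (indicator {0<..} r * ?G r)) * indicator {0<..} r \<partial>lborel) =
      (\<integral>\<^sup>+r. ennreal (r ^ n * ?G r) * indicator {0<..} r \<partial>lborel)"
    by (intro nn_integral_cong) (auto simp: indicator_def)
  also have "\<dots> = ennreal (Gamma (\<mu> + n) * (Gamma (\<sigma> + 1 + n))\<^sup>2 / fact n)"
    by (rule nn_integral_meijer[OF \<mu> \<sigma>])
  also have "ennreal pi * (ennreal C * \<dots>) = ennreal (pi * (C * (Gamma (\<mu> + n) * (Gamma (\<sigma> + 1 + n))\<^sup>2 / fact n)))"
    using C by (simp add: less_imp_le flip: ennreal_mult')
  also have "pi * (C * (Gamma (\<mu> + n) * (Gamma (\<sigma> + 1 + n))\<^sup>2 / fact n)) = pochhammer \<mu> n * (pochhammer (\<sigma> + 1) n)\<^sup>2 / fact n"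
    using \<mu> \<sigma> by (simp add: pochhammer_eq_Gamma_quotient C_def power_divide)
  finally show ?thesis .
qed

lemma l2_features_entire_basis: "l2_features (nu_measure \<mu> \<sigma>) (entire_basis \<mu> \<sigma>)"
proof
  let ?\<nu> = "nu_measure \<mu> \<sigma>" and ?c = "entire_coeff \<mu> \<sigma>" and ?e = "entire_basis \<mu> \<sigma>"
  have poch: "pochhammer \<mu> n > 0" "pochhammer (\<sigma> + 1) n > 0" for n using \<mu> \<sigma> by (simp_all add: pochhammer_pos)
  have norm_e: "(cmod (?e n z))\<^sup>2 = (?c n)\<^sup>2 * (cmod z) ^ (2 * n)" for n z
    by (simp add: entire_basis_def norm_mult norm_power power_mult_distrib power_mult mult.commute)
  have em [measurable]: "?e n \<in> borel_measurable borel" for n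
    unfolding entire_basis_def by measurable
  have i: "has_bochner_integral ?\<nu> (\<lambda>z. (cmod (?e n z))\<^sup>2) 1" for n
  proof (rule has_bochner_integral_nn_integral)
    have "(\<integral>\<^sup>+z. ennreal ((cmod (?e n z))\<^sup>2) \<partial>?\<nu>) = (\<integral>\<^sup>+z. ennreal ((?c n)\<^sup>2) * ennreal ((cmod z) ^ (2 * n)) \<partial>?\<nu>)"
      unfolding norm_e by (simp add: ennreal_mult')
    also have "\<dots> = ennreal ((?c n)\<^sup>2) * ennreal (pochhammer \<mu> n * (pochhammer (\<sigma> + 1) n)\<^sup>2 / fact n)"
      by (subst nn_integral_cmult) (simp_all add: nn_integral_nu_power)
    also have "\<dots> = ennreal 1"
      unfolding entire_coeff_square using poch[of n] by (simp add: less_imp_le flip: ennreal_mult'')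
    finally show "(\<integral>\<^sup>+z. ennreal ((cmod (?e n z))\<^sup>2) \<partial>?\<nu>) = ennreal 1" .
  qed simp_all
  have L2: "?e n \<in> L2 ?\<nu>" for n
    using i[of n] by (simp add: L2_def has_bochner_integral_iff)
  have orth: "l2_inner ?\<nu> (?e m) (?e n) = 0" if "m \<noteq> n" for m n
  proof -
    have "l2_inner ?\<nu> (?e m) (?e n) = (\<integral>z. of_real (?c m * ?c n) * (z ^ m * cnj (z ^ n)) \<partial>?\<nu>)"
      by (simp add: l2_inner_def entire_basis_def mult_ac)
    also have "\<dots> = of_real (?c m * ?c n) * (\<integral>z. z ^ m * cnj (z ^ n) \<partial>?\<nu>)" by (rule integral_mult_right_zero)
    also have "(\<integral>z. z ^ m * cnj (z ^ n) \<partial>?\<nu>) = 0"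
      unfolding nu_measure_eq(1) by (rule radial_density_orthogonal[OF nu_measure_eq(2,3) that])
    finally show ?thesis by simp
  qed
  have "l2_inner ?\<nu> (?e n) (?e n) = 1" for n
    using i[of n] by (simp add: l2_inner_self l2_sqnorm_def has_bochner_integral_iff)
  thus "l2_orthonormal ?\<nu> ?e" unfolding l2_orthonormal_def using L2 orth by auto
  fix z :: complex
  define x where "x = (cmod z)\<^sup>2"
  have x: "x \<ge> 0" by (simp add: x_def)
  \<comment> \<open>The ratio of consecutive terms is (n + 1) / (\<mu> + n) times x / (\<sigma> + 1
    + n)^2. The first factor is at most 1; the second is at most 1/2 once n \<ge> 2 x + 1, because
    then 2 x \<le> n \<le> n^2.\<close>
  obtain N :: nat where N: "2 * x + 1 \<le> real N" using real_arch_simple by blast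
  have norm_sq: "norm ((cmod (?e n z))\<^sup>2) = (?c n)\<^sup>2 * x ^ n" for n
    unfolding real_norm_def by (subst abs_of_nonneg) (simp_all add: norm_e power_mult x_def)
  show "summable (\<lambda>n. (cmod (?e n z))\<^sup>2)"
  proof (rule summable_ratio_test)
    fix n assume n: "n \<ge> N"
    have step: "(?c (Suc n))\<^sup>2 = (?c n)\<^sup>2 * (real (Suc n) / (\<mu> + real n) / (\<sigma> + 1 + real n)\<^sup>2)"
      by (simp add: entire_coeff_square pochhammer_Suc power_mult_distrib mult_ac)
    have nN: "real n \<ge> 2 * x + 1" using N n by linarith
    have "real (Suc n) / (\<mu> + real n) \<le> 1" using \<mu> by simp
    moreover have "x / (\<sigma> + 1 + real n)\<^sup>2 \<le> 1 / 2"
    proof -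
      have "2 * x \<le> real n * 1" using nN by simp
      also have "\<dots> \<le> real n * real n" using nN x by (intro mult_left_mono) auto
      also have "\<dots> \<le> (\<sigma> + 1 + real n)\<^sup>2" using \<sigma> unfolding power2_eq_square by (intro mult_mono) auto
      finally have "2 * x \<le> (\<sigma> + 1 + real n)\<^sup>2" .
      moreover have "(\<sigma> + 1 + real n)\<^sup>2 > 0" using \<sigma> by simp
      ultimately show ?thesis by (simp add: divide_le_eq)
    qed
    ultimately have "real (Suc n) / (\<mu> + real n) * (x / (\<sigma> + 1 + real n)\<^sup>2) \<le> 1 * (1 / 2)"
      using x \<mu> by (intro mult_mono) auto
    hence "(?c n)\<^sup>2 * x ^ n * (real (Suc n) / (\<mu> + real n) * (x / (\<sigma> + 1 + real n)\<^sup>2)) \<le> (?c n)\<^sup>2 * x ^ n * (1 * (1 / 2))"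
      using x by (intro mult_left_mono) auto
    thus "norm ((cmod (?e (Suc n) z))\<^sup>2) \<le> 1 / 2 * norm ((cmod (?e n z))\<^sup>2)"
      unfolding norm_sq step by (simp add: mult_ac)
  qed simp
qed

text \<open>The two upper parameters 1 give (n!)^2, and the division by n! in the hypergeometric
  series leaves the single n! of the squared coefficient.\<close>

lemma entire_kernel_eq: "entire_kernel \<mu> \<sigma> = l2_features.kernel (entire_basis \<mu> \<sigma>)"
proof (intro ext)
  fix z w
  interpret l2_features "nu_measure \<mu> \<sigma>" "entire_basis \<mu> \<sigma>" by (rule l2_features_entire_basis)
  have "(\<Prod>a\<leftarrow>[1, 1]. pochhammer a n) / (\<Prod>b\<leftarrow>[of_real \<mu>, of_real (\<sigma> + 1), of_real (\<sigma> + 1)]. pochhammer b n)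
      * (z * cnj w) ^ n / fact n = cnj (entire_basis \<mu> \<sigma> n w) * entire_basis \<mu> \<sigma> n z" for n
  proof -
    have "cnj (entire_basis \<mu> \<sigma> n w) * entire_basis \<mu> \<sigma> n z = of_real ((entire_coeff \<mu> \<sigma> n)\<^sup>2) * (z * cnj w) ^ n"
      by (simp add: entire_basis_def power2_eq_square power_mult_distrib mult_ac)
    also have "of_real ((entire_coeff \<mu> \<sigma> n)\<^sup>2) =
        (fact n / (pochhammer (of_real \<mu>) n * (pochhammer (of_real (\<sigma> + 1)) n)\<^sup>2) :: complex)"
      unfolding entire_coeff_square by (simp add: pochhammer_of_real[symmetric])
    finally show ?thesis
      by (simp add: power2_eq_square pochhammer_fact[symmetric])
  qed
  thus "entire_kernel \<mu> \<sigma> z w = kernel z w"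
    unfolding entire_kernel_def hypergeometric_def kernel_def by (simp only:)
qed

text \<open>Existence is the series space itself; uniqueness rests on the strictly positive
  coefficients, which allow each monomial to be isolated.\<close>

lemma entire_space_eq: "entire_space \<mu> \<sigma> = l2_series_space (entire_basis \<mu> \<sigma>)"
  unfolding entire_space_def
proof (rule the_equality)
  interpret l2_features "nu_measure \<mu> \<sigma>" "entire_basis \<mu> \<sigma>" by (rule l2_features_entire_basis)
  show "(\<forall>f\<in>l2_series_space (entire_basis \<mu> \<sigma>). f holomorphic_on UNIV) \<and>
      l2_series_space (entire_basis \<mu> \<sigma>) \<subseteq> L2 (nu_measure \<mu> \<sigma>) \<and>
      reproducing_kernel_hilbert_space (l2_series_space (entire_basis \<mu> \<sigma>)) (l2_inner (nu_measure \<mu> \<sigma>)) (entire_kernel \<mu> \<sigma>)"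
  proof (intro conjI ballI)
    fix f assume "f \<in> l2_series_space (entire_basis \<mu> \<sigma>)"
    then obtain a where a: "summable (\<lambda>n. (cmod (a n))\<^sup>2)" "f = (\<lambda>z. \<Sum>n. a n * entire_basis \<mu> \<sigma> n z)"
      unfolding l2_series_space_def by blast
    have eq: "a n * entire_basis \<mu> \<sigma> n z = a n * of_real (entire_coeff \<mu> \<sigma> n) * z ^ n" for n z
      by (simp add: entire_basis_def)
    show "f holomorphic_on UNIV"
      unfolding a(2) eq
      by (rule holomorphic_on_power_series) (use sums_summable[OF sums_series[OF a(1)]] in \<open>simp only: eq\<close>)
  next
    show "l2_series_space (entire_basis \<mu> \<sigma>) \<subseteq> L2 (nu_measure \<mu> \<sigma>)" by (rule series_space_L2)
    show "reproducing_kernel_hilbert_space (l2_series_space (entire_basis \<mu> \<sigma>)) (l2_inner (nu_measure \<mu> \<sigma>)) (entire_kernel \<mu> \<sigma>)"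
      unfolding entire_kernel_eq by (rule reproducing_kernel_hilbert_space_series)
  qed
  fix H assume H: "(\<forall>f\<in>H. f holomorphic_on UNIV) \<and> H \<subseteq> L2 (nu_measure \<mu> \<sigma>) \<and>
      reproducing_kernel_hilbert_space H (l2_inner (nu_measure \<mu> \<sigma>)) (entire_kernel \<mu> \<sigma>)"
  show "H = l2_series_space (entire_basis \<mu> \<sigma>)"
  proof (rule rkhs_of_monomials_unique)
    show "l2_features (nu_measure \<mu> \<sigma>) (entire_basis \<mu> \<sigma>)" by (rule l2_features_entire_basis)
    show "reproducing_kernel_hilbert_space H (l2_inner (nu_measure \<mu> \<sigma>)) kernel"
      using H by (simp only: entire_kernel_eq)
  qed (use H entire_coeff_pos in \<open>auto simp: entire_basis_def\<close>)
qed

end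

section \<open>Laguerre functions\<close>

text \<open>Pascal's rule rewrites the alternating sum of order n + 1 as one of order n over the
  differences f(s) - f(s + 1), and differencing a rising factorial lowers its degree by one.\<close>

lemma alternating_binomial_pochhammer_Suc:
  fixes a :: real
  shows "(\<Sum>s\<le>Suc n. (-1) ^ s * real (Suc n choose s) * pochhammer (a + real s) k) =
    - real k * (\<Sum>s\<le>n. (-1) ^ s * real (n choose s) * pochhammer (a + 1 + real s) (k - 1))"
proof -
  define f where "f s = pochhammer (a + real s) k" for s
  \<comment> \<open>For k = 0 the truncated k - 1 is harmless because of the factor k.\<close>
  have diff: "f s - f (Suc s) = - real k * pochhammer (a + 1 + real s) (k - 1)" for s
  proof (cases k)
    case (Suc j)
    have "f s = (a + real s) * pochhammer (a + 1 + real s) j"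
      unfolding f_def Suc pochhammer_rec by (simp add: add_ac)
    moreover have "f (Suc s) = (a + 1 + real s + real j) * pochhammer (a + 1 + real s) j"
      unfolding f_def Suc pochhammer_Suc by (simp add: add_ac)
    ultimately show ?thesis by (simp add: Suc algebra_simps)
  qed (simp add: f_def)
  have "(\<Sum>s\<le>Suc n. (-1) ^ s * real (Suc n choose s) * f s) =
      f 0 + (\<Sum>s\<le>n. (-1) ^ Suc s * real (Suc n choose Suc s) * f (Suc s))"
    by (simp only: sum.atMost_Suc_shift power_0 binomial_n_0 of_nat_1 mult_1)
  also have "(\<Sum>s\<le>n. (-1) ^ Suc s * real (Suc n choose Suc s) * f (Suc s)) =
      (\<Sum>s\<le>n. (-1) ^ Suc s * real (n choose Suc s) * f (Suc s) - (-1) ^ s * real (n choose s) * f (Suc s))"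
  proof (intro sum.cong refl)
    fix s
    have "real (Suc n choose Suc s) = real (n choose s) + real (n choose Suc s)" by simp
    thus "(-1) ^ Suc s * real (Suc n choose Suc s) * f (Suc s) =
        (-1) ^ Suc s * real (n choose Suc s) * f (Suc s) - (-1) ^ s * real (n choose s) * f (Suc s)"
      by (simp only: power_Suc ring_distribs)
  qed
  also have "f 0 + \<dots> = (f 0 + (\<Sum>s\<le>n. (-1) ^ Suc s * real (n choose Suc s) * f (Suc s)))
      - (\<Sum>s\<le>n. (-1) ^ s * real (n choose s) * f (Suc s))"
    by (simp only: sum_subtractf add_diff_eq)
  also have "f 0 + (\<Sum>s\<le>n. (-1) ^ Suc s * real (n choose Suc s) * f (Suc s)) =
      (\<Sum>s\<le>Suc n. (-1) ^ s * real (n choose s) * f s)"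
    by (simp only: sum.atMost_Suc_shift power_0 binomial_n_0 of_nat_1 mult_1)
  also have "\<dots> = (\<Sum>s\<le>n. (-1) ^ s * real (n choose s) * f s)" by simp
  also have "\<dots> - (\<Sum>s\<le>n. (-1) ^ s * real (n choose s) * f (Suc s)) =
      (\<Sum>s\<le>n. (-1) ^ s * real (n choose s) * (f s - f (Suc s)))"
    by (simp only: sum_subtractf right_diff_distrib)
  also have "\<dots> = - real k * (\<Sum>s\<le>n. (-1) ^ s * real (n choose s) * pochhammer (a + 1 + real s) (k - 1))"
    unfolding diff sum_distrib_left by (intro sum.cong) auto
  finally show ?thesis by (simp only: f_def)
qed

text \<open>An n-th finite difference of a monic polynomial in s of degree k: it annihilates degrees
  below n and gives n! up to sign at degree n.\<close>

lemma alternating_binomial_pochhammer: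
  fixes a :: real
  shows "k \<le> n \<Longrightarrow> (\<Sum>s\<le>n. (-1) ^ s * real (n choose s) * pochhammer (a + real s) k) =
    (if k = n then (-1) ^ n * fact n else 0)"
proof (induction n arbitrary: a k)
  case (Suc n)
  show ?case
  proof (cases k)
    case 0
    thus ?thesis by (simp only: alternating_binomial_pochhammer_Suc) simp
  next
    case (Suc j)
    hence "j \<le> n" using Suc.prems by simp
    thus ?thesis
      unfolding alternating_binomial_pochhammer_Suc Suc diff_Suc_1 Suc.IH[OF \<open>j \<le> n\<close>]
      by (simp add: algebra_simps)
  qed
qed simp

text \<open>The Laguerre polynomial with parameter \<mu> - 1, rescaled to the value 1 at x =
  0.\<close>

definition laguerre_poly :: "real \<Rightarrow> nat \<Rightarrow> real \<Rightarrow> real" where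
  "laguerre_poly \<mu> n x = (\<Sum>s\<le>n. real (n choose s) * (- x) ^ s / pochhammer \<mu> s)"

section \<open>Gaussian moments on the half-line\<close>

lemma nn_integral_half_line:
  assumes [measurable]: "f \<in> borel_measurable borel"
  shows "(\<integral>\<^sup>+x. f x \<partial>half_line) = (\<integral>\<^sup>+x. f x * indicator {0<..} x \<partial>lborel)"
  by (subst nn_integral_restrict_space) (simp_all add: nn_integral_completion)

lemma borel_measurable_half_line:
  fixes f :: "real \<Rightarrow> 'b::topological_space"
  assumes "f \<in> borel_measurable borel"
  shows "f \<in> borel_measurable half_line"
  using assms by (intro measurable_restrict_space1 measurable_completion) simp

lemma nn_integral_gaussian_moment:
  assumes \<mu>: "\<mu> > 0" and \<beta>: "\<beta> > 0"
  shows "(\<integral>\<^sup>+\<xi>. ennreal (\<xi> powr (2 * \<mu> - 1) * exp (- \<beta> * \<xi>\<^sup>2)) \<partial>half_line) = ennreal (Gamma \<mu> / (2 * \<beta> powr \<mu>))"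
proof -
  have G: "Gamma \<mu> > 0" using \<mu> by (rule Gamma_real_pos)
  have "(\<integral>\<^sup>+\<xi>. ennreal (\<xi> powr (2 * \<mu> - 1) * exp (- \<beta> * \<xi>\<^sup>2)) \<partial>half_line) =
      (\<integral>\<^sup>+\<xi>. ennreal (\<xi> powr (2 * \<mu> - 1) * exp (- \<beta> * \<xi>\<^sup>2)) * indicator {0<..} \<xi> \<partial>lborel)"
    by (rule nn_integral_half_line) measurable
  also have "\<dots> = (\<integral>\<^sup>+u. ennreal (exp u powr (2 * \<mu> - 1) * exp (- \<beta> * (exp u)\<^sup>2)) * ennreal (exp u) \<partial>lborel)"
    by (rule nn_integral_exp_substitution) measurable
  also have "\<dots> = (\<integral>\<^sup>+u. ennreal (\<beta> powr - \<mu>) * ennreal (exp (\<mu> * (ln \<beta> + 2 * u) - exp (ln \<beta> + 2 * u))) \<partial>lborel)"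
  \<comment> \<open>The logarithm of \<beta> \<xi>^2 with \<xi> = exp u is ln \<beta> + 2 u. In that
    variable the integral is the logarithmic form of \<Gamma>(\<mu>), and the slope 2 produces the
    factor 1/2.\<close>
  proof (rule nn_integral_cong)
    fix u
    have "exp u powr (2 * \<mu> - 1) * exp (- \<beta> * (exp u)\<^sup>2) * exp u =
        \<beta> powr - \<mu> * exp (\<mu> * (ln \<beta> + 2 * u) - exp (ln \<beta> + 2 * u))"
    proof -
      have "exp u powr (2 * \<mu> - 1) * exp (- \<beta> * (exp u)\<^sup>2) * exp u = exp ((2 * \<mu> - 1) * u + - \<beta> * (exp u)\<^sup>2 + u)"
        by (simp add: powr_def flip: exp_add)
      also have "(2 * \<mu> - 1) * u + - \<beta> * (exp u)\<^sup>2 + u = - \<mu> * ln \<beta> + (\<mu> * (ln \<beta> + 2 * u) - exp (ln \<beta> + 2 * u))"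
      proof -
        have "exp (ln \<beta> + 2 * u) = \<beta> * (exp u)\<^sup>2" using \<beta> by (simp add: exp_add exp_double)
        thus ?thesis by (simp only:) (simp add: algebra_simps)
      qed
      also have "exp \<dots> = \<beta> powr - \<mu> * exp (\<mu> * (ln \<beta> + 2 * u) - exp (ln \<beta> + 2 * u))"
        using \<beta> by (simp only: exp_add powr_def) simp
      finally show ?thesis .
    qed
    thus "ennreal (exp u powr (2 * \<mu> - 1) * exp (- \<beta> * (exp u)\<^sup>2)) * ennreal (exp u) =
        ennreal (\<beta> powr - \<mu>) * ennreal (exp (\<mu> * (ln \<beta> + 2 * u) - exp (ln \<beta> + 2 * u)))"
      by (simp flip: ennreal_mult'')
  qed
  also have "\<dots> = ennreal (\<beta> powr - \<mu>) * (\<integral>\<^sup>+u. ennreal (exp (\<mu> * (ln \<beta> + 2 * u) - exp (ln \<beta> + 2 * u))) \<partial>lborel)"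
    by (rule nn_integral_cmult) measurable
  also have "(\<integral>\<^sup>+u. ennreal (exp (\<mu> * (ln \<beta> + 2 * u) - exp (ln \<beta> + 2 * u))) \<partial>lborel) = ennreal (Gamma \<mu> / 2)"
  proof -
    let ?I = "\<integral>\<^sup>+u. ennreal (exp (\<mu> * (ln \<beta> + 2 * u) - exp (ln \<beta> + 2 * u))) \<partial>lborel"
    have "ennreal (Gamma \<mu>) = ennreal 2 * ?I"
      unfolding nn_integral_Gamma_log[OF \<mu>, symmetric]
      by (subst nn_integral_real_affine[of _ 2 "ln \<beta>"]) simp_all
    hence "ennreal (1/2) * ennreal (Gamma \<mu>) = ennreal (1/2) * ennreal 2 * ?I" by (simp only: mult.assoc)
    also have "ennreal (1/2) * ennreal 2 = 1" by (subst ennreal_mult'[symmetric]) simp_all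
    finally have "?I = ennreal (1/2) * ennreal (Gamma \<mu>)" by (simp only: mult_1_left)
    also have "\<dots> = ennreal (Gamma \<mu> / 2)" by (subst ennreal_mult'[symmetric]) simp_all
    finally show ?thesis .
  qed
  also have "ennreal (\<beta> powr - \<mu>) * ennreal (Gamma \<mu> / 2) = ennreal (Gamma \<mu> / (2 * \<beta> powr \<mu>))"
    by (simp add: powr_minus field_simps flip: ennreal_mult')
  finally show ?thesis .
qed

lemma half_line_space [simp]: "space half_line = {0<..}"
  by (simp add: space_restrict_space)

text \<open>The power of \<beta> \<xi>^2 shifts \<mu> to \<mu> + k in the Gaussian moment, and
  \<beta>^k restores the denominator of the unshifted one.\<close>

lemma has_bochner_integral_weight_power:
  assumes \<mu>: "\<mu> > 0" and \<beta>: "\<beta> > 0"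
  shows "has_bochner_integral half_line (\<lambda>\<xi>. \<xi> powr (2 * \<mu> - 1) * exp (- \<beta> * \<xi>\<^sup>2) * (\<beta> * \<xi>\<^sup>2) ^ k)
    (Gamma (\<mu> + k) / (2 * \<beta> powr \<mu>))"
proof -
  have "has_bochner_integral half_line (\<lambda>\<xi>. \<xi> powr (2 * (\<mu> + k) - 1) * exp (- \<beta> * \<xi>\<^sup>2)) (Gamma (\<mu> + k) / (2 * \<beta> powr (\<mu> + k)))"
  proof (rule has_bochner_integral_nn_integral)
    show "(\<integral>\<^sup>+\<xi>. ennreal (\<xi> powr (2 * (\<mu> + k) - 1) * exp (- \<beta> * \<xi>\<^sup>2)) \<partial>half_line) = ennreal (Gamma (\<mu> + k) / (2 * \<beta> powr (\<mu> + k)))"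
      using \<mu> by (intro nn_integral_gaussian_moment \<beta>) simp
    show "(\<lambda>\<xi>. \<xi> powr (2 * (\<mu> + k) - 1) * exp (- \<beta> * \<xi>\<^sup>2)) \<in> borel_measurable half_line"
      by (rule borel_measurable_half_line) measurable
    show "0 \<le> Gamma (\<mu> + k) / (2 * \<beta> powr (\<mu> + k))" using \<mu> by (simp add: Gamma_real_pos less_imp_le)
  qed simp
  hence "has_bochner_integral half_line (\<lambda>\<xi>. \<beta> ^ k * (\<xi> powr (2 * (\<mu> + k) - 1) * exp (- \<beta> * \<xi>\<^sup>2)))
      (\<beta> ^ k * (Gamma (\<mu> + k) / (2 * \<beta> powr (\<mu> + k))))"
    by (rule has_bochner_integral_mult_right)
  also have "\<beta> ^ k * (Gamma (\<mu> + k) / (2 * \<beta> powr (\<mu> + k))) = Gamma (\<mu> + k) / (2 * \<beta> powr \<mu>)"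
    using \<beta> by (simp add: powr_add powr_realpow)
  finally show ?thesis
  proof (rule has_bochner_integral_cong[THEN iffD1, rotated -1])
    fix \<xi> :: real assume "\<xi> \<in> space half_line"
    hence \<xi>: "\<xi> > 0" by simp
    have "\<xi> powr (2 * (\<mu> + k) - 1) = \<xi> powr ((2 * \<mu> - 1) + real (2 * k))" by (simp add: algebra_simps)
    also have "\<dots> = \<xi> powr (2 * \<mu> - 1) * (\<xi>\<^sup>2) ^ k" using \<xi> by (simp only: powr_add powr_realpow power_mult)
    finally show "\<beta> ^ k * (\<xi> powr (2 * (\<mu> + k) - 1) * exp (- \<beta> * \<xi>\<^sup>2)) = \<xi> powr (2 * \<mu> - 1) * exp (- \<beta> * \<xi>\<^sup>2) * (\<beta> * \<xi>\<^sup>2) ^ k"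
      by (simp add: power_mult_distrib mult_ac)
  qed simp_all
qed

context
  fixes \<mu> \<beta> :: real
  assumes \<mu>: "\<mu> > 0" and \<beta>: "\<beta> > 0"
begin

definition laguerre_weight :: "real \<Rightarrow> real" where
  "laguerre_weight \<xi> = \<xi> powr (2 * \<mu> - 1) * exp (- \<beta> * \<xi>\<^sup>2)"

text \<open>The first root gives the weight total mass one, and the second normalizes the polynomial
  with respect to that probability.\<close>

definition laguerre_fun :: "nat \<Rightarrow> real \<Rightarrow> real" where
  "laguerre_fun n \<xi> = sqrt (2 * \<beta> powr \<mu> / Gamma \<mu>) * sqrt (pochhammer \<mu> n / fact n) *
    (\<xi> powr (\<mu> - 1/2) * exp (- (1/2) * \<beta> * \<xi>\<^sup>2)) * laguerre_poly \<mu> n (\<beta> * \<xi>\<^sup>2)"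

lemma Gamma_plus_nat: "Gamma (\<mu> + real n) = pochhammer \<mu> n * Gamma \<mu>"
  using pochhammer_eq_Gamma_quotient[OF \<mu>, of n] Gamma_real_pos[OF \<mu>] by simp

text \<open>The moment of order k + s is proportional to (\<mu>)_s (\<mu> + s)_k. The factor
  (\<mu>)_s cancels the denominator in the polynomial, and a finite difference of a polynomial of
  degree k in s remains.\<close>

lemma has_bochner_integral_laguerre_power:
  assumes "k \<le> n"
  shows "has_bochner_integral half_line (\<lambda>\<xi>. laguerre_weight \<xi> * ((\<beta> * \<xi>\<^sup>2) ^ k * laguerre_poly \<mu> n (\<beta> * \<xi>\<^sup>2)))
    (if k = n then (-1) ^ n * fact n * Gamma \<mu> / (2 * \<beta> powr \<mu>) else 0)"
proof -
  have "has_bochner_integral half_line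
      (\<lambda>\<xi>. \<Sum>s\<le>n. ((-1) ^ s * real (n choose s) / pochhammer \<mu> s) * (laguerre_weight \<xi> * (\<beta> * \<xi>\<^sup>2) ^ (k + s)))
      (\<Sum>s\<le>n. ((-1) ^ s * real (n choose s) / pochhammer \<mu> s) * (Gamma (\<mu> + real (k + s)) / (2 * \<beta> powr \<mu>)))"
    unfolding laguerre_weight_def
    by (intro has_bochner_integral_sum has_bochner_integral_mult_right has_bochner_integral_weight_power \<mu> \<beta>)
  also have "(\<lambda>\<xi>. \<Sum>s\<le>n. ((-1) ^ s * real (n choose s) / pochhammer \<mu> s) * (laguerre_weight \<xi> * (\<beta> * \<xi>\<^sup>2) ^ (k + s))) =
      (\<lambda>\<xi>. laguerre_weight \<xi> * ((\<beta> * \<xi>\<^sup>2) ^ k * laguerre_poly \<mu> n (\<beta> * \<xi>\<^sup>2)))"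
  proof
    fix \<xi>
    have minus: "(- (\<beta> * \<xi>\<^sup>2)) ^ s = (-1) ^ s * (\<beta> * \<xi>\<^sup>2) ^ s" for s by (rule power_minus)
    show "(\<Sum>s\<le>n. ((-1) ^ s * real (n choose s) / pochhammer \<mu> s) * (laguerre_weight \<xi> * (\<beta> * \<xi>\<^sup>2) ^ (k + s))) =
      laguerre_weight \<xi> * ((\<beta> * \<xi>\<^sup>2) ^ k * laguerre_poly \<mu> n (\<beta> * \<xi>\<^sup>2))"
      unfolding laguerre_poly_def sum_distrib_left power_add minus by (intro sum.cong) (simp_all only: times_divide_eq_left times_divide_eq_right mult_ac)
  qed
  also have "(\<Sum>s\<le>n. ((-1) ^ s * real (n choose s) / pochhammer \<mu> s) * (Gamma (\<mu> + real (k + s)) / (2 * \<beta> powr \<mu>))) =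
      (\<Sum>s\<le>n. (-1) ^ s * real (n choose s) * pochhammer (\<mu> + real s) k) * (Gamma \<mu> / (2 * \<beta> powr \<mu>))"
    unfolding sum_distrib_right
  proof (intro sum.cong refl)
    fix s
    have "pochhammer \<mu> s > 0" using \<mu> by (rule pochhammer_pos)
    moreover have "pochhammer \<mu> (k + s) = pochhammer \<mu> s * pochhammer (\<mu> + real s) k"
      using pochhammer_product'[of \<mu> s k] by (simp add: add.commute)
    ultimately show "((-1) ^ s * real (n choose s) / pochhammer \<mu> s) * (Gamma (\<mu> + real (k + s)) / (2 * \<beta> powr \<mu>)) =
        (-1) ^ s * real (n choose s) * pochhammer (\<mu> + real s) k * (Gamma \<mu> / (2 * \<beta> powr \<mu>))"
      unfolding Gamma_plus_nat by simp
  qed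
  also have "(\<Sum>s\<le>n. (-1) ^ s * real (n choose s) * pochhammer (\<mu> + real s) k) * (Gamma \<mu> / (2 * \<beta> powr \<mu>)) =
      (if k = n then (-1) ^ n * fact n * Gamma \<mu> / (2 * \<beta> powr \<mu>) else 0)"
    unfolding alternating_binomial_pochhammer[OF assms] by simp
  finally show ?thesis .
qed

text \<open>Expanding the factor of lower degree leaves only powers up to n; all are orthogonal to
  the other factor except the top one when m = n.\<close>

lemma has_bochner_integral_laguerre_mult:
  assumes "m \<le> n"
  shows "has_bochner_integral half_line (\<lambda>\<xi>. laguerre_weight \<xi> * (laguerre_poly \<mu> m (\<beta> * \<xi>\<^sup>2) * laguerre_poly \<mu> n (\<beta> * \<xi>\<^sup>2)))
    (if m = n then fact n / pochhammer \<mu> n * Gamma \<mu> / (2 * \<beta> powr \<mu>) else 0)"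
proof -
  have "has_bochner_integral half_line
      (\<lambda>\<xi>. \<Sum>s\<le>m. ((-1) ^ s * real (m choose s) / pochhammer \<mu> s) * (laguerre_weight \<xi> * ((\<beta> * \<xi>\<^sup>2) ^ s * laguerre_poly \<mu> n (\<beta> * \<xi>\<^sup>2))))
      (\<Sum>s\<le>m. ((-1) ^ s * real (m choose s) / pochhammer \<mu> s) * (if s = n then (-1) ^ n * fact n * Gamma \<mu> / (2 * \<beta> powr \<mu>) else 0))"
    using assms by (intro has_bochner_integral_sum has_bochner_integral_mult_right has_bochner_integral_laguerre_power) simp
  also have "(\<lambda>\<xi>. \<Sum>s\<le>m. ((-1) ^ s * real (m choose s) / pochhammer \<mu> s) * (laguerre_weight \<xi> * ((\<beta> * \<xi>\<^sup>2) ^ s * laguerre_poly \<mu> n (\<beta> * \<xi>\<^sup>2)))) =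
      (\<lambda>\<xi>. laguerre_weight \<xi> * (laguerre_poly \<mu> m (\<beta> * \<xi>\<^sup>2) * laguerre_poly \<mu> n (\<beta> * \<xi>\<^sup>2)))"
  proof
    fix \<xi>
    have minus: "(- (\<beta> * \<xi>\<^sup>2)) ^ s = (-1) ^ s * (\<beta> * \<xi>\<^sup>2) ^ s" for s by (rule power_minus)
    show "(\<Sum>s\<le>m. ((-1) ^ s * real (m choose s) / pochhammer \<mu> s) * (laguerre_weight \<xi> * ((\<beta> * \<xi>\<^sup>2) ^ s * laguerre_poly \<mu> n (\<beta> * \<xi>\<^sup>2)))) =
      laguerre_weight \<xi> * (laguerre_poly \<mu> m (\<beta> * \<xi>\<^sup>2) * laguerre_poly \<mu> n (\<beta> * \<xi>\<^sup>2))"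
      unfolding laguerre_poly_def[of \<mu> m] sum_distrib_left sum_distrib_right minus by (intro sum.cong) (simp_all only: times_divide_eq_left times_divide_eq_right mult_ac)
  qed
  also have "(\<Sum>s\<le>m. ((-1) ^ s * real (m choose s) / pochhammer \<mu> s) * (if s = n then (-1) ^ n * fact n * Gamma \<mu> / (2 * \<beta> powr \<mu>) else 0)) =
      (if m = n then fact n / pochhammer \<mu> n * Gamma \<mu> / (2 * \<beta> powr \<mu>) else 0)"
  proof (cases "m = n")
    case True
    have "(\<Sum>s\<le>n. ((-1) ^ s * real (n choose s) / pochhammer \<mu> s) * (if s = n then (-1) ^ n * fact n * Gamma \<mu> / (2 * \<beta> powr \<mu>) else 0)) =
        (\<Sum>s\<le>n. if s = n then ((-1) ^ n * real (n choose n) / pochhammer \<mu> n) * ((-1) ^ n * fact n * Gamma \<mu> / (2 * \<beta> powr \<mu>)) else 0)"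
      by (intro sum.cong) auto
    also have "\<dots> = ((-1) ^ n * (-1) ^ n) * (fact n / pochhammer \<mu> n * Gamma \<mu> / (2 * \<beta> powr \<mu>))"
      by simp
    also have "(-1) ^ n * (-1) ^ n = (1::real)" by (simp flip: power_mult_distrib)
    finally show ?thesis using True by simp
  next
    case False
    hence "s \<noteq> n" if "s \<le> m" for s using that assms by auto
    thus ?thesis using False by simp
  qed
  finally show ?thesis .
qed

lemma laguerre_fun_measurable [measurable]: "laguerre_fun n \<in> borel_measurable borel"
  unfolding laguerre_fun_def laguerre_poly_def by measurable

lemma has_bochner_integral_laguerre_fun:
  "has_bochner_integral half_line (\<lambda>\<xi>. laguerre_fun m \<xi> * laguerre_fun n \<xi>) (if m = n then 1 else 0)"
proof -
  have *: "has_bochner_integral half_line (\<lambda>\<xi>. laguerre_fun m \<xi> * laguerre_fun n \<xi>) (if m = n then 1 else 0)" if "m \<le> n" for m n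
  proof -
    let ?C = "2 * \<beta> powr \<mu> / Gamma \<mu> * (sqrt (pochhammer \<mu> m / fact m) * sqrt (pochhammer \<mu> n / fact n))"
    have G: "Gamma \<mu> > 0" using \<mu> by (rule Gamma_real_pos)
    hence Gn: "Gamma \<mu> \<noteq> 0" by linarith
    have "has_bochner_integral half_line (\<lambda>\<xi>. ?C * (laguerre_weight \<xi> * (laguerre_poly \<mu> m (\<beta> * \<xi>\<^sup>2) * laguerre_poly \<mu> n (\<beta> * \<xi>\<^sup>2))))
        (?C * (if m = n then fact n / pochhammer \<mu> n * Gamma \<mu> / (2 * \<beta> powr \<mu>) else 0))"
      by (rule has_bochner_integral_mult_right[OF has_bochner_integral_laguerre_mult[OF that]])
    also have "?C * (if m = n then fact n / pochhammer \<mu> n * Gamma \<mu> / (2 * \<beta> powr \<mu>) else 0) = (if m = n then 1 else 0)"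
      using \<beta> Gn pochhammer_pos[OF \<mu>, of n] by simp
    finally show ?thesis
    proof (rule has_bochner_integral_cong[THEN iffD1, rotated -1])
      fix \<xi> :: real
      have w: "laguerre_weight \<xi> = (\<xi> powr (\<mu> - 1/2) * exp (- (1/2) * \<beta> * \<xi>\<^sup>2)) * (\<xi> powr (\<mu> - 1/2) * exp (- (1/2) * \<beta> * \<xi>\<^sup>2))"
      proof -
        have "\<xi> powr (2 * \<mu> - 1) = \<xi> powr (\<mu> - 1/2) * \<xi> powr (\<mu> - 1/2)" by (simp flip: powr_add)
        moreover have "exp (- \<beta> * \<xi>\<^sup>2) = exp (- (1/2) * \<beta> * \<xi>\<^sup>2) * exp (- (1/2) * \<beta> * \<xi>\<^sup>2)" by (simp flip: exp_add)
        ultimately show ?thesis unfolding laguerre_weight_def by (simp only: mult_ac)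
      qed
      have s: "sqrt (2 * \<beta> powr \<mu> / Gamma \<mu>) * sqrt (2 * \<beta> powr \<mu> / Gamma \<mu>) = 2 * \<beta> powr \<mu> / Gamma \<mu>"
        using G by simp
      show "?C * (laguerre_weight \<xi> * (laguerre_poly \<mu> m (\<beta> * \<xi>\<^sup>2) * laguerre_poly \<mu> n (\<beta> * \<xi>\<^sup>2))) = laguerre_fun m \<xi> * laguerre_fun n \<xi>"
      proof -
        have "laguerre_fun m \<xi> * laguerre_fun n \<xi> = sqrt (2 * \<beta> powr \<mu> / Gamma \<mu>) * sqrt (2 * \<beta> powr \<mu> / Gamma \<mu>) *
            (sqrt (pochhammer \<mu> m / fact m) * sqrt (pochhammer \<mu> n / fact n)) *
            (laguerre_weight \<xi> * (laguerre_poly \<mu> m (\<beta> * \<xi>\<^sup>2) * laguerre_poly \<mu> n (\<beta> * \<xi>\<^sup>2)))"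
          unfolding laguerre_fun_def w by (simp only: mult_ac)
        thus ?thesis unfolding s by simp
      qed
    qed simp_all
  qed
  show ?thesis
  proof (cases "m \<le> n")
    case False
    hence "n \<le> m" "n \<noteq> m" "m \<noteq> n" by auto
    thus ?thesis using *[of n m] by (simp add: mult.commute)
  qed (rule *)
qed

lemma l2_orthonormal_laguerre: "l2_orthonormal half_line (\<lambda>n \<xi>. complex_of_real (laguerre_fun n \<xi>))"
  unfolding l2_orthonormal_def
proof (intro conjI allI)
  fix m n
  have "(\<lambda>\<xi>. complex_of_real (laguerre_fun n \<xi>)) \<in> borel_measurable half_line"
    by (rule borel_measurable_half_line) measurable
  thus "(\<lambda>\<xi>. complex_of_real (laguerre_fun n \<xi>)) \<in> L2 half_line"
    using has_bochner_integral_laguerre_fun[of n n]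
    by (simp add: L2_def has_bochner_integral_iff power2_eq_square)
  have "l2_inner half_line (\<lambda>\<xi>. complex_of_real (laguerre_fun m \<xi>)) (\<lambda>\<xi>. complex_of_real (laguerre_fun n \<xi>)) =
      (\<integral>\<xi>. complex_of_real (laguerre_fun m \<xi> * laguerre_fun n \<xi>) \<partial>half_line)"
    by (simp add: l2_inner_def)
  also have "\<dots> = complex_of_real (if m = n then 1 else 0)"
    unfolding integral_complex_of_real using has_bochner_integral_laguerre_fun[of m n]
    by (simp add: has_bochner_integral_iff)
  finally show "l2_inner half_line (\<lambda>\<xi>. complex_of_real (laguerre_fun m \<xi>)) (\<lambda>\<xi>. complex_of_real (laguerre_fun n \<xi>)) =
      (if m = n then 1 else 0)" by simp
qed

end

section \<open>Completeness of the Laguerre functions\<close>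

lemma AE_zero_of_lessThan_integrals:
  fixes g :: "real \<Rightarrow> real"
  assumes int: "integrable lborel g" and zero: "\<And>c. (\<integral>x. g x * indicator {..<c} x \<partial>lborel) = 0"
  shows "AE x in lborel. g x = 0"
proof -
  have gm [measurable]: "g \<in> borel_measurable borel" using int by simp
  \<comment> \<open>\<open>ennreal\<close> truncates, so these are the measures with densities the
    positive and the negative part of g. They agree on a generator, hence the two parts agree almost
    everywhere.\<close>
  have eq: "density lborel (\<lambda>x. ennreal (g x)) = density lborel (\<lambda>x. ennreal (- g x))"
  proof (rule measure_eqI_generator_eq)
    let ?E = "range (\<lambda>r::real. {..<r})"
    have "{..<a} \<inter> {..<b} = {..<min a b}" for a b :: real by auto
    thus "Int_stable ?E" by (intro Int_stableI) auto
    show "?E \<subseteq> Pow UNIV" by simp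
    show "sets (density lborel (\<lambda>x. ennreal (g x))) = sigma_sets UNIV ?E"
      "sets (density lborel (\<lambda>x. ennreal (- g x))) = sigma_sets UNIV ?E"
      by (simp_all add: borel_Iio)
    show "range (\<lambda>n. {..<real n}) \<subseteq> ?E" by auto
    show "(\<Union>n. {..<real n}) = UNIV" using reals_Archimedean2 by auto
    have fin: "(\<integral>\<^sup>+x. ennreal (s * g x * indicator {..<c} x) \<partial>lborel) < \<infinity>" if "s \<in> {1, -1}" for c s
    proof -
      have "(\<integral>\<^sup>+x. ennreal (s * g x * indicator {..<c} x) \<partial>lborel) \<le> (\<integral>\<^sup>+x. ennreal (norm (g x)) \<partial>lborel)"
        using that by (intro nn_integral_mono ennreal_leI) (auto simp: indicator_def)
      also have "\<dots> < \<infinity>" using int by (simp add: integrable_iff_bounded)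
      finally show ?thesis .
    qed
    have em: "emeasure (density lborel (\<lambda>x. ennreal (s * g x))) {..<c} = (\<integral>\<^sup>+x. ennreal (s * g x * indicator {..<c} x) \<partial>lborel)" for c s
      by (subst emeasure_density) (auto intro!: nn_integral_cong simp: indicator_def)
    show "emeasure (density lborel (\<lambda>x. ennreal (g x))) {..<real n} \<noteq> \<infinity>" for n
      using em[of 1 "real n"] fin[of 1 "real n"] by simp
    fix X assume "X \<in> ?E"
    then obtain c where X: "X = {..<c}" by auto
    have i: "integrable lborel (\<lambda>x. g x * indicator {..<c} x)"
      by (rule Bochner_Integration.integrable_bound[OF int]) (auto simp: indicator_def)
    have "enn2real (\<integral>\<^sup>+x. ennreal (g x * indicator {..<c} x) \<partial>lborel) =
        enn2real (\<integral>\<^sup>+x. ennreal (- (g x * indicator {..<c} x)) \<partial>lborel)"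
      using zero[of c] unfolding real_lebesgue_integral_def[OF i] by simp
    moreover have "a = b" if "a < \<infinity>" "b < \<infinity>" "enn2real a = enn2real b" for a b
      using that by (metis ennreal_enn2real infinity_ennreal_def)
    ultimately have "(\<integral>\<^sup>+x. ennreal (1 * g x * indicator {..<c} x) \<partial>lborel) = (\<integral>\<^sup>+x. ennreal (-1 * g x * indicator {..<c} x) \<partial>lborel)"
      using fin[of 1 c] fin[of "-1" c] by simp
    thus "emeasure (density lborel (\<lambda>x. ennreal (g x))) X = emeasure (density lborel (\<lambda>x. ennreal (- g x))) X"
      using em[of 1 c] em[of "-1" c] by (simp add: X)
  qed
  have "AE x in lborel. ennreal (g x) = ennreal (- g x)"
    by (rule sigma_finite_measure.density_unique[OF sigma_finite_lborel _ _ eq]) measurable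
  thus ?thesis
  proof eventually_elim
    fix x assume "ennreal (g x) = ennreal (- g x)"
    thus "g x = 0" by (cases "g x \<ge> 0") (simp_all add: ennreal_neg)
  qed
qed

text \<open>Functions on \<open>half_line\<close> are only Lebesgue measurable. After extension by
  zero, a Borel representative brings the statement back to \<open>lborel\<close>.\<close>

lemma half_line_AE_zero_of_lessThan_integrals:
  fixes f :: "real \<Rightarrow> real"
  assumes int: "integrable half_line f" and zero: "\<And>c. c > 0 \<Longrightarrow> (\<integral>x. f x * indicator {..<c} x \<partial>half_line) = 0"
  shows "AE x in half_line. f x = 0"
proof -
  define F where "F x = indicator {0<..} x *\<^sub>R f x" for x
  have F: "integrable lebesgue F"
    using int unfolding F_def by (subst (asm) integrable_restrict_space) auto
  then obtain g where g: "g \<in> borel_measurable lborel" "AE x in lborel. F x = g x"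
    using completion_ex_borel_measurable_real[of F lborel] by auto
  have gm [measurable]: "g \<in> borel_measurable borel" using g(1) by simp
  have ae: "AE x in lebesgue. F x = g x" using g(2) by (rule AE_completion)
  have gleb: "h \<in> borel_measurable lebesgue" if "h \<in> borel_measurable borel" for h :: "real \<Rightarrow> real"
    using that by (intro measurable_completion) simp
  have "integrable lebesgue g"
    by (rule integrable_cong_AE_imp[OF F gleb[OF gm]]) (use ae in auto)
  hence gint: "integrable lborel g" using gm by (subst (asm) integrable_completion) auto
  have "(\<integral>x. g x * indicator {..<c} x \<partial>lborel) = 0" for c
  proof -
    have Fm [measurable]: "F \<in> borel_measurable lebesgue" using F by auto
    have [measurable]: "(indicator {..<c} :: real \<Rightarrow> real) \<in> borel_measurable lebesgue"
      by (rule gleb) measurable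
    have "(\<integral>x. g x * indicator {..<c} x \<partial>lborel) = (\<integral>x. g x * indicator {..<c} x \<partial>lebesgue)"
      by (rule integral_completion[symmetric]) measurable
    also have "\<dots> = (\<integral>x. F x * indicator {..<c} x \<partial>lebesgue)"
    proof (rule integral_cong_AE)
      show "(\<lambda>x. g x * indicator {..<c} x) \<in> borel_measurable lebesgue" by (rule gleb) measurable
      show "(\<lambda>x. F x * indicator {..<c} x) \<in> borel_measurable lebesgue" by measurable
    qed (use ae in auto)
    also have "\<dots> = 0"
    proof (cases "c > 0")
      case True
      have "(\<integral>x. F x * indicator {..<c} x \<partial>lebesgue) = (\<integral>x. indicator {0<..} x *\<^sub>R (f x * indicator {..<c} x) \<partial>lebesgue)"
        by (simp add: F_def mult.assoc)
      also have "\<dots> = (\<integral>x. f x * indicator {..<c} x \<partial>half_line)"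
        by (rule integral_restrict_space[symmetric]) simp
      finally show ?thesis using zero[OF True] by simp
    next
      case False
      hence "(\<lambda>x. F x * indicator {..<c} x) = (\<lambda>x. 0)" by (auto simp: F_def indicator_def fun_eq_iff)
      thus ?thesis by (simp only: Bochner_Integration.integral_zero)
    qed
    finally show ?thesis .
  qed
  from AE_zero_of_lessThan_integrals[OF gint this]
  have "AE x in lborel. g x = 0" .
  hence "AE x in lebesgue. g x = 0" by (rule AE_completion)
  with ae have "AE x in lebesgue. F x = 0" by eventually_elim simp
  hence "AE x in lebesgue. x \<in> {0<..} \<longrightarrow> f x = 0" by eventually_elim (auto simp: F_def)
  thus ?thesis by (subst AE_restrict_space_iff) auto
qed

text \<open>With y = exp (-\<delta> x^2) in [0, 1], f is orthogonal to polynomials in y, hence by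
  uniform approximation to continuous functions of y, hence by dominated convergence to indicators
  of {x < c}.\<close>

lemma half_line_AE_zero_of_gaussian_moments:
  fixes f :: "real \<Rightarrow> real"
  assumes int: "integrable half_line f" and \<delta>: "\<delta> > 0"
    and zero: "\<And>j::nat. (\<integral>x. f x * exp (- \<delta> * x\<^sup>2) ^ j \<partial>half_line) = 0"
  shows "AE x in half_line. f x = 0"
proof (rule half_line_AE_zero_of_lessThan_integrals[OF int])
  define y where "y x = exp (- \<delta> * x\<^sup>2)" for x :: real
  have y01: "y x \<in> {0..1}" for x using \<delta> by (simp add: y_def)
  have fm [measurable]: "f \<in> borel_measurable half_line" using int by simp
  have ym: "(\<lambda>x. h (y x)) \<in> borel_measurable half_line" if "h \<in> borel_measurable borel" for h :: "real \<Rightarrow> real"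
  proof (intro borel_measurable_half_line measurable_compose[OF _ that])
    show "y \<in> borel_measurable borel" unfolding y_def by measurable
  qed
  have bound_int: "integrable half_line (\<lambda>x. f x * h (y x))"
    if "h \<in> borel_measurable borel" "\<And>u. u \<in> {0..1} \<Longrightarrow> \<bar>h u\<bar> \<le> B" for h :: "real \<Rightarrow> real" and B
  proof (rule Bochner_Integration.integrable_bound)
    show "integrable half_line (\<lambda>x. B * f x)" using int by simp
    show "(\<lambda>x. f x * h (y x)) \<in> borel_measurable half_line" using ym[OF that(1)] by measurable
    have "\<bar>h (y x)\<bar> * \<bar>f x\<bar> \<le> \<bar>B\<bar> * \<bar>f x\<bar>" for x
      using that(2)[OF y01[of x]] by (intro mult_right_mono) auto
    thus "AE x in half_line. norm (f x * h (y x)) \<le> norm (B * f x)"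
      by (simp add: abs_mult mult.commute)
  qed
  have poly: "(\<integral>x. f x * (\<Sum>i\<le>n. a i * y x ^ i) \<partial>half_line) = 0" for a :: "nat \<Rightarrow> real" and n
  proof -
    have pint: "integrable half_line (\<lambda>x. f x * y x ^ i)" for i
      using bound_int[of "\<lambda>u. u ^ i" 1] by (simp add: power_le_one)
    have "(\<integral>x. f x * (\<Sum>i\<le>n. a i * y x ^ i) \<partial>half_line) = (\<integral>x. (\<Sum>i\<le>n. a i * (f x * y x ^ i)) \<partial>half_line)"
      by (simp add: sum_distrib_left mult_ac)
    also have "\<dots> = (\<Sum>i\<le>n. a i * (\<integral>x. f x * y x ^ i \<partial>half_line))"
      by (subst Bochner_Integration.integral_sum) (simp_all add: pint)
    also have "\<dots> = 0" using zero unfolding y_def by simp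
    finally show ?thesis .
  qed
  have cont: "(\<integral>x. f x * h (y x) \<partial>half_line) = 0" if h: "continuous_on UNIV h" for h :: "real \<Rightarrow> real"
  proof -
    have hm [measurable]: "h \<in> borel_measurable borel" using h by (rule borel_measurable_continuous_onI)
    have h01: "continuous_on {0..1} h" using h by (rule continuous_on_subset) simp
    have "compact (h ` {0..1})" by (intro compact_continuous_image h01) simp
    then obtain B where B: "\<And>u. u \<in> {0..1} \<Longrightarrow> \<bar>h u\<bar> \<le> B"
      using compact_imp_bounded bounded_iff by (metis image_eqI real_norm_def)
    have le: "\<bar>\<integral>x. f x * h (y x) \<partial>half_line\<bar> \<le> e * (\<integral>x. \<bar>f x\<bar> \<partial>half_line)" if e: "e > 0" for e
    proof -
      obtain p where p: "real_polynomial_function p" "\<And>u. u \<in> {0..1} \<Longrightarrow> \<bar>h u - p u\<bar> < e"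
        using Stone_Weierstrass_real_polynomial_function[OF compact_Icc h01 e] by blast
      obtain a n where an: "p = (\<lambda>x. \<Sum>i\<le>n. a i * x ^ i)"
        using p(1) real_polynomial_function_iff_sum by blast
      have hp: "(\<lambda>u. h u - p u) \<in> borel_measurable borel" unfolding an by measurable
      have i1: "integrable half_line (\<lambda>x. f x * (h (y x) - p (y x)))"
        by (rule bound_int[OF hp, of e]) (use p(2) in \<open>auto intro: less_imp_le\<close>)
      have i2: "integrable half_line (\<lambda>x. f x * h (y x))" by (rule bound_int[OF hm B])
      have i3: "integrable half_line (\<lambda>x. f x * p (y x))"
        using Bochner_Integration.integrable_diff[OF i2 i1] by (simp add: right_diff_distrib)
      have "(\<integral>x. f x * h (y x) \<partial>half_line) = (\<integral>x. f x * (h (y x) - p (y x)) \<partial>half_line)"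
        using i2 i3 poly[of a n] by (simp add: right_diff_distrib an)
      also have "\<bar>\<dots>\<bar> \<le> (\<integral>x. \<bar>f x * (h (y x) - p (y x))\<bar> \<partial>half_line)" by (rule integral_abs_bound)
      also have "\<dots> \<le> (\<integral>x. e * \<bar>f x\<bar> \<partial>half_line)"
      proof (rule integral_mono)
        show "\<bar>f x * (h (y x) - p (y x))\<bar> \<le> e * \<bar>f x\<bar>" for x
          using p(2)[OF y01[of x]] by (simp add: abs_mult mult.commute[of e] mult_left_mono less_imp_le)
      qed (use i1 int in auto)
      also have "\<dots> = e * (\<integral>x. \<bar>f x\<bar> \<partial>half_line)" by simp
      finally show ?thesis .
    qed
    define A where "A = (\<integral>x. \<bar>f x\<bar> \<partial>half_line)"
    have A: "A \<ge> 0" unfolding A_def by simp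
    show ?thesis
    proof (rule ccontr)
      let ?I = "\<bar>\<integral>x. f x * h (y x) \<partial>half_line\<bar>"
      assume "(\<integral>x. f x * h (y x) \<partial>half_line) \<noteq> 0"
      hence I: "?I > 0" by simp
      \<comment> \<open>The choice e = I / (2 (A + 1)) forces I \<le> I / 2; adding 1 keeps the
        denominator positive when A = 0.\<close>
      have "?I \<le> ?I / (2 * (A + 1)) * A"
        using le[of "?I / (2 * (A + 1))"] I A unfolding A_def[symmetric] by simp
      also have "\<dots> \<le> ?I / (2 * (A + 1)) * (A + 1)" using I A by (intro mult_left_mono) auto
      also have "\<dots> = ?I / 2" using A by (simp add: field_simps)
      finally show False using I by simp
    qed
  qed
  fix c :: real assume c: "c > 0"
  define y0 where "y0 = y c"
  \<comment> \<open>A continuous ramp from 0 at y0 to 1 at y0 + 1/m. As y decreases in x, the ramps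
    tend to the indicator of x < c, with value 0 at x = c as required.\<close>
  define h where "h m u = max 0 (min 1 (real m * (u - y0)))" for m u
  have "(\<lambda>m. \<integral>x. f x * h m (y x) \<partial>half_line) \<longlonglongrightarrow> (\<integral>x. f x * indicator {..<c} x \<partial>half_line)"
  proof (rule integral_dominated_convergence[where w = "\<lambda>x. \<bar>f x\<bar>"])
    have "(\<lambda>x. indicator {..<c} x :: real) \<in> borel_measurable half_line"
      by (rule borel_measurable_half_line) measurable
    thus "(\<lambda>x. f x * indicator {..<c} x) \<in> borel_measurable half_line" by measurable
    have "h m \<in> borel_measurable borel" for m unfolding h_def by measurable
    from ym[OF this] show "(\<lambda>x. f x * h m (y x)) \<in> borel_measurable half_line" for m by measurable
    show "integrable half_line (\<lambda>x. \<bar>f x\<bar>)" using int by simp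
    show "AE x in half_line. norm (f x * h m (y x)) \<le> \<bar>f x\<bar>" for m
    proof (rule AE_I2)
      fix x
      have "\<bar>h m (y x)\<bar> \<le> 1" by (auto simp: h_def)
      thus "norm (f x * h m (y x)) \<le> \<bar>f x\<bar>" by (simp add: abs_mult mult_left_le)
    qed
    show "AE x in half_line. (\<lambda>m. f x * h m (y x)) \<longlonglongrightarrow> f x * indicator {..<c} x"
    proof (intro AE_I2 tendsto_mult tendsto_const)
      fix x assume "x \<in> space half_line"
      hence x: "x > 0" by simp
      have iff: "y0 < y x \<longleftrightarrow> x < c"
      proof -
        have "y0 < y x \<longleftrightarrow> x\<^sup>2 < c\<^sup>2" using \<delta> by (simp add: y0_def y_def)
        also have "\<dots> \<longleftrightarrow> x < c" using x c power2_less_imp_less[of x c] power_strict_mono[of x c 2] by auto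
        finally show ?thesis .
      qed
      show "(\<lambda>m. h m (y x)) \<longlonglongrightarrow> indicator {..<c} x"
      proof (cases "x < c")
        case True
        hence d: "y x - y0 > 0" using iff by simp
        obtain N :: nat where N: "1 / (y x - y0) \<le> real N" using real_arch_simple by blast
        have "h m (y x) = 1" if "m \<ge> N" for m
        proof -
          have "1 = 1 / (y x - y0) * (y x - y0)" using d by simp
          also have "\<dots> \<le> real m * (y x - y0)" using N that d by (intro mult_right_mono) auto
          finally show ?thesis by (simp add: h_def)
        qed
        thus ?thesis using True by (intro tendsto_eventually eventually_sequentiallyI[of N]) simp
      next
        case False
        hence "y x - y0 \<le> 0" using iff by simp
        hence "real m * (y x - y0) \<le> 0" for m by (intro mult_nonneg_nonpos) auto
        moreover have "max 0 (min 1 t) = 0" if "t \<le> 0" for t :: real using that by (simp add: max_def min_def)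
        ultimately have "h m (y x) = 0" for m unfolding h_def by blast
        thus ?thesis using False by simp
      qed
    qed
  qed
  moreover have "(\<integral>x. f x * h m (y x) \<partial>half_line) = 0" for m
    unfolding h_def by (intro cont continuous_intros)
  ultimately show "(\<integral>x. f x * indicator {..<c} x \<partial>half_line) = 0"
    by (simp add: LIMSEQ_const_iff)
qed

context
  fixes \<mu> \<beta> :: real
  assumes \<mu>: "\<mu> > 0" and \<beta>: "\<beta> > 0"
begin

definition laguerre_half_weight :: "real \<Rightarrow> real" where
  "laguerre_half_weight \<xi> = \<xi> powr (\<mu> - 1/2) * exp (- (1/2) * \<beta> * \<xi>\<^sup>2)"

text \<open>Half of the Gaussian decay is given away: the square of this function still decays like
  exp (-(\<beta> / 2) \<xi>^2). That reserve is the origin of \<delta> = \<beta> / 4 in the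
  completeness proof.\<close>

lemma half_weight_L2:
  "(\<lambda>\<xi>. complex_of_real (laguerre_half_weight \<xi> * (\<xi>\<^sup>2) ^ k * exp (\<beta> / 4 * \<xi>\<^sup>2))) \<in> L2 half_line"
proof -
  let ?h = "\<lambda>\<xi>. laguerre_half_weight \<xi> * (\<xi>\<^sup>2) ^ k * exp (\<beta> / 4 * \<xi>\<^sup>2)"
  have [measurable]: "?h \<in> borel_measurable borel" unfolding laguerre_half_weight_def by measurable
  have "integrable half_line (\<lambda>\<xi>. (2 / \<beta>) ^ (2 * k) * (\<xi> powr (2 * \<mu> - 1) * exp (- (\<beta> / 2) * \<xi>\<^sup>2) * (\<beta> / 2 * \<xi>\<^sup>2) ^ (2 * k)))"
    using has_bochner_integral_weight_power[OF \<mu>, of "\<beta> / 2" "2 * k"] \<beta>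
    by (intro integrable_mult_right) (simp add: has_bochner_integral_iff)
  also have "(\<lambda>\<xi>. (2 / \<beta>) ^ (2 * k) * (\<xi> powr (2 * \<mu> - 1) * exp (- (\<beta> / 2) * \<xi>\<^sup>2) * (\<beta> / 2 * \<xi>\<^sup>2) ^ (2 * k))) = (\<lambda>\<xi>. (?h \<xi>)\<^sup>2)"
  proof
    fix \<xi> :: real
    have "(?h \<xi>)\<^sup>2 = (\<xi> powr (\<mu> - 1/2) * \<xi> powr (\<mu> - 1/2)) *
        (exp (- (1/2) * \<beta> * \<xi>\<^sup>2) * exp (- (1/2) * \<beta> * \<xi>\<^sup>2) * exp (\<beta> / 4 * \<xi>\<^sup>2) * exp (\<beta> / 4 * \<xi>\<^sup>2)) * ((\<xi>\<^sup>2) ^ k * (\<xi>\<^sup>2) ^ k)"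
      unfolding laguerre_half_weight_def power2_eq_square[of "_ * _ * exp _"] by (simp only: mult_ac)
    also have "\<xi> powr (\<mu> - 1/2) * \<xi> powr (\<mu> - 1/2) = \<xi> powr (2 * \<mu> - 1)" by (simp flip: powr_add)
    also have "exp (- (1/2) * \<beta> * \<xi>\<^sup>2) * exp (- (1/2) * \<beta> * \<xi>\<^sup>2) * exp (\<beta> / 4 * \<xi>\<^sup>2) * exp (\<beta> / 4 * \<xi>\<^sup>2) = exp (- (\<beta> / 2) * \<xi>\<^sup>2)"
      by (simp add: algebra_simps flip: exp_add)
    also have "(\<xi>\<^sup>2) ^ k * (\<xi>\<^sup>2) ^ k = (\<xi>\<^sup>2) ^ (2 * k)" by (simp only: mult_2 power_add)
    also have "(\<xi>\<^sup>2) ^ (2 * k) = (2 / \<beta>) ^ (2 * k) * (\<beta> / 2 * \<xi>\<^sup>2) ^ (2 * k)"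
      using \<beta> by (simp add: power_mult_distrib[symmetric] del: power_mult_distrib)
    finally show "(2 / \<beta>) ^ (2 * k) * (\<xi> powr (2 * \<mu> - 1) * exp (- (\<beta> / 2) * \<xi>\<^sup>2) * (\<beta> / 2 * \<xi>\<^sup>2) ^ (2 * k)) = (?h \<xi>)\<^sup>2"
      by (simp only: mult_ac)
  qed
  finally have i: "integrable half_line (\<lambda>\<xi>. (?h \<xi>)\<^sup>2)" .
  have "(\<lambda>\<xi>. complex_of_real (?h \<xi>)) \<in> borel_measurable half_line"
    by (rule borel_measurable_half_line) measurable
  thus ?thesis using i unfolding L2_def mem_Collect_eq norm_of_real power2_abs by simp
qed

lemma laguerre_fun_eq:
  "laguerre_fun \<mu> \<beta> n \<xi> = (sqrt (2 * \<beta> powr \<mu> / Gamma \<mu>) * sqrt (pochhammer \<mu> n / fact n)) *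
    (laguerre_half_weight \<xi> * (\<Sum>s\<le>n. (real (n choose s) * (- \<beta>) ^ s / pochhammer \<mu> s) * (\<xi>\<^sup>2) ^ s))"
proof -
  have "laguerre_poly \<mu> n (\<beta> * \<xi>\<^sup>2) = (\<Sum>s\<le>n. (real (n choose s) * (- \<beta>) ^ s / pochhammer \<mu> s) * (\<xi>\<^sup>2) ^ s)"
    unfolding laguerre_poly_def mult_minus_left[symmetric] power_mult_distrib by (intro sum.cong) simp_all
  thus ?thesis unfolding laguerre_fun_def[OF \<mu> \<beta>] laguerre_half_weight_def by (simp only: mult.assoc)
qed

lemma laguerre_complete:
  assumes \<phi>: "\<phi> \<in> L2 half_line"
    and orth: "\<And>n. l2_inner half_line \<phi> (\<lambda>\<xi>. complex_of_real (laguerre_fun \<mu> \<beta> n \<xi>)) = 0"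
  shows "l2_sqnorm half_line \<phi> = 0"
proof -
  define \<delta> where "\<delta> = \<beta> / 4"
  have \<delta>: "\<delta> > 0" using \<beta> by (simp add: \<delta>_def)
  define g where "g \<xi> = \<phi> \<xi> * complex_of_real (laguerre_half_weight \<xi>)" for \<xi>
  have \<phi>m [measurable]: "\<phi> \<in> borel_measurable half_line" using \<phi> by (rule L2_measurable)
  have rm: "(\<lambda>\<xi>. complex_of_real (h \<xi>)) \<in> borel_measurable half_line" if [measurable]: "h \<in> borel_measurable borel" for h
    by (rule borel_measurable_half_line) measurable
  have gm [measurable]: "g \<in> borel_measurable half_line"
  proof -
    have "(\<lambda>\<xi>. complex_of_real (laguerre_half_weight \<xi>)) \<in> borel_measurable half_line"
      by (rule rm) (simp add: laguerre_half_weight_def[abs_def])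
    thus ?thesis unfolding g_def by measurable
  qed
  have dom: "integrable half_line (\<lambda>\<xi>. cmod (g \<xi>) * ((\<xi>\<^sup>2) ^ k * exp (\<delta> * \<xi>\<^sup>2)))" for k
  proof -
    have "integrable half_line (\<lambda>\<xi>. cmod (\<phi> \<xi>) * cmod (complex_of_real (laguerre_half_weight \<xi> * (\<xi>\<^sup>2) ^ k * exp (\<beta> / 4 * \<xi>\<^sup>2))))"
      by (rule L2_integrable_norm_mult[OF \<phi> half_weight_L2])
    thus ?thesis unfolding norm_of_real by (simp add: g_def \<delta>_def norm_mult abs_mult mult_ac)
  qed
  have gint: "integrable half_line (\<lambda>\<xi>. g \<xi> * complex_of_real ((\<xi>\<^sup>2) ^ k * h \<xi>))"
    if "h \<in> borel_measurable borel" "\<And>\<xi>. \<bar>h \<xi>\<bar> \<le> exp (\<delta> * \<xi>\<^sup>2)" for k h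
  proof (rule Bochner_Integration.integrable_bound[OF dom[of k]])
    have "(\<lambda>\<xi>. complex_of_real ((\<xi>\<^sup>2) ^ k * h \<xi>)) \<in> borel_measurable half_line"
      by (rule rm) (use that(1) in measurable)
    thus "(\<lambda>\<xi>. g \<xi> * complex_of_real ((\<xi>\<^sup>2) ^ k * h \<xi>)) \<in> borel_measurable half_line" by measurable
    have "cmod (g \<xi> * complex_of_real ((\<xi>\<^sup>2) ^ k * h \<xi>)) \<le> cmod (g \<xi>) * ((\<xi>\<^sup>2) ^ k * exp (\<delta> * \<xi>\<^sup>2))" for \<xi>
      using that(2)[of \<xi>] by (simp only: norm_mult norm_of_real abs_mult) (intro mult_left_mono mult_mono; simp)
    thus "AE \<xi> in half_line. norm (g \<xi> * complex_of_real ((\<xi>\<^sup>2) ^ k * h \<xi>)) \<le> norm (cmod (g \<xi>) * ((\<xi>\<^sup>2) ^ k * exp (\<delta> * \<xi>\<^sup>2)))"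
      by simp
  qed
  have gint_exp: "integrable half_line (\<lambda>\<xi>. g \<xi> * complex_of_real ((\<xi>\<^sup>2) ^ k * exp (- \<delta> * \<xi>\<^sup>2) ^ j))" for k j
  proof (rule gint)
    fix \<xi> :: real
    have "exp (- \<delta> * \<xi>\<^sup>2) ^ j \<le> 1" using \<delta> by (intro power_le_one) auto
    also have "1 \<le> exp (\<delta> * \<xi>\<^sup>2)" using \<delta> by simp
    finally show "\<bar>exp (- \<delta> * \<xi>\<^sup>2) ^ j\<bar> \<le> exp (\<delta> * \<xi>\<^sup>2)" by simp
  qed measurable
  \<comment> \<open>Each Laguerre function has a nonzero top coefficient as a polynomial in \<xi>^2,
    so orthogonality to all of them is a triangular system for the power moments.\<close>
  have powers: "(\<integral>\<xi>. g \<xi> * complex_of_real ((\<xi>\<^sup>2) ^ k) \<partial>half_line) = 0" for k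
  proof (induction k rule: less_induct)
    case (less n)
    define I where "I s = (\<integral>\<xi>. g \<xi> * complex_of_real ((\<xi>\<^sup>2) ^ s) \<partial>half_line)" for s
    define a where "a s = real (n choose s) * (- \<beta>) ^ s / pochhammer \<mu> s" for s
    define c where "c = sqrt (2 * \<beta> powr \<mu> / Gamma \<mu>) * sqrt (pochhammer \<mu> n / fact n)"
    have "c > 0" using \<mu> \<beta> by (simp add: c_def Gamma_real_pos pochhammer_pos)
    have "0 = l2_inner half_line \<phi> (\<lambda>\<xi>. complex_of_real (laguerre_fun \<mu> \<beta> n \<xi>))" by (rule orth[symmetric])
    also have "\<dots> = (\<integral>\<xi>. (\<Sum>s\<le>n. complex_of_real (c * a s) * (g \<xi> * complex_of_real ((\<xi>\<^sup>2) ^ s))) \<partial>half_line)"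
      unfolding l2_inner_def laguerre_fun_eq c_def[symmetric] a_def[symmetric]
      by (simp add: g_def sum_distrib_left sum_distrib_right mult_ac)
    also have "\<dots> = (\<Sum>s\<le>n. complex_of_real (c * a s) * I s)"
      unfolding I_def using gint_exp[of _ 0]
      by (subst Bochner_Integration.integral_sum) simp_all
    also have "\<dots> = complex_of_real (c * a n) * I n"
      using less unfolding I_def by (subst sum.remove[of _ n]) (auto intro!: sum.neutral)
    finally have "complex_of_real (c * a n) * I n = 0" by simp
    moreover have "a n \<noteq> 0" using \<beta> pochhammer_pos[OF \<mu>, of n] by (simp add: a_def)
    ultimately show ?case using \<open>c > 0\<close> unfolding I_def[symmetric] by simp
  qed
  have moments: "(\<integral>\<xi>. g \<xi> * complex_of_real ((\<xi>\<^sup>2) ^ k * exp (- \<delta> * \<xi>\<^sup>2) ^ j) \<partial>half_line) = 0" for k j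
  \<comment> \<open>Expanding one more factor exp (-\<delta> \<xi>^2) raises the power of \<xi>^2,
    hence \<open>k\<close> is arbitrary. The factors already present are at most 1, so the same
    dominating function serves every j.\<close>
  proof (induction j arbitrary: k)
    case (Suc j)
    define p where "p N \<xi> = (\<Sum>i<N. (- \<delta> * \<xi>\<^sup>2) ^ i / fact i)" for N and \<xi> :: real
    have pm: "p N \<in> borel_measurable borel" for N unfolding p_def by measurable
    have p_bound: "\<bar>p N \<xi>\<bar> \<le> exp (\<delta> * \<xi>\<^sup>2)" for N \<xi>
    proof -
      have "\<bar>p N \<xi>\<bar> \<le> (\<Sum>i<N. \<bar>(- \<delta> * \<xi>\<^sup>2) ^ i / fact i\<bar>)" unfolding p_def by (rule sum_abs)
      also have "\<dots> = (\<Sum>i<N. (\<delta> * \<xi>\<^sup>2) ^ i /\<^sub>R fact i)"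
        using \<delta> by (intro sum.cong) (simp_all add: power_abs abs_mult divide_inverse mult.commute)
      also have "\<dots> \<le> exp (\<delta> * \<xi>\<^sup>2)"
        unfolding exp_def using \<delta> by (intro sum_le_suminf summable_exp_generic) auto
      finally show ?thesis .
    qed
    have "(\<lambda>N. \<integral>\<xi>. g \<xi> * complex_of_real ((\<xi>\<^sup>2) ^ k * exp (- \<delta> * \<xi>\<^sup>2) ^ j * p N \<xi>) \<partial>half_line)
        \<longlonglongrightarrow> (\<integral>\<xi>. g \<xi> * complex_of_real ((\<xi>\<^sup>2) ^ k * exp (- \<delta> * \<xi>\<^sup>2) ^ j * exp (- \<delta> * \<xi>\<^sup>2)) \<partial>half_line)"
    proof (rule integral_dominated_convergence[OF _ _ dom[of k]])
      have "(\<lambda>\<xi>. complex_of_real ((\<xi>\<^sup>2) ^ k * exp (- \<delta> * \<xi>\<^sup>2) ^ j * exp (- \<delta> * \<xi>\<^sup>2))) \<in> borel_measurable half_line"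
        by (rule rm) measurable
      thus "(\<lambda>\<xi>. g \<xi> * complex_of_real ((\<xi>\<^sup>2) ^ k * exp (- \<delta> * \<xi>\<^sup>2) ^ j * exp (- \<delta> * \<xi>\<^sup>2))) \<in> borel_measurable half_line"
        by measurable
      have "(\<lambda>\<xi>. complex_of_real ((\<xi>\<^sup>2) ^ k * exp (- \<delta> * \<xi>\<^sup>2) ^ j * p N \<xi>)) \<in> borel_measurable half_line" for N
        by (rule rm) (use pm in measurable)
      thus "(\<lambda>\<xi>. g \<xi> * complex_of_real ((\<xi>\<^sup>2) ^ k * exp (- \<delta> * \<xi>\<^sup>2) ^ j * p N \<xi>)) \<in> borel_measurable half_line" for N
        by measurable
      show "AE \<xi> in half_line. (\<lambda>N. g \<xi> * complex_of_real ((\<xi>\<^sup>2) ^ k * exp (- \<delta> * \<xi>\<^sup>2) ^ j * p N \<xi>))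
          \<longlonglongrightarrow> g \<xi> * complex_of_real ((\<xi>\<^sup>2) ^ k * exp (- \<delta> * \<xi>\<^sup>2) ^ j * exp (- \<delta> * \<xi>\<^sup>2))"
      proof (intro AE_I2 tendsto_intros)
        fix \<xi> :: real
        show "(\<lambda>N. p N \<xi>) \<longlonglongrightarrow> exp (- \<delta> * \<xi>\<^sup>2)"
          using exp_converges[of "- \<delta> * \<xi>\<^sup>2"] by (simp add: sums_def p_def divide_inverse mult.commute)
      qed
      show "AE \<xi> in half_line. norm (g \<xi> * complex_of_real ((\<xi>\<^sup>2) ^ k * exp (- \<delta> * \<xi>\<^sup>2) ^ j * p N \<xi>))
          \<le> cmod (g \<xi>) * ((\<xi>\<^sup>2) ^ k * exp (\<delta> * \<xi>\<^sup>2))" for N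
      proof (rule AE_I2)
        fix \<xi> :: real
        have "exp (- \<delta> * \<xi>\<^sup>2) ^ j \<le> 1" using \<delta> by (intro power_le_one) auto
        hence "exp (- \<delta> * \<xi>\<^sup>2) ^ j * \<bar>p N \<xi>\<bar> \<le> 1 * exp (\<delta> * \<xi>\<^sup>2)" using p_bound by (intro mult_mono) auto
        hence "cmod (g \<xi>) * ((\<xi>\<^sup>2) ^ k * (exp (- \<delta> * \<xi>\<^sup>2) ^ j * \<bar>p N \<xi>\<bar>)) \<le> cmod (g \<xi>) * ((\<xi>\<^sup>2) ^ k * exp (\<delta> * \<xi>\<^sup>2))"
          by (intro mult_left_mono) auto
        moreover have eq: "\<bar>(\<xi>\<^sup>2) ^ k * exp (- \<delta> * \<xi>\<^sup>2) ^ j * p N \<xi>\<bar> = (\<xi>\<^sup>2) ^ k * (exp (- \<delta> * \<xi>\<^sup>2) ^ j * \<bar>p N \<xi>\<bar>)"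
          by (simp add: abs_mult mult.assoc)
        ultimately show "norm (g \<xi> * complex_of_real ((\<xi>\<^sup>2) ^ k * exp (- \<delta> * \<xi>\<^sup>2) ^ j * p N \<xi>)) \<le> cmod (g \<xi>) * ((\<xi>\<^sup>2) ^ k * exp (\<delta> * \<xi>\<^sup>2))"
          by (simp only: norm_mult norm_of_real eq)
      qed
    qed
    moreover have "(\<integral>\<xi>. g \<xi> * complex_of_real ((\<xi>\<^sup>2) ^ k * exp (- \<delta> * \<xi>\<^sup>2) ^ j * p N \<xi>) \<partial>half_line) = 0" for N
    proof -
      have "(\<integral>\<xi>. g \<xi> * complex_of_real ((\<xi>\<^sup>2) ^ k * exp (- \<delta> * \<xi>\<^sup>2) ^ j * p N \<xi>) \<partial>half_line) =
          (\<integral>\<xi>. (\<Sum>i<N. complex_of_real ((- \<delta>) ^ i / fact i) * (g \<xi> * complex_of_real ((\<xi>\<^sup>2) ^ (k + i) * exp (- \<delta> * \<xi>\<^sup>2) ^ j))) \<partial>half_line)"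
      proof (rule Bochner_Integration.integral_cong[OF refl])
        fix \<xi> :: real
        have "(\<xi>\<^sup>2) ^ k * E * ((- \<delta> * \<xi>\<^sup>2) ^ i / fact i) = (- \<delta>) ^ i / fact i * ((\<xi>\<^sup>2) ^ (k + i) * E)" for i E
          unfolding power_mult_distrib power_add by (simp only: times_divide_eq_left times_divide_eq_right mult_ac)
        hence "(\<xi>\<^sup>2) ^ k * exp (- \<delta> * \<xi>\<^sup>2) ^ j * p N \<xi> = (\<Sum>i<N. (- \<delta>) ^ i / fact i * ((\<xi>\<^sup>2) ^ (k + i) * exp (- \<delta> * \<xi>\<^sup>2) ^ j))"
          unfolding p_def sum_distrib_left by (intro sum.cong refl)
        thus "g \<xi> * complex_of_real ((\<xi>\<^sup>2) ^ k * exp (- \<delta> * \<xi>\<^sup>2) ^ j * p N \<xi>) =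
            (\<Sum>i<N. complex_of_real ((- \<delta>) ^ i / fact i) * (g \<xi> * complex_of_real ((\<xi>\<^sup>2) ^ (k + i) * exp (- \<delta> * \<xi>\<^sup>2) ^ j)))"
          by (simp only: of_real_sum sum_distrib_left of_real_mult mult_ac)
      qed
      also have "\<dots> = (\<Sum>i<N. complex_of_real ((- \<delta>) ^ i / fact i) *
          (\<integral>\<xi>. g \<xi> * complex_of_real ((\<xi>\<^sup>2) ^ (k + i) * exp (- \<delta> * \<xi>\<^sup>2) ^ j) \<partial>half_line))"
        by (subst Bochner_Integration.integral_sum) (simp_all only: integrable_mult_right gint_exp integral_mult_right_zero)
      also have "\<dots> = 0" unfolding Suc.IH by simp
      finally show ?thesis .
    qed
    ultimately have "(\<integral>\<xi>. g \<xi> * complex_of_real ((\<xi>\<^sup>2) ^ k * exp (- \<delta> * \<xi>\<^sup>2) ^ j * exp (- \<delta> * \<xi>\<^sup>2)) \<partial>half_line) = 0"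
      by (simp only: LIMSEQ_const_iff)
    thus ?case by (simp only: power_Suc mult_ac)
  qed (use powers in simp)
  have g0: "integrable half_line g" using gint_exp[of 0 0] by simp
  have g_moment: "(\<integral>\<xi>. g \<xi> * complex_of_real (exp (- \<delta> * \<xi>\<^sup>2) ^ j) \<partial>half_line) = 0" for j
    using moments[of 0 j] by (simp only: power_0 mult_1)
  have gi: "integrable half_line (\<lambda>\<xi>. g \<xi> * complex_of_real (exp (- \<delta> * \<xi>\<^sup>2) ^ j))" for j
    using gint_exp[of 0 j] by (simp only: power_0 mult_1)
  have "AE \<xi> in half_line. Re (g \<xi>) = 0"
  proof (rule half_line_AE_zero_of_gaussian_moments[OF _ \<delta>])
    show "integrable half_line (\<lambda>\<xi>. Re (g \<xi>))" using g0 by (rule integrable_Re)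
    fix j
    have "(\<integral>\<xi>. Re (g \<xi>) * exp (- \<delta> * \<xi>\<^sup>2) ^ j \<partial>half_line) = (\<integral>\<xi>. Re (g \<xi> * complex_of_real (exp (- \<delta> * \<xi>\<^sup>2) ^ j)) \<partial>half_line)"
      by (simp only: times_complex.sel Re_complex_of_real Im_complex_of_real mult_zero_right diff_zero)
    also have "\<dots> = Re (\<integral>\<xi>. g \<xi> * complex_of_real (exp (- \<delta> * \<xi>\<^sup>2) ^ j) \<partial>half_line)" by (rule integral_Re[OF gi])
    finally show "(\<integral>\<xi>. Re (g \<xi>) * exp (- \<delta> * \<xi>\<^sup>2) ^ j \<partial>half_line) = 0" unfolding g_moment by simp
  qed
  moreover have "AE \<xi> in half_line. Im (g \<xi>) = 0"
  proof (rule half_line_AE_zero_of_gaussian_moments[OF _ \<delta>])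
    show "integrable half_line (\<lambda>\<xi>. Im (g \<xi>))" using g0 by (rule integrable_Im)
    fix j
    have "(\<integral>\<xi>. Im (g \<xi>) * exp (- \<delta> * \<xi>\<^sup>2) ^ j \<partial>half_line) = (\<integral>\<xi>. Im (g \<xi> * complex_of_real (exp (- \<delta> * \<xi>\<^sup>2) ^ j)) \<partial>half_line)"
      by (simp only: times_complex.sel Re_complex_of_real Im_complex_of_real mult_zero_right add_0)
    also have "\<dots> = Im (\<integral>\<xi>. g \<xi> * complex_of_real (exp (- \<delta> * \<xi>\<^sup>2) ^ j) \<partial>half_line)" by (rule integral_Im[OF gi])
    finally show "(\<integral>\<xi>. Im (g \<xi>) * exp (- \<delta> * \<xi>\<^sup>2) ^ j \<partial>half_line) = 0" unfolding g_moment by simp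
  qed
  ultimately have "AE \<xi> in half_line. \<phi> \<xi> = 0"
  proof (rule AE_mp[OF AE_conjI], intro AE_I2 impI)
    fix \<xi> assume "\<xi> \<in> space half_line" "Re (g \<xi>) = 0 \<and> Im (g \<xi>) = 0"
    hence "\<xi> > 0" "g \<xi> = 0" by (simp_all add: complex_eq_iff)
    \<comment> \<open>The half weight is strictly positive on the open half-line.\<close>
    thus "\<phi> \<xi> = 0" by (simp add: g_def laguerre_half_weight_def)
  qed
  hence "l2_sqnorm half_line \<phi> = (\<integral>\<xi>. 0 \<partial>half_line)"
    unfolding l2_sqnorm_def by (intro integral_cong_AE) auto
  thus ?thesis by simp
qed

end

section \<open>The transform\<close>

lemma bij_betw_diagonals: "bij_betw (\<lambda>(n, s). (n - s, s)) (SIGMA n:UNIV. {..n::nat}) UNIV"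
  by (rule bij_betw_byWitness[where f' = "\<lambda>(r, s). (r + s, s)"]) auto

lemma summable_power_over_pochhammer:
  fixes B a :: real
  assumes "a > 0" "B \<ge> 0"
  shows "summable (\<lambda>n. B ^ n / pochhammer a n)"
proof -
  obtain N :: nat where N: "2 * B \<le> real N" using real_arch_simple by blast
  show ?thesis
  proof (rule summable_ratio_test)
    fix n assume "n \<ge> N"
    hence "2 * B \<le> a + real n" using N assms by linarith
    hence "B / (a + real n) \<le> 1/2" using assms by (simp add: divide_le_eq)
    hence "B ^ n / pochhammer a n * (B / (a + real n)) \<le> B ^ n / pochhammer a n * (1/2)"
      using assms pochhammer_pos[of a n] by (intro mult_left_mono) auto
    moreover have nonneg: "B ^ m / pochhammer a m \<ge> 0" for m using assms pochhammer_pos[of a m] by simp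
    ultimately show "norm (B ^ Suc n / pochhammer a (Suc n)) \<le> 1/2 * norm (B ^ n / pochhammer a n)"
      unfolding real_norm_def abs_of_nonneg[OF nonneg] by (simp add: pochhammer_Suc mult.commute)
  qed simp
qed

lemma pochhammer_ge_1: "a \<ge> 1 \<Longrightarrow> pochhammer (a::real) n \<ge> 1"
proof (induction n)
  case (Suc n)
  hence "1 * 1 \<le> pochhammer a n * (a + real n)" by (intro mult_mono) auto
  thus ?case by (simp add: pochhammer_Suc)
qed simp

text \<open>On the diagonal r + s = n the factorials combine to a binomial coefficient and the
  powers of z to z^n, so the inner sum is a Laguerre polynomial. By (\<mu>)_s \<ge> 1 and the
  binomial theorem, the diagonal has the majorant (|z| (1 + |x|))^n / (c)_n, which justifies the
  rearrangement.\<close>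

lemma kampe_de_feriet_expansion:
  fixes c \<mu> x :: real and z :: complex
  assumes c: "c > 0" and \<mu>: "\<mu> \<ge> 1"
  defines "t \<equiv> \<lambda>n. z ^ n * complex_of_real (laguerre_poly \<mu> n x / pochhammer c n)"
  shows "summable (\<lambda>n. cmod (t n))"
    and "t sums kampe_de_feriet 1 (of_real c) (of_real \<mu>) z (- of_real x * z)"
proof -
  let ?f = "\<lambda>r s. pochhammer 1 (r + s) / (pochhammer (of_real c) (r + s) * pochhammer (of_real \<mu>) s)
        * (z ^ r / fact r) * ((- of_real x * z) ^ s / fact s) :: complex"
  define u where "u n s = real (n choose s) * (- x) ^ s / pochhammer \<mu> s / pochhammer c n" for n s
  have f_eq: "?f (n - s) s = z ^ n * complex_of_real (u n s)" if "s \<le> n" for n s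
  proof -
    have zz: "z ^ (n - s) * z ^ s = z ^ n" using that by (simp flip: power_add)
    have binom: "(fact n :: complex) / (fact (n - s) * fact s) = of_nat (n choose s)"
      using binomial_fact[OF that, where 'a = complex] by (simp add: mult.commute)
    have poch: "pochhammer (complex_of_real c) n = of_real (pochhammer c n)"
      "pochhammer (complex_of_real \<mu>) s = of_real (pochhammer \<mu> s)"
      by (simp_all add: pochhammer_of_real)
    have "?f (n - s) s = (fact n / (fact (n - s) * fact s)) * (z ^ (n - s) * z ^ s) * (- of_real x) ^ s /
        (of_real (pochhammer c n) * of_real (pochhammer \<mu> s))"
      using that unfolding poch[symmetric] power_mult_distrib[of "- of_real x" z] by (simp add: pochhammer_fact[symmetric] mult_ac)
    also have "\<dots> = z ^ n * complex_of_real (u n s)"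
      unfolding zz binom u_def by (simp add: mult_ac)
    finally show ?thesis .
  qed
  have t_eq: "t n = (\<Sum>s\<le>n. z ^ n * complex_of_real (u n s))" for n
    unfolding t_def laguerre_poly_def u_def by (simp add: sum_divide_distrib sum_distrib_left)
  define B where "B = cmod z * (1 + \<bar>x\<bar>)"
  have norm_le: "(\<Sum>s\<le>n. cmod (z ^ n * complex_of_real (u n s))) \<le> B ^ n / pochhammer c n" for n
  proof -
    have pc: "pochhammer c n > 0" using c by (rule pochhammer_pos)
    have "cmod (z ^ n * complex_of_real (u n s)) \<le> cmod z ^ n / pochhammer c n * (real (n choose s) * \<bar>x\<bar> ^ s * 1 ^ (n - s))" for s
    proof -
      have "\<bar>u n s\<bar> = real (n choose s) * \<bar>x\<bar> ^ s / pochhammer \<mu> s / pochhammer c n"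
        using pc pochhammer_ge_1[OF \<mu>, of s] by (simp add: u_def abs_mult power_abs)
      also have "\<dots> \<le> real (n choose s) * \<bar>x\<bar> ^ s / 1 / pochhammer c n"
        using pc pochhammer_ge_1[OF \<mu>, of s] by (intro divide_right_mono divide_left_mono) auto
      finally have "cmod z ^ n * \<bar>u n s\<bar> \<le> cmod z ^ n * (real (n choose s) * \<bar>x\<bar> ^ s / 1 / pochhammer c n)"
        by (intro mult_left_mono) auto
      thus ?thesis by (simp add: norm_mult norm_power)
    qed
    hence "(\<Sum>s\<le>n. cmod (z ^ n * complex_of_real (u n s))) \<le> (\<Sum>s\<le>n. cmod z ^ n / pochhammer c n * (real (n choose s) * \<bar>x\<bar> ^ s * 1 ^ (n - s)))"
      by (rule sum_mono)
    also have "\<dots> = cmod z ^ n / pochhammer c n * (\<bar>x\<bar> + 1) ^ n"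
      unfolding binomial_ring sum_distrib_left ..
    also have "\<dots> = B ^ n / pochhammer c n" by (simp add: B_def power_mult_distrib add.commute)
    finally show ?thesis .
  qed
  have B: "summable (\<lambda>n. B ^ n / pochhammer c n)"
    by (rule summable_power_over_pochhammer[OF c]) (simp add: B_def)
  have inner: "summable (\<lambda>n. \<Sum>s\<le>n. cmod (z ^ n * complex_of_real (u n s)))"
    by (rule summable_comparison_test'[OF B]) (use norm_le in \<open>simp add: sum_nonneg\<close>)
  show summ: "summable (\<lambda>n. cmod (t n))"
    by (rule summable_comparison_test'[OF inner]) (simp add: t_eq norm_sum)
  have "(\<lambda>p. norm (case p of (n, s) \<Rightarrow> ?f (n - s) s)) summable_on (SIGMA n:UNIV. {..n})"
  proof (subst Infinite_Sum.abs_summable_on_Sigma_iff, intro conjI ballI)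
    show "(\<lambda>s. norm (case (n, s) of (n, s) \<Rightarrow> ?f (n - s) s)) summable_on {..n}" for n
      by (rule summable_on_finite) simp
    have eq: "infsum (\<lambda>s. norm (case (n, s) of (n, s) \<Rightarrow> ?f (n - s) s)) {..n} = (\<Sum>s\<le>n. cmod (z ^ n * complex_of_real (u n s)))" for n
      unfolding prod.case infsum_finite[OF finite_atMost]
      by (intro sum.cong refl arg_cong[where f = cmod] f_eq) simp
    show "(\<lambda>n. norm (infsum (\<lambda>s. norm (case (n, s) of (n, s) \<Rightarrow> ?f (n - s) s)) {..n})) summable_on UNIV"
      unfolding eq using inner by (subst summable_on_UNIV_nonneg_real_iff) (simp_all add: sum_nonneg)
  qed
  hence summable: "(\<lambda>(n, s). ?f (n - s) s) summable_on (SIGMA n:UNIV. {..n})"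
    by (rule Infinite_Sum.abs_summable_summable)
  have "kampe_de_feriet 1 (of_real c) (of_real \<mu>) z (- of_real x * z) = infsum (\<lambda>(r, s). ?f r s) UNIV"
    by (simp add: kampe_de_feriet_def)
  also have "\<dots> = infsum (\<lambda>p. case (case p of (n, s) \<Rightarrow> (n - s, s)) of (r, s) \<Rightarrow> ?f r s) (SIGMA n:UNIV. {..n})"
    by (rule infsum_reindex_bij_betw[OF bij_betw_diagonals, symmetric])
  also have "\<dots> = infsum (\<lambda>(n, s). ?f (n - s) s) (SIGMA n:UNIV. {..n})"
    by (rule infsum_cong) (simp add: case_prod_beta)
  also have "\<dots> = infsum (\<lambda>n. infsum (\<lambda>s. ?f (n - s) s) {..n}) UNIV"
    by (rule infsum_Sigma'_banach[symmetric, OF summable])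
  also have "\<dots> = infsum t UNIV"
    unfolding t_eq infsum_finite[OF finite_atMost] by (intro infsum_cong sum.cong refl f_eq) simp
  finally have "kampe_de_feriet 1 (of_real c) (of_real \<mu>) z (- of_real x * z) = infsum t UNIV" .
  moreover have "t sums suminf t" by (rule summable_sums[OF summable_norm_cancel[OF summ]])
  moreover from norm_summable_imp_has_sum[OF summ this] have "infsum t UNIV = suminf t" by (rule infsumI)
  ultimately show "t sums kampe_de_feriet 1 (of_real c) (of_real \<mu>) z (- of_real x * z)" by simp
qed

text \<open>For c = 1 the two factors depending on r + s cancel, so the double series splits into
  the exponential series and a confluent one. The Cauchy product of these has the same diagonals as
  the expansion above.\<close>

lemma kampe_de_feriet_confluent:
  fixes \<mu> x :: real and z :: complex
  assumes \<mu>: "\<mu> \<ge> 1"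
  defines "a \<equiv> \<lambda>s. (- of_real x * z) ^ s / (of_real (pochhammer \<mu> s) * fact s)"
  shows "summable (\<lambda>s. cmod (a s))"
    and "kampe_de_feriet 1 1 (of_real \<mu>) z (- of_real x * z) = exp z * (\<Sum>s. a s)"
proof -
  show a: "summable (\<lambda>s. cmod (a s))"
  proof (rule summable_comparison_test')
    show "summable (\<lambda>s. (\<bar>x\<bar> * cmod z) ^ s /\<^sub>R fact s)" by (rule summable_exp_generic)
    fix s :: nat
    have p: "pochhammer \<mu> s \<ge> 1" by (rule pochhammer_ge_1[OF \<mu>])
    have "cmod (a s) = (\<bar>x\<bar> * cmod z) ^ s / (pochhammer \<mu> s * fact s)"
      using p by (simp add: a_def norm_divide norm_mult norm_power)
    also have "\<dots> \<le> (\<bar>x\<bar> * cmod z) ^ s / (1 * fact s)"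
      using p by (intro divide_left_mono mult_right_mono) auto
    finally show "norm (cmod (a s)) \<le> (\<bar>x\<bar> * cmod z) ^ s /\<^sub>R fact s" by (simp add: divide_inverse mult.commute)
  qed
  define b where "b r = z ^ r / fact r" for r
  have b: "summable (\<lambda>r. cmod (b r))"
    using summable_exp_generic[of "cmod z"] by (simp add: b_def norm_mult norm_inverse norm_power divide_inverse mult.commute)
  have "(\<lambda>n. \<Sum>s\<le>n. a s * b (n - s)) sums ((\<Sum>s. a s) * (\<Sum>r. b r))" by (rule Cauchy_product_sums[OF a b])
  also have "(\<lambda>n. \<Sum>s\<le>n. a s * b (n - s)) = (\<lambda>n. z ^ n * complex_of_real (laguerre_poly \<mu> n x / pochhammer 1 n))"
  proof
    fix n
    have "a s * b (n - s) = z ^ n * complex_of_real (real (n choose s) * (- x) ^ s / pochhammer \<mu> s / pochhammer 1 n)" if "s \<le> n" for s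
    proof -
      have zz: "z ^ s * z ^ (n - s) = z ^ n" using that by (simp flip: power_add)
      have binom: "1 / (fact s * fact (n - s)) = (of_nat (n choose s) / fact n :: complex)"
        using binomial_fact[OF that, where 'a = complex] by simp
      have "a s * b (n - s) = (z ^ s * z ^ (n - s)) * (- of_real x) ^ s / of_real (pochhammer \<mu> s) * (1 / (fact s * fact (n - s)))"
        unfolding a_def b_def power_mult_distrib[of "- of_real x" z] by (simp add: mult_ac)
      also have "\<dots> = z ^ n * complex_of_real (real (n choose s) * (- x) ^ s / pochhammer \<mu> s / pochhammer 1 n)"
        unfolding zz binom by (simp add: pochhammer_fact[symmetric])
      finally show ?thesis .
    qed
    thus "(\<Sum>s\<le>n. a s * b (n - s)) = z ^ n * complex_of_real (laguerre_poly \<mu> n x / pochhammer 1 n)"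
      unfolding laguerre_poly_def by (simp add: sum_divide_distrib sum_distrib_left)
  qed
  finally have "(\<lambda>n. z ^ n * complex_of_real (laguerre_poly \<mu> n x / pochhammer 1 n)) sums ((\<Sum>s. a s) * (\<Sum>r. b r))" .
  moreover have "(\<lambda>n. z ^ n * complex_of_real (laguerre_poly \<mu> n x / pochhammer 1 n)) sums
      kampe_de_feriet 1 1 (of_real \<mu>) z (- of_real x * z)"
    using kampe_de_feriet_expansion(2)[of 1 \<mu> z x] \<mu> by simp
  ultimately have "kampe_de_feriet 1 1 (of_real \<mu>) z (- of_real x * z) = (\<Sum>s. a s) * (\<Sum>r. b r)" by (rule sums_unique2[symmetric])
  also have "(\<Sum>r. b r) = exp z" by (simp add: b_def exp_def divide_inverse scaleR_conv_of_real mult.commute)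
  finally show "kampe_de_feriet 1 1 (of_real \<mu>) z (- of_real x * z) = exp z * (\<Sum>s. a s)" by (simp add: mult.commute)
qed

context
  fixes \<mu> \<sigma> \<beta> :: real
  assumes \<mu>: "\<mu> > 3/2" and \<sigma>: "-1 < \<sigma>" "\<sigma> \<le> 0" and \<beta>: "\<beta> > 0"
begin

abbreviation "laguerre_basis \<equiv> \<lambda>n \<xi>. complex_of_real (laguerre_fun \<mu> \<beta> n \<xi>)"
abbreviation "bargmann_const \<equiv> sqrt (2 * \<beta> powr \<mu> / Gamma \<mu>)"

lemma mu_pos: "\<mu> > 0" using \<mu> by simp

lemma bargmann_const_pos: "bargmann_const > 0"
  using mu_pos \<beta> by (simp add: Gamma_real_pos)

lemma bargmann_kernel_expansion:
  fixes z :: complex and \<xi> :: real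
  defines "t \<equiv> \<lambda>n. entire_basis \<mu> \<sigma> n z * laguerre_basis n \<xi>"
  shows "summable (\<lambda>n. cmod (t n))" and "t sums (of_real bargmann_const * bargmann_kernel \<mu> \<sigma> \<beta> z \<xi>)"
proof -
  let ?w = "\<xi> powr (\<mu> - 1/2) * exp (- (1/2) * \<beta> * \<xi>\<^sup>2)"
  let ?k = "\<lambda>n. z ^ n * complex_of_real (laguerre_poly \<mu> n (\<beta> * \<xi>\<^sup>2) / pochhammer (\<sigma> + 1) n)"
  have c: "\<sigma> + 1 > 0" and m: "\<mu> \<ge> 1" using \<sigma> \<mu> by simp_all
  have t_eq: "t n = of_real (bargmann_const * ?w) * ?k n" for n
  proof -
    have p: "pochhammer \<mu> n > 0" using mu_pos by (rule pochhammer_pos)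
    \<comment> \<open>The two normalizations cancel, leaving the plain coefficient of the diagonal
      expansion.\<close>
    have "sqrt (fact n / pochhammer \<mu> n) * sqrt (pochhammer \<mu> n / fact n) = 1"
      using p by (simp flip: real_sqrt_mult)
    hence "entire_coeff \<mu> \<sigma> n * laguerre_fun \<mu> \<beta> n \<xi> = bargmann_const * ?w * (laguerre_poly \<mu> n (\<beta> * \<xi>\<^sup>2) / pochhammer (\<sigma> + 1) n)"
      unfolding entire_coeff_def laguerre_fun_def[OF mu_pos \<beta>] by (simp add: mult_ac)
    hence "complex_of_real (entire_coeff \<mu> \<sigma> n * laguerre_fun \<mu> \<beta> n \<xi>) = of_real (bargmann_const * ?w * (laguerre_poly \<mu> n (\<beta> * \<xi>\<^sup>2) / pochhammer (\<sigma> + 1) n))"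
      by (simp only:)
    moreover have "t n = z ^ n * complex_of_real (entire_coeff \<mu> \<sigma> n * laguerre_fun \<mu> \<beta> n \<xi>)"
      unfolding t_def entire_basis_def by simp
    ultimately show ?thesis by (simp only: of_real_mult mult_ac)
  qed
  show "summable (\<lambda>n. cmod (t n))"
    unfolding t_eq norm_mult[of "of_real (bargmann_const * ?w)"]
    by (rule summable_mult[OF kampe_de_feriet_expansion(1)[OF c m]])
  have "(\<lambda>n. of_real (bargmann_const * ?w) * ?k n) sums (of_real (bargmann_const * ?w) *
      kampe_de_feriet 1 (of_real (\<sigma> + 1)) (of_real \<mu>) z (- of_real (\<beta> * \<xi>\<^sup>2) * z))"
    by (rule sums_mult[OF kampe_de_feriet_expansion(2)[OF c m]])
  also have "- complex_of_real (\<beta> * \<xi>\<^sup>2) * z = - of_real \<beta> * z * of_real (\<xi>\<^sup>2)" by simp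
  finally show "t sums (of_real bargmann_const * bargmann_kernel \<mu> \<sigma> \<beta> z \<xi>)"
    unfolding t_eq[abs_def] bargmann_kernel_def by (simp only: of_real_mult mult.assoc)
qed

text \<open>Absolute summability at z comes from square summability at 2 z, paired with the
  square-summable sequence 2^-n.\<close>

lemma summable_norm_entire_basis: "summable (\<lambda>n. cmod (entire_basis \<mu> \<sigma> n z))"
proof -
  interpret l2_features "nu_measure \<mu> \<sigma>" "entire_basis \<mu> \<sigma>" by (rule l2_features_entire_basis[OF \<mu> \<sigma>])
  have "summable (\<lambda>n. (cmod ((1/2::complex) ^ n))\<^sup>2)"
  proof -
    have "(cmod ((1/2::complex) ^ n))\<^sup>2 = (1/4) ^ n" for n
    proof -
      have "(cmod ((1/2::complex) ^ n))\<^sup>2 = ((1/2) ^ n)\<^sup>2" by (simp add: norm_power norm_divide)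
      also have "\<dots> = ((1/2)\<^sup>2) ^ n" by (simp only: power_mult[symmetric] mult.commute)
      also have "(1/2)\<^sup>2 = (1/4 :: real)" by (simp add: power2_eq_square)
      finally show ?thesis .
    qed
    thus ?thesis by (simp only:) (simp add: summable_geometric)
  qed
  hence "summable (\<lambda>n. cmod ((1/2) ^ n * entire_basis \<mu> \<sigma> n (2 * z)))" by (rule summable_norm_series)
  thus ?thesis by (simp add: entire_basis_def power_mult_distrib norm_mult norm_power power_divide)
qed

text \<open>Since the Laguerre functions have norm one, the integral of |F n| is at most a constant
  times the modulus of the n-th basis function at z, and these moduli are summable. This licenses
  exchanging sum and integral and also gives integrability of the limit.\<close>

lemma bargmann_expansion:
  assumes \<phi>: "\<phi> \<in> L2 half_line"
  shows "integrable half_line (\<lambda>\<xi>. bargmann_kernel \<mu> \<sigma> \<beta> z \<xi> * \<phi> \<xi>)"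
    and "bargmann \<mu> \<sigma> \<beta> \<phi> z = (\<Sum>n. l2_inner half_line \<phi> (laguerre_basis n) * entire_basis \<mu> \<sigma> n z)"
proof -
  note orth = l2_orthonormal_laguerre[OF mu_pos \<beta>]
  have \<psi>: "laguerre_basis n \<in> L2 half_line" for n by (rule l2_orthonormalD(1)[OF orth])
  define F where "F n \<xi> = entire_basis \<mu> \<sigma> n z * (laguerre_basis n \<xi> * \<phi> \<xi>)" for n \<xi>
  have F: "integrable half_line (F n)" for n
    unfolding F_def by (intro integrable_mult_right L2_integrable_mult \<psi> \<phi>)
  have F_sums: "(\<lambda>n. F n \<xi>) sums (of_real bargmann_const * bargmann_kernel \<mu> \<sigma> \<beta> z \<xi> * \<phi> \<xi>)" for \<xi>
    using sums_mult2[OF bargmann_kernel_expansion(2), of z \<xi> "\<phi> \<xi>"] unfolding F_def by (simp only: mult.assoc)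
  have norm1: "AE \<xi> in half_line. summable (\<lambda>n. norm (F n \<xi>))"
    using summable_mult2[OF bargmann_kernel_expansion(1), of z _ "cmod (\<phi> _)"]
    unfolding F_def by (intro AE_I2) (simp only: norm_mult mult.assoc)
  have "l2_sqnorm half_line (laguerre_basis n) = 1" for n
  proof -
    have "complex_of_real (l2_sqnorm half_line (laguerre_basis n)) = 1"
      using l2_orthonormalD(2)[OF orth, of n n] by (simp add: l2_inner_self)
    thus ?thesis by (simp only: of_real_eq_1_iff)
  qed
  hence \<psi>1: "(\<integral>\<xi>. (cmod (laguerre_basis n \<xi>))\<^sup>2 \<partial>half_line) = 1" for n by (simp only: l2_sqnorm_def)
  have bound: "(\<integral>\<xi>. norm (F n \<xi>) \<partial>half_line) \<le> cmod (entire_basis \<mu> \<sigma> n z) * (1 + l2_sqnorm half_line \<phi>)" for n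
  proof -
    have "cmod (laguerre_basis n \<xi> * \<phi> \<xi>) \<le> (cmod (laguerre_basis n \<xi>))\<^sup>2 + (cmod (\<phi> \<xi>))\<^sup>2" for \<xi>
    proof -
      have "2 * (cmod (laguerre_basis n \<xi>) * cmod (\<phi> \<xi>)) \<le> (cmod (laguerre_basis n \<xi>))\<^sup>2 + (cmod (\<phi> \<xi>))\<^sup>2"
        using sum_squares_bound[of "cmod (laguerre_basis n \<xi>)" "cmod (\<phi> \<xi>)"] by (simp only: mult.assoc)
      moreover have "0 \<le> cmod (laguerre_basis n \<xi>) * cmod (\<phi> \<xi>)" by simp
      ultimately show ?thesis unfolding norm_mult by linarith
    qed
    hence "(\<integral>\<xi>. cmod (laguerre_basis n \<xi> * \<phi> \<xi>) \<partial>half_line) \<le> (\<integral>\<xi>. (cmod (laguerre_basis n \<xi>))\<^sup>2 + (cmod (\<phi> \<xi>))\<^sup>2 \<partial>half_line)"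
      by (intro integral_mono integrable_norm L2_integrable_mult Bochner_Integration.integrable_add L2_integrable \<psi> \<phi>)
    also have "\<dots> = 1 + l2_sqnorm half_line \<phi>"
      unfolding l2_sqnorm_def \<psi>1[of n, symmetric]
      by (intro Bochner_Integration.integral_add L2_integrable \<psi> \<phi>)
    finally have "cmod (entire_basis \<mu> \<sigma> n z) * (\<integral>\<xi>. cmod (laguerre_basis n \<xi> * \<phi> \<xi>) \<partial>half_line) \<le>
        cmod (entire_basis \<mu> \<sigma> n z) * (1 + l2_sqnorm half_line \<phi>)" by (intro mult_left_mono) auto
    thus ?thesis unfolding F_def norm_mult[of "entire_basis \<mu> \<sigma> n z"] by (simp only: integral_mult_right_zero)
  qed
  have norm2: "summable (\<lambda>n. \<integral>\<xi>. norm (F n \<xi>) \<partial>half_line)"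
    by (rule summable_comparison_test'[OF summable_mult2[OF summable_norm_entire_basis[of z], of "1 + l2_sqnorm half_line \<phi>"]])
      (use bound in simp)
  have suminf_F: "(\<Sum>n. F n \<xi>) = of_real bargmann_const * bargmann_kernel \<mu> \<sigma> \<beta> z \<xi> * \<phi> \<xi>" for \<xi>
    using F_sums[of \<xi>] by (simp add: sums_iff)
  have const_nonzero: "complex_of_real bargmann_const \<noteq> 0" using bargmann_const_pos by (metis of_real_eq_0_iff less_irrefl)
  have cancel: "(1 / s) * (s * a * b) = a * b" if "s \<noteq> 0" for s a b :: complex using that by simp
  have "integrable half_line (\<lambda>\<xi>. (1 / of_real bargmann_const) * (of_real bargmann_const * bargmann_kernel \<mu> \<sigma> \<beta> z \<xi> * \<phi> \<xi>))"
    using integrable_suminf[OF F norm1 norm2] unfolding suminf_F by (rule integrable_mult_right)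
  thus "integrable half_line (\<lambda>\<xi>. bargmann_kernel \<mu> \<sigma> \<beta> z \<xi> * \<phi> \<xi>)" by (simp only: cancel[OF const_nonzero])
  have "bargmann \<mu> \<sigma> \<beta> \<phi> z = (\<integral>\<xi>. of_real bargmann_const * (bargmann_kernel \<mu> \<sigma> \<beta> z \<xi> * \<phi> \<xi>) \<partial>half_line)"
    unfolding bargmann_def by (rule integral_mult_right_zero[symmetric])
  also have "\<dots> = (\<integral>\<xi>. (\<Sum>n. F n \<xi>) \<partial>half_line)" unfolding suminf_F by (simp only: mult.assoc)
  also have "\<dots> = (\<Sum>n. \<integral>\<xi>. F n \<xi> \<partial>half_line)" by (rule integral_suminf[OF F norm1 norm2])
  also have "\<dots> = (\<Sum>n. l2_inner half_line \<phi> (laguerre_basis n) * entire_basis \<mu> \<sigma> n z)"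
    unfolding F_def integral_mult_right_zero l2_inner_def complex_cnj_complex_of_real by (simp only: mult.commute)
  finally show "bargmann \<mu> \<sigma> \<beta> \<phi> z = (\<Sum>n. l2_inner half_line \<phi> (laguerre_basis n) * entire_basis \<mu> \<sigma> n z)" .
qed

lemma bargmann_unitary:
  "unitary_map (L2 half_line) (l2_inner half_line) (entire_space \<mu> \<sigma>) (l2_inner (nu_measure \<mu> \<sigma>)) (bargmann \<mu> \<sigma> \<beta>)"
proof -
  interpret l2_features "nu_measure \<mu> \<sigma>" "entire_basis \<mu> \<sigma>" by (rule l2_features_entire_basis[OF \<mu> \<sigma>])
  show ?thesis
    unfolding entire_space_eq[OF \<mu> \<sigma>]
    by (rule unitary_map_expansion[OF l2_orthonormal_laguerre[OF mu_pos \<beta>] laguerre_complete[OF mu_pos \<beta>]])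
      (use bargmann_expansion(2) in auto)
qed

text \<open>The image is a power series; continuity at z = 0 supplies the extension of the Bessel
  form.\<close>

lemma isCont_bargmann:
  assumes \<phi>: "\<phi> \<in> L2 half_line"
  shows "isCont (bargmann \<mu> \<sigma> \<beta> \<phi>) z"
proof -
  interpret l2_features "nu_measure \<mu> \<sigma>" "entire_basis \<mu> \<sigma>" by (rule l2_features_entire_basis[OF \<mu> \<sigma>])
  let ?a = "\<lambda>n. l2_inner half_line \<phi> (laguerre_basis n) * of_real (entire_coeff \<mu> \<sigma> n)"
  have eq: "l2_inner half_line \<phi> (laguerre_basis n) * entire_basis \<mu> \<sigma> n z = ?a n * z ^ n" for n z
    by (simp add: entire_basis_def)
  have "bargmann \<mu> \<sigma> \<beta> \<phi> = (\<lambda>z. \<Sum>n. ?a n * z ^ n)"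
    using bargmann_expansion(2)[OF \<phi>] unfolding eq by (rule ext)
  moreover have "(\<lambda>z. \<Sum>n. ?a n * z ^ n) holomorphic_on UNIV"
    using sums_summable[OF sums_series[OF l2_bessel(1)[OF l2_orthonormal_laguerre[OF mu_pos \<beta>] \<phi>]]]
    unfolding eq by (rule holomorphic_on_power_series)
  ultimately show ?thesis
    by (metis UNIV_I continuous_on_eq_continuous_at holomorphic_on_imp_continuous_on open_UNIV)
qed

end

section \<open>The Bessel form at \<sigma> = 0\<close>

lemma bessel_J_csqrt:
  fixes \<mu> \<beta> \<xi> :: real and z :: complex
  assumes \<mu>: "\<mu> \<ge> 1" and \<beta>: "\<beta> > 0" and \<xi>: "\<xi> > 0" and z: "z \<noteq> 0"
  shows "z powr of_real ((1 - \<mu>) / 2) * exp z * bessel_J (of_real (\<mu> - 1)) (2 * csqrt (of_real \<beta> * z) * of_real \<xi>) =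
    of_real (\<beta> powr ((\<mu> - 1) / 2) * \<xi> powr (\<mu> - 1) / Gamma \<mu>) *
      kampe_de_feriet 1 1 (of_real \<mu>) z (- of_real \<beta> * z * of_real (\<xi>\<^sup>2))"
proof -
  define X where "X = csqrt (of_real \<beta> * z) * of_real \<xi>"
  have G: "Gamma \<mu> > 0" using \<mu> by (intro Gamma_real_pos) simp
  hence Gn: "Gamma \<mu> \<noteq> 0" by linarith
  have Ln_bz: "Ln (of_real \<beta> * z) = of_real (ln \<beta>) + Ln z" using Ln_times_of_real[OF \<beta> z] by (simp add: Ln_of_real \<beta>)
  have "csqrt (of_real \<beta> * z) = exp (Ln (of_real \<beta> * z) / 2)" using \<beta> z by (intro csqrt_exp_Ln) simp
  also have "\<dots> * of_real \<xi> = exp ((of_real (ln \<beta>) + Ln z) / 2 + of_real (ln \<xi>))"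
    using \<xi> by (simp add: Ln_bz exp_add exp_of_real)
  finally have X: "X = exp ((of_real (ln \<beta>) + Ln z) / 2 + of_real (ln \<xi>))" by (simp only: X_def)
  \<comment> \<open>The imaginary part of the exponent is half that of \<open>Ln z\<close>, hence
    within the principal range, and no branch correction arises. The powers of z then cancel
    exactly.\<close>
  have "Ln X = (of_real (ln \<beta>) + Ln z) / 2 + of_real (ln \<xi>)"
    unfolding X using mpi_less_Im_Ln[OF z] Im_Ln_le_pi[OF z] pi_gt_zero by (intro Ln_exp) auto
  hence "X powr of_real (\<mu> - 1) = exp (of_real (\<mu> - 1) * ((of_real (ln \<beta>) + Ln z) / 2 + of_real (ln \<xi>)))"
    using X by (simp add: powr_def)
  moreover have "z powr of_real ((1 - \<mu>) / 2) = exp (of_real ((1 - \<mu>) / 2) * Ln z)" using z by (simp add: powr_def)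
  ultimately have "z powr of_real ((1 - \<mu>) / 2) * X powr of_real (\<mu> - 1) =
      exp (of_real ((1 - \<mu>) / 2) * Ln z + of_real (\<mu> - 1) * ((of_real (ln \<beta>) + Ln z) / 2 + of_real (ln \<xi>)))"
    by (simp only: exp_add)
  also have "of_real ((1 - \<mu>) / 2) * Ln z + of_real (\<mu> - 1) * ((of_real (ln \<beta>) + Ln z) / 2 + of_real (ln \<xi>)) =
      of_real ((\<mu> - 1) / 2 * ln \<beta> + (\<mu> - 1) * ln \<xi>)"
    by (simp add: field_simps)
  also have "exp (complex_of_real ((\<mu> - 1) / 2 * ln \<beta> + (\<mu> - 1) * ln \<xi>)) = of_real (\<beta> powr ((\<mu> - 1) / 2) * \<xi> powr (\<mu> - 1))"
    unfolding exp_of_real using \<beta> \<xi> by (simp add: powr_def exp_add)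
  finally have powers: "z powr of_real ((1 - \<mu>) / 2) * X powr of_real (\<mu> - 1) = of_real (\<beta> powr ((\<mu> - 1) / 2) * \<xi> powr (\<mu> - 1))" .
  have "X\<^sup>2 = of_real (\<beta> * \<xi>\<^sup>2) * z" by (simp add: X_def power_mult_distrib)
  hence X2: "X ^ (2 * k) = (of_real (\<beta> * \<xi>\<^sup>2) * z) ^ k" for k by (simp add: power_mult)
  let ?a = "\<lambda>s. (- of_real (\<beta> * \<xi>\<^sup>2) * z) ^ s / (of_real (pochhammer \<mu> s) * fact s)"
  have summand: "(-1) ^ k / (fact k * Gamma (of_real (\<mu> - 1) + of_nat k + 1)) * X ^ (2 * k) = ?a k / of_real (Gamma \<mu>)" for k
  proof -
    have "of_real (\<mu> - 1) + of_nat k + 1 = complex_of_real (\<mu> + real k)" by simp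
    hence "Gamma (of_real (\<mu> - 1) + of_nat k + 1) = complex_of_real (Gamma (\<mu> + real k))"
      by (simp only: Gamma_complex_of_real)
    also have "Gamma (\<mu> + real k) = pochhammer \<mu> k * Gamma \<mu>"
      using pochhammer_eq_Gamma_quotient[of \<mu> k] Gn \<mu> by simp
    finally have "Gamma (of_real (\<mu> - 1) + of_nat k + 1) = complex_of_real (pochhammer \<mu> k * Gamma \<mu>)" .
    moreover have "(- of_real (\<beta> * \<xi>\<^sup>2) * z) ^ k = (-1) ^ k * (of_real (\<beta> * \<xi>\<^sup>2) * z) ^ k"
      unfolding mult_minus_left by (rule power_minus)
    ultimately show ?thesis unfolding X2 by (simp add: mult_ac)
  qed
  have half: "2 * csqrt (of_real \<beta> * z) * of_real \<xi> / 2 = X" by (simp add: X_def)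
  have "bessel_J (of_real (\<mu> - 1)) (2 * csqrt (of_real \<beta> * z) * of_real \<xi>) = X powr of_real (\<mu> - 1) * (\<Sum>k. ?a k / of_real (Gamma \<mu>))"
    unfolding bessel_J_def half summand ..
  also have "(\<Sum>k. ?a k / of_real (Gamma \<mu>)) = (\<Sum>k. ?a k) / of_real (Gamma \<mu>)"
    by (rule suminf_divide[OF summable_norm_cancel[OF kampe_de_feriet_confluent(1)[OF \<mu>]]])
  finally have "z powr of_real ((1 - \<mu>) / 2) * exp z * bessel_J (of_real (\<mu> - 1)) (2 * csqrt (of_real \<beta> * z) * of_real \<xi>) =
      (z powr of_real ((1 - \<mu>) / 2) * X powr of_real (\<mu> - 1)) * (exp z * (\<Sum>k. ?a k)) / of_real (Gamma \<mu>)"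
    by (simp add: mult_ac)
  also have "\<dots> = of_real (\<beta> powr ((\<mu> - 1) / 2) * \<xi> powr (\<mu> - 1) / Gamma \<mu>) * (exp z * (\<Sum>k. ?a k))"
    unfolding powers by simp
  also have "exp z * (\<Sum>k. ?a k) = kampe_de_feriet 1 1 (of_real \<mu>) z (- of_real (\<beta> * \<xi>\<^sup>2) * z)"
    by (rule kampe_de_feriet_confluent(2)[OF \<mu>, symmetric])
  also have "- of_real (\<beta> * \<xi>\<^sup>2) * z = - of_real \<beta> * z * of_real (\<xi>\<^sup>2)" by simp
  finally show ?thesis .
qed

lemma bargmann_eq_bargmann_bessel:
  assumes \<mu>: "\<mu> \<ge> 1" and \<beta>: "\<beta> > 0" and z: "z \<noteq> 0"
  shows "bargmann \<mu> 0 \<beta> \<phi> z = bargmann_bessel \<mu> \<beta> \<phi> z"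
proof -
  have G: "Gamma \<mu> > 0" using \<mu> by (intro Gamma_real_pos) simp
  \<comment> \<open>The factor \<beta> powr ((\<mu> - 1) / 2) / \<Gamma>(\<mu>) left over from the
    Bessel function turns one normalization into the other.\<close>
  have const: "sqrt (2 * \<beta> * Gamma \<mu>) * (\<beta> powr ((\<mu> - 1) / 2) / Gamma \<mu>) = sqrt (2 * \<beta> powr \<mu> / Gamma \<mu>)"
  proof (rule power2_eq_imp_eq)
    have "(\<beta> powr ((\<mu> - 1) / 2))\<^sup>2 = \<beta> powr (\<mu> - 1)" by (simp add: power2_eq_square flip: powr_add)
    moreover have "\<beta> powr \<mu> = \<beta> powr (\<mu> - 1) * \<beta>" using \<beta> by (simp add: powr_diff)
    ultimately show "(sqrt (2 * \<beta> * Gamma \<mu>) * (\<beta> powr ((\<mu> - 1) / 2) / Gamma \<mu>))\<^sup>2 = (sqrt (2 * \<beta> powr \<mu> / Gamma \<mu>))\<^sup>2"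
      using \<beta> G by (simp add: power_mult_distrib power_divide less_imp_le) (simp add: power2_eq_square)
  qed (use \<beta> G in \<open>auto simp: less_imp_le\<close>)
  let ?c = "of_real (sqrt (2 * \<beta> * Gamma \<mu>)) * z powr of_real ((1 - \<mu>) / 2) * exp z"
  have "?c * (of_real (\<xi> powr (1/2) * exp (- (1/2) * \<beta> * \<xi>\<^sup>2))
            * bessel_J (of_real (\<mu> - 1)) (2 * csqrt (of_real \<beta> * z) * of_real \<xi>) * \<phi> \<xi>) =
      of_real (sqrt (2 * \<beta> powr \<mu> / Gamma \<mu>)) * (bargmann_kernel \<mu> 0 \<beta> z \<xi> * \<phi> \<xi>)" if "\<xi> > 0" for \<xi>
  proof -
    let ?K = "kampe_de_feriet 1 1 (of_real \<mu>) z (- of_real \<beta> * z * of_real (\<xi>\<^sup>2))"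
    have "?c * (of_real (\<xi> powr (1/2) * exp (- (1/2) * \<beta> * \<xi>\<^sup>2))
            * bessel_J (of_real (\<mu> - 1)) (2 * csqrt (of_real \<beta> * z) * of_real \<xi>) * \<phi> \<xi>) =
        of_real (sqrt (2 * \<beta> * Gamma \<mu>)) * of_real (\<xi> powr (1/2) * exp (- (1/2) * \<beta> * \<xi>\<^sup>2)) *
        (z powr of_real ((1 - \<mu>) / 2) * exp z * bessel_J (of_real (\<mu> - 1)) (2 * csqrt (of_real \<beta> * z) * of_real \<xi>)) * \<phi> \<xi>"
      by (simp only: mult_ac)
    also have "\<dots> = of_real (sqrt (2 * \<beta> * Gamma \<mu>) * (\<beta> powr ((\<mu> - 1) / 2) / Gamma \<mu>) *
        (\<xi> powr (1/2) * \<xi> powr (\<mu> - 1) * exp (- (1/2) * \<beta> * \<xi>\<^sup>2))) * ?K * \<phi> \<xi>"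
      unfolding bessel_J_csqrt[OF \<mu> \<beta> that z] by simp
    also have "\<xi> powr (1/2) * \<xi> powr (\<mu> - 1) = \<xi> powr (\<mu> - 1/2)" by (simp flip: powr_add)
    finally show ?thesis unfolding const bargmann_kernel_def by (simp only: of_real_mult mult.assoc add_0 of_real_1)
  qed
  hence "(\<integral>\<xi>. ?c * (of_real (\<xi> powr (1/2) * exp (- (1/2) * \<beta> * \<xi>\<^sup>2))
            * bessel_J (of_real (\<mu> - 1)) (2 * csqrt (of_real \<beta> * z) * of_real \<xi>) * \<phi> \<xi>) \<partial>half_line) =
      (\<integral>\<xi>. of_real (sqrt (2 * \<beta> powr \<mu> / Gamma \<mu>)) * (bargmann_kernel \<mu> 0 \<beta> z \<xi> * \<phi> \<xi>) \<partial>half_line)"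
    by (intro Bochner_Integration.integral_cong refl) (simp only: half_line_space greaterThan_iff)
  thus ?thesis unfolding bargmann_def bargmann_bessel_def integral_mult_right_zero by (rule sym)
qed

theorem theorem4p3p1:
  fixes \<mu> \<sigma> \<beta> :: real
  assumes "\<mu> > 3/2" and "-1 < \<sigma>" and "\<sigma> \<le> 0" and "\<beta> > 0"
  shows "(\<forall>\<phi>\<in>L2 half_line. \<forall>z. integrable half_line (\<lambda>\<xi>. bargmann_kernel \<mu> \<sigma> \<beta> z \<xi> * \<phi> \<xi>)) \<and>
    unitary_map (L2 half_line) (l2_inner half_line)
      (entire_space \<mu> \<sigma>) (l2_inner (nu_measure \<mu> \<sigma>)) (bargmann \<mu> \<sigma> \<beta>) \<and>
    (\<forall>\<phi>\<in>L2 half_line.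
      (\<forall>z. z \<noteq> 0 \<longrightarrow> bargmann \<mu> 0 \<beta> \<phi> z = bargmann_bessel \<mu> \<beta> \<phi> z) \<and>
      (bargmann_bessel \<mu> \<beta> \<phi> \<longlongrightarrow> bargmann \<mu> 0 \<beta> \<phi> 0) (at 0))"
proof (intro conjI ballI allI impI)
  show "unitary_map (L2 half_line) (l2_inner half_line)
      (entire_space \<mu> \<sigma>) (l2_inner (nu_measure \<mu> \<sigma>)) (bargmann \<mu> \<sigma> \<beta>)"
    by (rule bargmann_unitary[OF assms])
  fix \<phi> :: "real \<Rightarrow> complex" assume \<phi>: "\<phi> \<in> L2 half_line"
  show "integrable half_line (\<lambda>\<xi>. bargmann_kernel \<mu> \<sigma> \<beta> z \<xi> * \<phi> \<xi>)" for z
    by (rule bargmann_expansion(1)[OF assms \<phi>])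
  show eq: "bargmann \<mu> 0 \<beta> \<phi> z = bargmann_bessel \<mu> \<beta> \<phi> z" if "z \<noteq> 0" for z
    using assms that by (intro bargmann_eq_bargmann_bessel) auto
  \<comment> \<open>The two zeros instantiate \<sigma> and the point: the Bessel form concerns
    \<sigma> = 0 irrespective of the \<sigma> in the unitarity claim.\<close>
  have "(bargmann \<mu> 0 \<beta> \<phi> \<longlongrightarrow> bargmann \<mu> 0 \<beta> \<phi> 0) (at 0)"
    using isCont_bargmann[OF assms(1) _ _ assms(4) \<phi>, of 0 0] by (simp add: isCont_def)
  moreover have "\<forall>\<^sub>F z in at 0. bargmann \<mu> 0 \<beta> \<phi> z = bargmann_bessel \<mu> \<beta> \<phi> z"
    by (simp add: eventually_at_filter eq)
  ultimately show "(bargmann_bessel \<mu> \<beta> \<phi> \<longlongrightarrow> bargmann \<mu> 0 \<beta> \<phi> 0) (at 0)"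
    by (rule Lim_transform_eventually)
qed

end
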